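(* Let $n\ge 1$ be an integer and let $\mathcal{A}$ be a $C^*$-algebra generated by $n$ elements $a_1,\dots,a_n$, i.e. $\mathcal{A}=C^*(a_1,\dots,a_n)$. Put $\delta(n)=\min\{k\in\mathbb{N} : (k-1)(k-2)\ge 2n\}$. Then for every integer $k\ge\delta(n)$, the matrix algebra $\mathrm{M}_k(\tilde{\mathcal{A}})$ is generated by $k$ mutually unitarily equivalent and almost mutually orthogonal projections.
   Context: $\mathbb{N}$ denotes the positive integers. $C^*(S)$ denotes the $C^*$-subalgebra generated by a set $S$. $\tilde{\mathcal{A}}$ denotes the $C^*$-algebra obtained by adjoining a unit to $\mathcal{A}$ if $\mathcal{A}$ is non-unital, and $\tilde{\mathcal{A}}=\mathcal{A}$ if $\mathcal{A}$ is unital. $\mathrm{M}_k(\tilde{\mathcal{A}})$ is the $C^*$-algebra of $k\times k$ matrices over $\tilde{\mathcal{A}}$. Projections are self-adjoint idempotents. Definition. A unital $C^*$-algebra $\mathcal{E}$ is said to be generated by $n$ ($n\ge 2$) mutually unitarily equivalent and almost mutually orthogonal projections if for every $\epsilon>0$ there exist projections $p_1,\dots,p_n$ in $\mathcal{E}$ such that: (1) $p_1+\cdots+p_n$ is invertible in $\mathcal{E}$; (2) $C^*(p_1,\dots,p_n)=\mathcal{E}$; (3) for all $i\ne j$, $p_i$ is unitarily equivalent to $p_j$ in $\mathcal{E}$ (that is, $p_j=up_iu^*$ for some unitary $u\in\mathcal{E}$) and $\|p_ip_j\|<\epsilon$. *)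

theory Defs
  imports
    Complex_Main
    "HOL-Analysis.Abstract_Metric_Spaces"
    "HOL-Algebra.Algebraic_Closure_Type"
    "Jordan_Normal_Form.Matrix"
begin

section \<open>C*-algebras\<close>

text \<open>
  Since a C*-algebra need not have a unit, the field \<open>one\<close> inherited from rings is meaningless
  for a general \<open>A\<close>. It is specified only by \<open>unital_cstar_algebra\<close>, and nothing below reads
  it for an algebra that is not assumed to be unital.
\<close>

record 'a cstar = "(complex, 'a) module" +
  star :: "'a \<Rightarrow> 'a"
  cnorm :: "'a \<Rightarrow> real"

text \<open>
  The value off the carrier is fixed because \<open>Metric_space\<close> demands nonnegativity and symmetry of
  the distance function on the whole type.
\<close>

definition cdist :: "'a cstar \<Rightarrow> 'a \<Rightarrow> 'a \<Rightarrow> real"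
  where "cdist A x y =
    (if x \<in> carrier A \<and> y \<in> carrier A then cnorm A (x \<ominus>\<^bsub>A\<^esub> y) else 0)"

locale cstar_algebra = module "ring_of_type_algebra :: complex ring" A
  for A :: "'a cstar" (structure) +
  assumes mult_closed: "\<lbrakk>x \<in> carrier A; y \<in> carrier A\<rbrakk> \<Longrightarrow> x \<otimes> y \<in> carrier A"
    and mult_assoc: "\<lbrakk>x \<in> carrier A; y \<in> carrier A; z \<in> carrier A\<rbrakk>
      \<Longrightarrow> (x \<otimes> y) \<otimes> z = x \<otimes> (y \<otimes> z)"
    and mult_add_left: "\<lbrakk>x \<in> carrier A; y \<in> carrier A; z \<in> carrier A\<rbrakk>
      \<Longrightarrow> (x \<oplus> y) \<otimes> z = x \<otimes> z \<oplus> y \<otimes> z"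
    and mult_add_right: "\<lbrakk>x \<in> carrier A; y \<in> carrier A; z \<in> carrier A\<rbrakk>
      \<Longrightarrow> z \<otimes> (x \<oplus> y) = z \<otimes> x \<oplus> z \<otimes> y"
    and mult_smult_left: "\<lbrakk>x \<in> carrier A; y \<in> carrier A\<rbrakk> \<Longrightarrow> (c \<odot> x) \<otimes> y = c \<odot> (x \<otimes> y)"
    and mult_smult_right: "\<lbrakk>x \<in> carrier A; y \<in> carrier A\<rbrakk> \<Longrightarrow> x \<otimes> (c \<odot> y) = c \<odot> (x \<otimes> y)"
    and star_closed: "x \<in> carrier A \<Longrightarrow> star A x \<in> carrier A"
    and star_star: "x \<in> carrier A \<Longrightarrow> star A (star A x) = x"
    and star_add: "\<lbrakk>x \<in> carrier A; y \<in> carrier A\<rbrakk> \<Longrightarrow> star A (x \<oplus> y) = star A x \<oplus> star A y"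
    and star_smult: "x \<in> carrier A \<Longrightarrow> star A (c \<odot> x) = cnj c \<odot> star A x"
    and star_mult: "\<lbrakk>x \<in> carrier A; y \<in> carrier A\<rbrakk> \<Longrightarrow> star A (x \<otimes> y) = star A y \<otimes> star A x"
    and cnorm_nonneg: "x \<in> carrier A \<Longrightarrow> 0 \<le> cnorm A x"
    and cnorm_eq_0: "x \<in> carrier A \<Longrightarrow> cnorm A x = 0 \<longleftrightarrow> x = \<zero>"
    and cnorm_triangle: "\<lbrakk>x \<in> carrier A; y \<in> carrier A\<rbrakk> \<Longrightarrow> cnorm A (x \<oplus> y) \<le> cnorm A x + cnorm A y"
    and cnorm_smult: "x \<in> carrier A \<Longrightarrow> cnorm A (c \<odot> x) = cmod c * cnorm A x"
    and cnorm_mult: "\<lbrakk>x \<in> carrier A; y \<in> carrier A\<rbrakk> \<Longrightarrow> cnorm A (x \<otimes> y) \<le> cnorm A x * cnorm A y"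
    and cnorm_star_mult: "x \<in> carrier A \<Longrightarrow> cnorm A (star A x \<otimes> x) = (cnorm A x)\<^sup>2"
    and complete: "Metric_space.mcomplete (carrier A) (cdist A)"

locale unital_cstar_algebra = cstar_algebra +
  assumes one_closed: "\<one> \<in> carrier A"
    and one_left: "x \<in> carrier A \<Longrightarrow> \<one> \<otimes> x = x"
    and one_right: "x \<in> carrier A \<Longrightarrow> x \<otimes> \<one> = x"

definition cstar_subalgebra :: "'a set \<Rightarrow> 'a cstar \<Rightarrow> bool"
  where "cstar_subalgebra B A \<longleftrightarrow>
    B \<subseteq> carrier A \<and>
    \<zero>\<^bsub>A\<^esub> \<in> B \<and>
    (\<forall>x\<in>B. \<forall>y\<in>B. x \<oplus>\<^bsub>A\<^esub> y \<in> B \<and> x \<otimes>\<^bsub>A\<^esub> y \<in> B) \<and>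
    (\<forall>c. \<forall>x\<in>B. c \<odot>\<^bsub>A\<^esub> x \<in> B) \<and>
    (\<forall>x\<in>B. star A x \<in> B) \<and>
    closedin (Metric_space.mtopology (carrier A) (cdist A)) B"

text \<open>A C*-subalgebra of a unital algebra is not required to contain the unit.\<close>

definition cstar_generated :: "'a cstar \<Rightarrow> 'a set \<Rightarrow> 'a set"
  where "cstar_generated A S = \<Inter>{B. cstar_subalgebra B A \<and> S \<subseteq> B}"

section \<open>Adjoining a unit\<close>

definition is_unit_of :: "'a cstar \<Rightarrow> 'a \<Rightarrow> bool"
  where "is_unit_of A e \<longleftrightarrow>
    e \<in> carrier A \<and> (\<forall>x\<in>carrier A. e \<otimes>\<^bsub>A\<^esub> x = x \<and> x \<otimes>\<^bsub>A\<^esub> e = x)"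

definition has_unit :: "'a cstar \<Rightarrow> bool"
  where "has_unit A \<longleftrightarrow> (\<exists>e. is_unit_of A e)"

text \<open>
  The pair \<open>(a, s)\<close> stands for \<open>a + s 1\<close>. If \<open>A\<close> has a unit, only the pairs \<open>(a, 0)\<close> are used, so
  that the result is a copy of \<open>A\<close> itself. Otherwise the norm is that of the operator of left
  multiplication by \<open>a + s 1\<close> on \<open>A\<close>, which is the unique C*-norm on the unitization.
\<close>

definition unitization :: "'a cstar \<Rightarrow> ('a \<times> complex) cstar"
  where "unitization A = \<lparr>
    carrier = (if has_unit A then carrier A \<times> {0} else carrier A \<times> UNIV),
    monoid.mult = (\<lambda>(a, s) (b, t). ((a \<otimes>\<^bsub>A\<^esub> b \<oplus>\<^bsub>A\<^esub> s \<odot>\<^bsub>A\<^esub> b) \<oplus>\<^bsub>A\<^esub> t \<odot>\<^bsub>A\<^esub> a, s * t)),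
    one = (if has_unit A then (THE e. is_unit_of A e, 0) else (\<zero>\<^bsub>A\<^esub>, 1)),
    ring.zero = (\<zero>\<^bsub>A\<^esub>, 0),
    add = (\<lambda>(a, s) (b, t). (a \<oplus>\<^bsub>A\<^esub> b, s + t)),
    module.smult = (\<lambda>c (a, s). (c \<odot>\<^bsub>A\<^esub> a, c * s)),
    star = (\<lambda>(a, s). (star A a, cnj s)),
    cnorm = (\<lambda>(a, s). if has_unit A then cnorm A a
      else (SUP x\<in>{x \<in> carrier A. cnorm A x \<le> 1}. cnorm A (a \<otimes>\<^bsub>A\<^esub> x \<oplus>\<^bsub>A\<^esub> s \<odot>\<^bsub>A\<^esub> x))) \<rparr>"

section \<open>Matrix algebras\<close>

text \<open>
  The C*-norm on \<open>k \<times> k\<close> matrices over \<open>B\<close> is the operator norm for the action on the Hilbert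
  \<open>B\<close>-module \<open>B\<^sup>k\<close>, whose inner product is \<open>\<langle>x, y\<rangle> = \<Sum>\<^sub>i x\<^sub>i\<^sup>* y\<^sub>i\<close> and whose norm is
  \<open>\<parallel>\<langle>x, x\<rangle>\<parallel>\<^bsup>1/2\<^esup>\<close>. Indices run from 0 to \<open>k - 1\<close>.
\<close>

definition column_norm :: "'a cstar \<Rightarrow> nat \<Rightarrow> (nat \<Rightarrow> 'a) \<Rightarrow> real"
  where "column_norm B k x = sqrt (cnorm B (\<Oplus>\<^bsub>B\<^esub>i\<in>{..<k}. star B (x i) \<otimes>\<^bsub>B\<^esub> x i))"

definition mat_apply :: "'a cstar \<Rightarrow> nat \<Rightarrow> 'a mat \<Rightarrow> (nat \<Rightarrow> 'a) \<Rightarrow> nat \<Rightarrow> 'a"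
  where "mat_apply B k M x i = (\<Oplus>\<^bsub>B\<^esub>j\<in>{..<k}. M $$ (i, j) \<otimes>\<^bsub>B\<^esub> x j)"

definition mat_cstar :: "nat \<Rightarrow> 'a cstar \<Rightarrow> 'a mat cstar"
  where "mat_cstar k B = \<lparr>
    carrier = {M \<in> carrier_mat k k. \<forall>i<k. \<forall>j<k. M $$ (i, j) \<in> carrier B},
    monoid.mult = (\<lambda>M N. mat k k (\<lambda>(i, j). \<Oplus>\<^bsub>B\<^esub>l\<in>{..<k}. M $$ (i, l) \<otimes>\<^bsub>B\<^esub> N $$ (l, j))),
    one = mat k k (\<lambda>(i, j). if i = j then \<one>\<^bsub>B\<^esub> else \<zero>\<^bsub>B\<^esub>),
    ring.zero = mat k k (\<lambda>_. \<zero>\<^bsub>B\<^esub>),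
    add = (\<lambda>M N. mat k k (\<lambda>(i, j). M $$ (i, j) \<oplus>\<^bsub>B\<^esub> N $$ (i, j))),
    module.smult = (\<lambda>c M. mat k k (\<lambda>(i, j). c \<odot>\<^bsub>B\<^esub> M $$ (i, j))),
    star = (\<lambda>M. mat k k (\<lambda>(i, j). star B (M $$ (j, i)))),
    cnorm = (\<lambda>M. SUP x\<in>{x \<in> {..<k} \<rightarrow> carrier B. column_norm B k x \<le> 1}.
      column_norm B k (mat_apply B k M x)) \<rparr>"

section \<open>Almost orthogonal generating projections\<close>

definition projection :: "'a cstar \<Rightarrow> 'a \<Rightarrow> bool"
  where "projection E p \<longleftrightarrow> p \<in> carrier E \<and> star E p = p \<and> p \<otimes>\<^bsub>E\<^esub> p = p"

definition unitary :: "'a cstar \<Rightarrow> 'a \<Rightarrow> bool"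
  where "unitary E u \<longleftrightarrow>
    u \<in> carrier E \<and> star E u \<otimes>\<^bsub>E\<^esub> u = \<one>\<^bsub>E\<^esub> \<and> u \<otimes>\<^bsub>E\<^esub> star E u = \<one>\<^bsub>E\<^esub>"

definition unitarily_equivalent :: "'a cstar \<Rightarrow> 'a \<Rightarrow> 'a \<Rightarrow> bool"
  where "unitarily_equivalent E p q \<longleftrightarrow> (\<exists>u. unitary E u \<and> q = u \<otimes>\<^bsub>E\<^esub> p \<otimes>\<^bsub>E\<^esub> star E u)"

definition generated_by_almost_orthogonal_projections :: "'a cstar \<Rightarrow> nat \<Rightarrow> bool"
  where "generated_by_almost_orthogonal_projections E n \<longleftrightarrow>
    unital_cstar_algebra E \<and> n \<ge> 2 \<and>
    (\<forall>\<epsilon>>0. \<exists>p :: nat \<Rightarrow> 'a.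
      (\<forall>i\<in>{1..n}. projection E (p i)) \<and>
      (\<Oplus>\<^bsub>E\<^esub>i\<in>{1..n}. p i) \<in> Units E \<and>
      cstar_generated E (p ` {1..n}) = carrier E \<and>
      (\<forall>i\<in>{1..n}. \<forall>j\<in>{1..n}. i \<noteq> j \<longrightarrow>
        unitarily_equivalent E (p i) (p j) \<and> cnorm E (p i \<otimes>\<^bsub>E\<^esub> p j) < \<epsilon>))"

definition delta :: "nat \<Rightarrow> nat"
  where "delta n = (LEAST k. 1 \<le> k \<and> (int k - 1) * (int k - 2) \<ge> 2 * int n)"

end

theory Submission
  imports Defs
begin

text \<open>
  Let \<open>B\<close> be the unitization of \<open>A\<close>. Take \<open>p\<^sub>j = v\<^sub>j v\<^sub>j\<^sup>*\<close>, where \<open>v\<^sub>0, \<dots>, v\<^bsub>k - 1\<^esub>\<close> are the unit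
  columns of an upper triangular matrix over \<open>B\<close> close to the identity, so that \<open>p\<^sub>j\<close> is close to
  the matrix unit \<open>e\<^bsub>jj\<^esub>\<close>; hence the \<open>p\<^sub>j\<close> are almost orthogonal, unitarily equivalent and have an
  invertible sum. In the first row of this matrix put a small scalar \<open>\<eta>\<close>; the remaining
  \<open>(k - 1) (k - 2) / 2 \<ge> n\<close> entries above the diagonal hold multiples of the generators.
  If \<open>C\<close> contains all \<open>p\<^sub>j\<close> then \<open>e\<^bsub>00\<^esub> = p\<^sub>0 \<in> C\<close>, and inductively
  \<open>e\<^bsub>00\<^esub> p\<^sub>j e\<^bsub>i0\<^esub> = \<eta> b\<^bsub>ij\<^esub>\<^sup>* e\<^bsub>00\<^esub>\<close> puts the entries \<open>b\<^bsub>ij\<^esub>\<close>, hence also the invertible diagonal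
  entry \<open>s\<^sub>j\<close>, into the corner of \<open>C\<close>, and what is left of \<open>e\<^bsub>00\<^esub> p\<^sub>j\<close> is \<open>\<eta> s\<^sub>j e\<^bsub>0j\<^esub>\<close>, which gives \<open>e\<^bsub>0j\<^esub> \<in> C\<close>.

  That matrix algebras are C*-algebras rests on the positivity of \<open>x\<^sup>* x\<close>, obtained here without
  spectral theory: \<open>x\<close> is positive if it is self-adjoint and \<open>\<parallel>t - x\<parallel> \<le> t\<close> for some \<open>t\<close>.
\<close>

text \<open>A rank-one projection shows only products \<open>v\<^sub>r v\<^sub>c\<^sup>*\<close> of
  the entries of its column, never an entry alone. The scalar \<open>\<eta>\<close> in row 0 is the
  known factor from which the others can be read. It costs \<open>k - 1\<close> of the
  \<open>k (k - 1) / 2\<close> entries above the diagonal, which explains the count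
  \<open>(k - 1) (k - 2) / 2\<close>. The triangular shape makes the first projection exactly a
  matrix unit and lets column \<open>j\<close> meet only rows whose matrix units are already
  available. The unit of \<open>B\<close> takes no entry, since that first projection puts 1 into
  the corner. A subalgebra is not known beforehand to contain square roots or inverses. They are
  therefore built as limits inside the algebra generated by their argument, and membership in that
  algebra is recorded along with them. The remaining properties hold for any unit columns within
  \<open>\<eta>\<close> of the standard basis, so \<open>\<eta>\<close> depends on \<open>k\<close>
  and \<open>\<epsilon>\<close> only and the generators are scaled to fit. Positivity enters through
  the norm of a column, the root of the norm of a sum of terms \<open>x\<^sup>* x\<close>: its
  triangle inequality needs these sums to be positive.\<close>

locale normed_module = module "ring_of_type_algebra :: complex ring" A
  for A :: "'a cstar" (structure) +
  assumes norm_nonneg: "x \<in> carrier A \<Longrightarrow> 0 \<le> cnorm A x"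
    and norm_eq_0: "x \<in> carrier A \<Longrightarrow> cnorm A x = 0 \<longleftrightarrow> x = \<zero>"
    and norm_triangle: "\<lbrakk>x \<in> carrier A; y \<in> carrier A\<rbrakk> \<Longrightarrow> cnorm A (x \<oplus> y) \<le> cnorm A x + cnorm A y"
    and norm_smult: "x \<in> carrier A \<Longrightarrow> cnorm A (c \<odot> x) = cmod c * cnorm A x"

sublocale cstar_algebra \<subseteq> normed_module
  by unfold_locales (simp_all add: cnorm_nonneg cnorm_eq_0 cnorm_triangle cnorm_smult)

section \<open>Sequential limits, completeness and closed sets in a normed module\<close>

definition tends :: "'a cstar \<Rightarrow> (nat \<Rightarrow> 'a) \<Rightarrow> 'a \<Rightarrow> bool"
  where "tends A f l \<longleftrightarrow> (\<forall>n. f n \<in> carrier A) \<and> l \<in> carrier A \<and>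
    (\<lambda>n. cnorm A (f n \<ominus>\<^bsub>A\<^esub> l)) \<longlonglongrightarrow> 0"

definition cauchy :: "'a cstar \<Rightarrow> (nat \<Rightarrow> 'a) \<Rightarrow> bool"
  where "cauchy A f \<longleftrightarrow> (\<forall>n. f n \<in> carrier A) \<and>
    (\<forall>e>0. \<exists>N. \<forall>m\<ge>N. \<forall>n\<ge>N. cnorm A (f m \<ominus>\<^bsub>A\<^esub> f n) < e)"

context normed_module
begin

lemma scalar_simps [simp]:
  "carrier (ring_of_type_algebra :: complex ring) = UNIV"
  "c \<oplus>\<^bsub>ring_of_type_algebra\<^esub> d = c + d"
  "c \<otimes>\<^bsub>ring_of_type_algebra\<^esub> d = c * d"
  "\<one>\<^bsub>ring_of_type_algebra\<^esub> = (1 :: complex)"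
  "\<zero>\<^bsub>ring_of_type_algebra\<^esub> = (0 :: complex)"
  by (simp_all add: ring_of_type_algebra_def)

lemma smult_in [simp, intro]: "x \<in> carrier A \<Longrightarrow> c \<odot> x \<in> carrier A"
  using smult_closed[of c x] by simp

lemma smult_add_left: "x \<in> carrier A \<Longrightarrow> (c + d) \<odot> x = c \<odot> x \<oplus> d \<odot> x"
  using smult_l_distr[of c d x] by simp

lemma smult_add_right: "\<lbrakk>x \<in> carrier A; y \<in> carrier A\<rbrakk> \<Longrightarrow> c \<odot> (x \<oplus> y) = c \<odot> x \<oplus> c \<odot> y"
  using smult_r_distr[of c x y] by simp

lemma smult_smult [simp]: "x \<in> carrier A \<Longrightarrow> c \<odot> (d \<odot> x) = (c * d) \<odot> x"
  using smult_assoc1[of c d x] by simp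

lemma smult_1 [simp]: "x \<in> carrier A \<Longrightarrow> 1 \<odot> x = x"
  using smult_one[of x] by simp

lemma smult_0 [simp]: "x \<in> carrier A \<Longrightarrow> 0 \<odot> x = \<zero>"
  using smult_l_null[of x] by simp

lemma smult_zero [simp]: "c \<odot> \<zero> = \<zero>"
  using smult_r_null[of c] by simp

lemmas add_closed [simp, intro] = M.a_closed
  and minus_in [simp, intro] = M.minus_closed
  and neg_closed [simp, intro] = M.a_inv_closed
  and zero_in [simp, intro] = M.zero_closed

lemma neg_smult: "x \<in> carrier A \<Longrightarrow> \<ominus> x = (-1) \<odot> x"
  by (rule M.minus_equality) (use smult_add_left[of x "-1" 1] in simp_all)

lemma minus_smult: "\<lbrakk>x \<in> carrier A; y \<in> carrier A\<rbrakk> \<Longrightarrow> x \<ominus> y = x \<oplus> (-1) \<odot> y"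
  by (simp add: M.minus_eq neg_smult)

lemma minus_self [simp]: "x \<in> carrier A \<Longrightarrow> x \<ominus> x = \<zero>"
  by (simp add: M.minus_eq M.r_neg)

lemma minus_zero_right [simp]: "x \<in> carrier A \<Longrightarrow> x \<ominus> \<zero> = x"
  by (simp add: minus_smult)

lemma minus_eq_zero: "\<lbrakk>x \<in> carrier A; y \<in> carrier A; x \<ominus> y = \<zero>\<rbrakk> \<Longrightarrow> x = y"
  using M.minus_equality[of x "\<ominus> y"] by (simp add: M.minus_eq M.minus_minus)

lemma minus_add_cancel: "\<lbrakk>x \<in> carrier A; y \<in> carrier A\<rbrakk> \<Longrightarrow> (x \<ominus> y) \<oplus> y = x"
  by (simp add: M.minus_eq M.a_assoc M.l_neg)

lemma minus_add_minus: "\<lbrakk>x \<in> carrier A; y \<in> carrier A; z \<in> carrier A\<rbrakk> \<Longrightarrow> x \<ominus> z = (x \<ominus> y) \<oplus> (y \<ominus> z)"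
  by (simp add: M.minus_eq M.a_assoc M.r_neg1)

lemma neg_minus: "\<lbrakk>x \<in> carrier A; y \<in> carrier A\<rbrakk> \<Longrightarrow> \<ominus> (x \<ominus> y) = y \<ominus> x"
  by (simp add: M.minus_eq M.minus_add M.a_comm M.minus_minus)

lemma smult_minus_right: "\<lbrakk>x \<in> carrier A; y \<in> carrier A\<rbrakk> \<Longrightarrow> c \<odot> (x \<ominus> y) = c \<odot> x \<ominus> c \<odot> y"
  by (simp add: minus_smult smult_add_right)

lemma add_minus_add: "\<lbrakk>x \<in> carrier A; y \<in> carrier A; z \<in> carrier A; w \<in> carrier A\<rbrakk>
    \<Longrightarrow> (x \<oplus> y) \<ominus> (z \<oplus> w) = (x \<ominus> z) \<oplus> (y \<ominus> w)"
  by (simp add: minus_smult smult_add_right M.a_ac)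

lemma norm_zero [simp]: "cnorm A \<zero> = 0"
  by (simp add: norm_eq_0)

lemma norm_neg [simp]: "x \<in> carrier A \<Longrightarrow> cnorm A (\<ominus> x) = cnorm A x"
  by (simp add: neg_smult norm_smult)

lemma norm_minus_commute: "\<lbrakk>x \<in> carrier A; y \<in> carrier A\<rbrakk> \<Longrightarrow> cnorm A (x \<ominus> y) = cnorm A (y \<ominus> x)"
  by (metis neg_minus minus_in norm_neg)

lemma norm_minus_triangle: "\<lbrakk>x \<in> carrier A; y \<in> carrier A\<rbrakk> \<Longrightarrow> cnorm A (x \<ominus> y) \<le> cnorm A x + cnorm A y"
  using norm_triangle[of x "\<ominus> y"] by (simp add: M.minus_eq)

lemma norm_dist_triangle: "\<lbrakk>x \<in> carrier A; y \<in> carrier A; z \<in> carrier A\<rbrakk>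
    \<Longrightarrow> cnorm A (x \<ominus> z) \<le> cnorm A (x \<ominus> y) + cnorm A (y \<ominus> z)"
  by (subst minus_add_minus[of x y z]) (auto intro: norm_triangle)

lemma norm_reverse_triangle: "\<lbrakk>x \<in> carrier A; y \<in> carrier A\<rbrakk> \<Longrightarrow> \<bar>cnorm A x - cnorm A y\<bar> \<le> cnorm A (x \<ominus> y)"
  using norm_triangle[of "x \<ominus> y" y] norm_triangle[of "y \<ominus> x" x]
  by (simp add: minus_add_cancel norm_minus_commute[of y x])

lemma norm_finsum: "f \<in> I \<rightarrow> carrier A \<Longrightarrow> cnorm A (\<Oplus>i\<in>I. f i) \<le> (\<Sum>i\<in>I. cnorm A (f i))"
proof (induction I rule: infinite_finite_induct)
  case (insert i I)
  have "cnorm A (\<Oplus>i\<in>insert i I. f i) = cnorm A (f i \<oplus> (\<Oplus>i\<in>I. f i))"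
    using insert by (subst M.finsum_insert) (auto simp: Pi_def)
  also have "\<dots> \<le> cnorm A (f i) + cnorm A (\<Oplus>i\<in>I. f i)"
    using insert by (intro norm_triangle M.finsum_closed) auto
  also have "\<dots> \<le> (\<Sum>i\<in>insert i I. cnorm A (f i))"
    using insert by simp
  finally show ?case .
qed (simp_all add: M.finsum_infinite)

sublocale metric: Metric_space "carrier A" "cdist A"
proof
  show "0 \<le> cdist A x y" for x y by (simp add: cdist_def norm_nonneg)
  show "cdist A x y = cdist A y x" for x y by (simp add: cdist_def norm_minus_commute)
  show "(cdist A x y = 0) = (x = y)" if "x \<in> carrier A" "y \<in> carrier A" for x y
    using that minus_eq_zero[of x y] by (auto simp: cdist_def norm_eq_0)
  show "cdist A x z \<le> cdist A x y + cdist A y z"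
    if "x \<in> carrier A" "y \<in> carrier A" "z \<in> carrier A" for x y z
    using that by (simp add: cdist_def norm_dist_triangle)
qed

text \<open>Topological convergence asks for membership in the carrier only eventually,
  \<open>tends\<close> asks for it at every term; hence the assumption. With all terms in the
  carrier, algebraic identities can be applied termwise in the limit laws.\<close>

lemma tends_iff_limitin:
  assumes "\<And>n. f n \<in> carrier A"
  shows "tends A f l \<longleftrightarrow> limitin metric.mtopology f l sequentially"
  unfolding metric.limitin_metric_dist_null using assms
  by (auto simp: tends_def cdist_def cong: conj_cong)

lemma cauchy_iff_MCauchy: "cauchy A f \<longleftrightarrow> metric.MCauchy f"
proof (cases "\<forall>n. f n \<in> carrier A")
  case True
  then show ?thesis
    by (simp add: cauchy_def metric.MCauchy_def cdist_def image_subset_iff)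
qed (auto simp: cauchy_def metric.MCauchy_def)

lemma mcomplete_iff: "metric.mcomplete \<longleftrightarrow> (\<forall>f. cauchy A f \<longrightarrow> (\<exists>l. tends A f l))"
  unfolding metric.mcomplete_def cauchy_iff_MCauchy[symmetric]
  by (metis tends_iff_limitin cauchy_def)

text \<open>Turns the closedness clause of \<open>cstar_subalgebra\<close> into closure under limits
  of sequences, the form in which subalgebras are handled below.\<close>

lemma closedin_iff: "closedin metric.mtopology S \<longleftrightarrow>
    S \<subseteq> carrier A \<and> (\<forall>f l. (\<forall>n. f n \<in> S) \<and> tends A f l \<longrightarrow> l \<in> S)"
proof (cases "S \<subseteq> carrier A")
  case True
  then have "(\<forall>n. f n \<in> S) \<and> tends A f l \<longleftrightarrow>
      range f \<subseteq> S \<and> limitin metric.mtopology f l sequentially" for f l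
    using tends_iff_limitin[of f l] by blast
  with True show ?thesis
    by (simp add: metric.metric_closedin_iff_sequentially_closed)
qed (simp add: metric.metric_closedin_iff_sequentially_closed)

lemma tends_unique: "\<lbrakk>tends A f l; tends A f m\<rbrakk> \<Longrightarrow> l = m"
  using tends_iff_limitin[of f] metric.limitin_metric_unique[of f _ sequentially]
  by (metis tends_def trivial_limit_sequentially)

lemma tends_const [simp]: "tends A (\<lambda>_. x) x \<longleftrightarrow> x \<in> carrier A"
  by (auto simp: tends_def)

lemma tendsI:
  assumes "\<And>n. f n \<in> carrier A" "l \<in> carrier A" "g \<longlonglongrightarrow> 0" "\<And>n. cnorm A (f n \<ominus> l) \<le> g n"
  shows "tends A f l"
  unfolding tends_def
  using assms by (auto intro!: tendsto_sandwich[OF _ _ tendsto_const[of 0] assms(3)] simp: norm_nonneg)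

lemma tends_Suc: "tends A f l \<Longrightarrow> tends A (\<lambda>n. f (Suc n)) l"
  using LIMSEQ_Suc by (fastforce simp: tends_def)

lemma tends_add: "\<lbrakk>tends A f l; tends A g m\<rbrakk> \<Longrightarrow> tends A (\<lambda>n. f n \<oplus> g n) (l \<oplus> m)"
proof -
  assume fg: "tends A f l" "tends A g m"
  then have "(\<lambda>n. cnorm A (f n \<ominus> l) + cnorm A (g n \<ominus> m)) \<longlonglongrightarrow> 0 + 0"
    unfolding tends_def by (intro tendsto_add) auto
  with fg show ?thesis
    by (intro tendsI[where g = "\<lambda>n. cnorm A (f n \<ominus> l) + cnorm A (g n \<ominus> m)"])
      (auto simp: tends_def add_minus_add intro: norm_triangle)
qed

lemma tends_smult: "tends A f l \<Longrightarrow> tends A (\<lambda>n. c \<odot> f n) (c \<odot> l)"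
proof -
  assume f: "tends A f l"
  then have "(\<lambda>n. cmod c * cnorm A (f n \<ominus> l)) \<longlonglongrightarrow> cmod c * 0"
    unfolding tends_def by (intro tendsto_mult) auto
  with f show ?thesis
    by (intro tendsI[where g = "\<lambda>n. cmod c * cnorm A (f n \<ominus> l)"])
      (auto simp: tends_def smult_minus_right[symmetric] norm_smult)
qed

lemma tends_norm: "tends A f l \<Longrightarrow> (\<lambda>n. cnorm A (f n)) \<longlonglongrightarrow> cnorm A l"
proof -
  assume f: "tends A f l"
  have "(\<lambda>n. cnorm A (f n) - cnorm A l) \<longlonglongrightarrow> 0"
    by (rule Lim_null_comparison[of _ "\<lambda>n. cnorm A (f n \<ominus> l)"])
      (use f in \<open>auto simp: tends_def norm_reverse_triangle\<close>)
  then show ?thesis by (simp add: LIM_zero_iff)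
qed

lemma tends_norm_le: "\<lbrakk>tends A f l; \<And>n. cnorm A (f n) \<le> b\<rbrakk> \<Longrightarrow> cnorm A l \<le> b"
  using tends_norm[of f l] by (rule LIMSEQ_le_const2) auto

text \<open>The majorant \<open>g\<close> acts like a sequence of partial sums: telescoping bounds
  the distance between two terms of \<open>f\<close> by the difference of the corresponding terms of
  \<open>g\<close>, which is a Cauchy sequence. Both the square root and the inverse below are
  limits obtained this way.\<close>

lemma cauchy_majorant:
  assumes f: "\<And>n. f n \<in> carrier A"
    and step: "\<And>n. cnorm A (f (Suc n) \<ominus> f n) \<le> g (Suc n) - g n"
    and g: "convergent (g :: nat \<Rightarrow> real)"
  shows "cauchy A f"
proof -
  have le: "cnorm A (f (n + d) \<ominus> f n) \<le> g (n + d) - g n" for n d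
  proof (induction d)
    case (Suc d)
    have "cnorm A (f (n + Suc d) \<ominus> f n) \<le> cnorm A (f (Suc (n + d)) \<ominus> f (n + d)) + cnorm A (f (n + d) \<ominus> f n)"
      using norm_dist_triangle f by simp
    with Suc step[of "n + d"] show ?case by simp
  qed (simp add: f)
  have "\<exists>N. \<forall>m\<ge>N. \<forall>n\<ge>N. cnorm A (f m \<ominus> f n) < e" if "e > 0" for e
  proof -
    have "Cauchy g" using g by (simp add: Cauchy_convergent_iff)
    with that obtain N where N: "\<forall>m\<ge>N. \<forall>n\<ge>N. \<bar>g m - g n\<bar> < e"
      unfolding Cauchy_def dist_real_def by blast
    have "cnorm A (f m \<ominus> f n) \<le> \<bar>g m - g n\<bar>" for m n
    proof (cases "m \<ge> n")
      case True
      with le[of n "m - n"] show ?thesis by simp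
    next
      case False
      with le[of m "n - m"] show ?thesis by (simp add: f norm_minus_commute[of "f m"])
    qed
    with N show ?thesis by (meson le_less_trans)
  qed
  with f show ?thesis by (simp add: cauchy_def)
qed

end

section \<open>C*-subalgebras and square roots\<close>

context cstar_algebra
begin

lemmas [simp, intro] = mult_closed star_closed
lemmas [simp] = star_star

lemma mult_zero_left [simp]: "x \<in> carrier A \<Longrightarrow> \<zero> \<otimes> x = \<zero>"
  using mult_smult_left[of \<zero> x 0] by simp

lemma mult_zero_right [simp]: "x \<in> carrier A \<Longrightarrow> x \<otimes> \<zero> = \<zero>"
  using mult_smult_right[of x \<zero> 0] by simp

lemma mult_neg_left: "\<lbrakk>x \<in> carrier A; y \<in> carrier A\<rbrakk> \<Longrightarrow> \<ominus> x \<otimes> y = \<ominus> (x \<otimes> y)"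
  by (simp add: neg_smult mult_smult_left)

lemma mult_neg_right: "\<lbrakk>x \<in> carrier A; y \<in> carrier A\<rbrakk> \<Longrightarrow> x \<otimes> \<ominus> y = \<ominus> (x \<otimes> y)"
  by (simp add: neg_smult mult_smult_right)

lemma mult_minus_left: "\<lbrakk>x \<in> carrier A; y \<in> carrier A; z \<in> carrier A\<rbrakk> \<Longrightarrow> (x \<ominus> y) \<otimes> z = x \<otimes> z \<ominus> y \<otimes> z"
  by (simp add: M.minus_eq mult_add_left mult_neg_left)

lemma mult_minus_right: "\<lbrakk>x \<in> carrier A; y \<in> carrier A; z \<in> carrier A\<rbrakk> \<Longrightarrow> z \<otimes> (x \<ominus> y) = z \<otimes> x \<ominus> z \<otimes> y"
  by (simp add: M.minus_eq mult_add_right mult_neg_right)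

lemma star_zero [simp]: "star A \<zero> = \<zero>"
  using star_smult[of \<zero> 0] by simp

lemma star_neg: "x \<in> carrier A \<Longrightarrow> star A (\<ominus> x) = \<ominus> star A x"
  by (simp add: neg_smult star_smult)

lemma star_minus: "\<lbrakk>x \<in> carrier A; y \<in> carrier A\<rbrakk> \<Longrightarrow> star A (x \<ominus> y) = star A x \<ominus> star A y"
  by (simp add: M.minus_eq star_add star_neg)

text \<open>The C*-identity and submultiplicativity give \<open>\<parallel>x\<parallel>\<^sup>2
  \<le> \<parallel>x\<^sup>*\<parallel> \<parallel>x\<parallel>\<close>. Cancelling one factor and
  exchanging \<open>x\<close> with its adjoint gives both inequalities.\<close>

lemma norm_star [simp]: "x \<in> carrier A \<Longrightarrow> cnorm A (star A x) = cnorm A x"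
proof -
  have le: "cnorm A x \<le> cnorm A (star A x)" if x: "x \<in> carrier A" for x
  proof (cases "cnorm A x = 0")
    case False
    have "cnorm A x * cnorm A x \<le> cnorm A (star A x) * cnorm A x"
      using cnorm_star_mult[OF x] cnorm_mult[of "star A x" x] x by (simp add: power2_eq_square)
    with False norm_nonneg[OF x] show ?thesis by simp
  qed (simp add: x norm_nonneg)
  show "x \<in> carrier A \<Longrightarrow> ?thesis" using le[of x] le[of "star A x"] by simp
qed

lemma norm_mult_star: "x \<in> carrier A \<Longrightarrow> cnorm A (x \<otimes> star A x) = (cnorm A x)\<^sup>2"
  using cnorm_star_mult[of "star A x"] by simp

lemma norm_square: "\<lbrakk>x \<in> carrier A; star A x = x\<rbrakk> \<Longrightarrow> cnorm A (x \<otimes> x) = (cnorm A x)\<^sup>2"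
  using cnorm_star_mult[of x] by simp

lemma tends_star: "tends A f l \<Longrightarrow> tends A (\<lambda>n. star A (f n)) (star A l)"
  by (auto simp: tends_def star_minus[symmetric])

lemma tends_mult_left: "\<lbrakk>tends A f l; x \<in> carrier A\<rbrakk> \<Longrightarrow> tends A (\<lambda>n. x \<otimes> f n) (x \<otimes> l)"
proof -
  assume f: "tends A f l" and x: "x \<in> carrier A"
  then have "(\<lambda>n. cnorm A x * cnorm A (f n \<ominus> l)) \<longlonglongrightarrow> cnorm A x * 0"
    unfolding tends_def by (intro tendsto_mult) auto
  with f x show ?thesis
    by (intro tendsI[where g = "\<lambda>n. cnorm A x * cnorm A (f n \<ominus> l)"])
      (auto simp: tends_def mult_minus_right[symmetric] cnorm_mult)
qed

lemma tends_mult_right: "\<lbrakk>tends A f l; x \<in> carrier A\<rbrakk> \<Longrightarrow> tends A (\<lambda>n. f n \<otimes> x) (l \<otimes> x)"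
proof -
  assume f: "tends A f l" and x: "x \<in> carrier A"
  then have "star A (star A x \<otimes> star A (f n)) = f n \<otimes> x" for n
    by (simp add: star_mult tends_def)
  moreover have "star A (star A x \<otimes> star A l) = l \<otimes> x"
    using f x by (simp add: star_mult tends_def)
  ultimately show ?thesis
    using tends_star[OF tends_mult_left[OF tends_star[OF f], of "star A x"]] x by simp
qed

lemma tends_mult:
  assumes f: "tends A f l" and g: "tends A g m"
  shows "tends A (\<lambda>n. f n \<otimes> g n) (l \<otimes> m)"
proof (rule tendsI)
  have cl: "f n \<in> carrier A" "g n \<in> carrier A" "l \<in> carrier A" "m \<in> carrier A" for n
    using f g by (auto simp: tends_def)
  show "f n \<otimes> g n \<in> carrier A" for n using cl by simp
  show "l \<otimes> m \<in> carrier A" using cl by simp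
  have "(\<lambda>n. cnorm A (f n) * cnorm A (g n \<ominus> m) + cnorm A (f n \<otimes> m \<ominus> l \<otimes> m))
      \<longlonglongrightarrow> cnorm A l * 0 + 0"
    using g tends_norm[OF f] tends_mult_right[OF f, of m] cl
    by (intro tendsto_add tendsto_mult) (auto simp: tends_def)
  then show "(\<lambda>n. cnorm A (f n) * cnorm A (g n \<ominus> m) + cnorm A (f n \<otimes> m \<ominus> l \<otimes> m)) \<longlonglongrightarrow> 0"
    by simp
  show "cnorm A (f n \<otimes> g n \<ominus> l \<otimes> m)
      \<le> cnorm A (f n) * cnorm A (g n \<ominus> m) + cnorm A (f n \<otimes> m \<ominus> l \<otimes> m)" for n
  proof -
    have "cnorm A (f n \<otimes> g n \<ominus> f n \<otimes> m) \<le> cnorm A (f n) * cnorm A (g n \<ominus> m)"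
      using cl by (simp add: mult_minus_right[symmetric] cnorm_mult)
    then show ?thesis
      using norm_dist_triangle[of "f n \<otimes> g n" "f n \<otimes> m" "l \<otimes> m"] cl by simp
  qed
qed

lemma cauchy_tends: "cauchy A f \<Longrightarrow> \<exists>l. tends A f l"
  using complete mcomplete_iff by blast

lemma subalgebra_iff: "cstar_subalgebra S A \<longleftrightarrow>
    S \<subseteq> carrier A \<and> \<zero> \<in> S \<and> (\<forall>x\<in>S. \<forall>y\<in>S. x \<oplus> y \<in> S \<and> x \<otimes> y \<in> S) \<and>
    (\<forall>c. \<forall>x\<in>S. c \<odot> x \<in> S) \<and> (\<forall>x\<in>S. star A x \<in> S) \<and>
    (\<forall>f l. (\<forall>n. f n \<in> S) \<and> tends A f l \<longrightarrow> l \<in> S)"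
  unfolding cstar_subalgebra_def closedin_iff by auto

lemma
  assumes "cstar_subalgebra S A"
  shows subalgebra_carrier: "x \<in> S \<Longrightarrow> x \<in> carrier A"
    and subalgebra_zero: "\<zero> \<in> S"
    and subalgebra_add: "\<lbrakk>x \<in> S; y \<in> S\<rbrakk> \<Longrightarrow> x \<oplus> y \<in> S"
    and subalgebra_mult: "\<lbrakk>x \<in> S; y \<in> S\<rbrakk> \<Longrightarrow> x \<otimes> y \<in> S"
    and subalgebra_smult: "x \<in> S \<Longrightarrow> c \<odot> x \<in> S"
    and subalgebra_star: "x \<in> S \<Longrightarrow> star A x \<in> S"
    and subalgebra_tends: "\<lbrakk>\<And>n. f n \<in> S; tends A f l\<rbrakk> \<Longrightarrow> l \<in> S"
  using assms unfolding subalgebra_iff by (simp_all add: subset_iff, blast)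

lemma subalgebra_minus: "\<lbrakk>cstar_subalgebra S A; x \<in> S; y \<in> S\<rbrakk> \<Longrightarrow> x \<ominus> y \<in> S"
  by (simp add: minus_smult subalgebra_add subalgebra_smult subalgebra_carrier)

lemma subalgebra_finsum: "\<lbrakk>cstar_subalgebra S A; f \<in> I \<rightarrow> S\<rbrakk> \<Longrightarrow> (\<Oplus>i\<in>I. f i) \<in> S"
proof (induction I rule: infinite_finite_induct)
  case (insert i I)
  then have "(\<Oplus>i\<in>insert i I. f i) = f i \<oplus> (\<Oplus>i\<in>I. f i)"
    by (subst M.finsum_insert) (auto simp: subalgebra_carrier Pi_def)
  with insert show ?case by (auto intro: subalgebra_add)
qed (auto simp: M.finsum_infinite subalgebra_zero)

lemma subalgebra_generated:
  assumes "S \<subseteq> carrier A"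
  shows "cstar_subalgebra (cstar_generated A S) A"
proof -
  \<comment> \<open>The family being intersected must have a member inside the carrier; an empty
    intersection would be the whole type.\<close>
  have "cstar_subalgebra (carrier A) A"
    by (auto simp: subalgebra_iff tends_def)
  with assms have "cstar_generated A S \<subseteq> carrier A"
    by (auto simp: cstar_generated_def)
  then show ?thesis
    unfolding subalgebra_iff
    by (auto simp: cstar_generated_def subalgebra_zero subalgebra_add subalgebra_mult
        subalgebra_smult subalgebra_star) (meson subalgebra_tends)
qed

lemma generated_minimal: "\<lbrakk>cstar_subalgebra D A; S \<subseteq> D\<rbrakk> \<Longrightarrow> cstar_generated A S \<subseteq> D"
  by (auto simp: cstar_generated_def)

lemma generated_superset: "S \<subseteq> cstar_generated A S"
  by (auto simp: cstar_generated_def)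

text \<open>Commutation with \<open>star A c\<close> is included because commutation with
  \<open>c\<close> alone is not inherited by adjoints.\<close>

lemma subalgebra_commutant:
  assumes c: "c \<in> carrier A"
  shows "cstar_subalgebra {y \<in> carrier A. y \<otimes> c = c \<otimes> y \<and> y \<otimes> star A c = star A c \<otimes> y} A"
    (is "cstar_subalgebra ?S A")
proof -
  have star: "star A y \<otimes> c = c \<otimes> star A y \<and> star A y \<otimes> star A c = star A c \<otimes> star A y"
    if "y \<in> ?S" for y
    using that c star_mult[of y "star A c"] star_mult[of "star A c" y] star_mult[of y c] star_mult[of c y]
    by auto
  have lim: "l \<in> ?S" if f: "\<forall>n. f n \<in> ?S" "tends A f l" for f l
  proof -
    have "tends A (\<lambda>n. f n \<otimes> d) (l \<otimes> d)" "tends A (\<lambda>n. d \<otimes> f n) (d \<otimes> l)"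
      if "d \<in> carrier A" for d
      using that f by (auto intro: tends_mult_left tends_mult_right)
    from this[of c] this[of "star A c"] have "l \<otimes> c = c \<otimes> l" "l \<otimes> star A c = star A c \<otimes> l"
      using f(1) c by (auto intro: tends_unique)
    with f show ?thesis by (auto simp: tends_def)
  qed
  have mult: "(x \<otimes> y) \<otimes> d = d \<otimes> (x \<otimes> y)"
    if "x \<otimes> d = d \<otimes> x" "y \<otimes> d = d \<otimes> y" "x \<in> carrier A" "y \<in> carrier A" "d \<in> carrier A" for x y d
  proof -
    have "(x \<otimes> y) \<otimes> d = x \<otimes> (d \<otimes> y)" using that by (simp add: mult_assoc)
    also have "\<dots> = (d \<otimes> x) \<otimes> y" using that by (simp add: mult_assoc[symmetric])
    finally show ?thesis using that by (simp add: mult_assoc)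
  qed
  show ?thesis
    unfolding subalgebra_iff
  proof (intro conjI ballI allI impI)
    show "x \<otimes> y \<in> ?S" if "x \<in> ?S" "y \<in> ?S" for x y
      using that c mult[of x c y] mult[of x "star A c" y] by simp
    show "star A x \<in> ?S" if "x \<in> ?S" for x
      using that star[OF that] by simp
    show "l \<in> ?S" if "(\<forall>n. f n \<in> ?S) \<and> tends A f l" for f l
      using lim that by blast
  qed (use c in \<open>auto simp: mult_add_left mult_add_right mult_smult_left mult_smult_right\<close>)
qed

text \<open>As \<open>z\<close> is self-adjoint, commuting with \<open>c\<close> entails commuting
  with \<open>star A c\<close>. So \<open>z\<close> lies in the closed commutant above, and with it
  everything that \<open>z\<close> generates. This replaces the commutation rules of a functional
  calculus.\<close>

lemma generated_commute:
  assumes z: "z \<in> carrier A" "star A z = z" and y: "y \<in> cstar_generated A {z}"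
    and c: "c \<in> carrier A" "z \<otimes> c = c \<otimes> z"
  shows "y \<otimes> c = c \<otimes> y"
proof -
  have "z \<otimes> star A c = star A c \<otimes> z"
    using c z star_mult[of c z] star_mult[of z c] by simp
  then show ?thesis
    using generated_minimal[OF subalgebra_commutant[OF c(1)], of "{z}"] y z c by auto
qed

text \<open>\<open>y = 1 - sqrt (1 - z)\<close> is a fixed point of \<open>y \<mapsto> (z + y\<^sup>2) / 2\<close>. The iteration is
  dominated by the same iteration for the real number \<open>z = 1\<close>, which increases and is
  bounded by 1; in particular \<open>\<parallel>z\<parallel> = 1\<close> is allowed.\<close>

lemma sqrt_iteration:
  assumes z: "z \<in> carrier A" "star A z = z" "cnorm A z \<le> 1"
  obtains y where "y \<in> cstar_generated A {z}" "star A y = y" "cnorm A y \<le> cnorm A z"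
    "y \<oplus> y = z \<oplus> y \<otimes> y"
proof -
  define Y where "Y = rec_nat \<zero> (\<lambda>_ u. (1/2) \<odot> (z \<oplus> u \<otimes> u))"
  have Y0: "Y 0 = \<zero>" and YS: "Y (Suc n) = (1/2) \<odot> (z \<oplus> Y n \<otimes> Y n)" for n
    by (simp_all add: Y_def)
  define q where "q = rec_nat 0 (\<lambda>_ u. (1 + u * u) / 2 :: real)"
  have q0: "q 0 = 0" and qS: "q (Suc n) = (1 + q n * q n) / 2" for n
    by (simp_all add: q_def)
  let ?G = "cstar_generated A {z}"
  have sub: "cstar_subalgebra ?G A" using z by (intro subalgebra_generated) simp
  have zG: "z \<in> ?G" using generated_superset by blast
  have YG: "Y n \<in> ?G" for n
    by (induction n) (auto simp: Y0 YS subalgebra_zero[OF sub] zG intro!: subalgebra_smult[OF sub]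
        subalgebra_add[OF sub] subalgebra_mult[OF sub])
  then have Yc [simp]: "Y n \<in> carrier A" for n using subalgebra_carrier[OF sub] by blast
  have Ystar: "star A (Y n) = Y n" for n
    by (induction n) (simp_all add: Y0 YS z star_smult star_add star_mult)
  have Yz: "Y n \<otimes> z = z \<otimes> Y n" for n
    by (rule generated_commute[OF z(1,2) YG]) (simp_all add: z)
  have Ycomm: "Y m \<otimes> Y n = Y n \<otimes> Y m" for m n
    by (rule generated_commute[OF z(1,2) YG]) (simp_all add: Yz)
  have q_range: "0 \<le> q n \<and> q n \<le> 1" for n
  proof (induction n)
    case (Suc n)
    then have "q n * q n \<le> 1" by (simp add: mult_le_one)
    then show ?case by (simp add: qS)
  qed (simp add: q0)
  have Yq: "cnorm A (Y n) \<le> q n \<and> cnorm A (Y n) \<le> cnorm A z" for n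
  proof (induction n)
    case 0
    show ?case using z by (simp add: Y0 q0 norm_nonneg)
  next
    case (Suc n)
    have "cnorm A (Y (Suc n)) \<le> (cnorm A z + cnorm A (Y n) * cnorm A (Y n)) / 2"
      using z norm_triangle[of z "Y n \<otimes> Y n"] cnorm_mult[of "Y n" "Y n"] by (simp add: YS norm_smult)
    moreover have "cnorm A (Y n) * cnorm A (Y n) \<le> q n * q n"
      using Suc norm_nonneg[of "Y n"] by (intro mult_mono) auto
    \<comment> \<open>One factor is bounded by \<open>\<parallel>z\<parallel>\<close> and the other
      by 1, so the iterates never exceed \<open>\<parallel>z\<parallel>\<close>; the scalar majorant
      alone would give only the bound 1.\<close>
    moreover have "cnorm A (Y n) * cnorm A (Y n) \<le> cnorm A z * 1"
      using Suc norm_nonneg[of "Y n"] z by (intro mult_mono) auto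
    ultimately show ?case using z by (auto simp: qS)
  qed
  have step: "cnorm A (Y (Suc n) \<ominus> Y n) \<le> q (Suc n) - q n" for n
  proof (induction n)
    case 0
    show ?case using z by (simp add: Y0 q0 YS qS norm_smult)
  next
    case (Suc n)
    let ?a = "Y (Suc n)" and ?b = "Y n"
    have "Y (Suc (Suc n)) \<ominus> ?a = (1/2) \<odot> (z \<oplus> ?a \<otimes> ?a) \<ominus> (1/2) \<odot> (z \<oplus> ?b \<otimes> ?b)"
      by (simp only: YS)
    also have "\<dots> = (1/2) \<odot> ((z \<oplus> ?a \<otimes> ?a) \<ominus> (z \<oplus> ?b \<otimes> ?b))"
      using z by (subst smult_minus_right) simp_all
    also have "(z \<oplus> ?a \<otimes> ?a) \<ominus> (z \<oplus> ?b \<otimes> ?b) = ?a \<otimes> ?a \<ominus> ?b \<otimes> ?b"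
      using z by (subst add_minus_add) simp_all
    also have "\<dots> = (?a \<otimes> ?a \<ominus> ?b \<otimes> ?a) \<oplus> (?b \<otimes> ?a \<ominus> ?b \<otimes> ?b)"
      by (rule minus_add_minus) simp_all
    also have "\<dots> = (?a \<ominus> ?b) \<otimes> ?a \<oplus> ?b \<otimes> (?a \<ominus> ?b)"
      by (simp add: mult_minus_left mult_minus_right)
    finally have "cnorm A (Y (Suc (Suc n)) \<ominus> ?a) =
        cnorm A ((?a \<ominus> ?b) \<otimes> ?a \<oplus> ?b \<otimes> (?a \<ominus> ?b)) / 2"
      by (simp add: norm_smult)
    also have "\<dots> \<le> (cnorm A (?a \<ominus> ?b) * cnorm A ?a + cnorm A ?b * cnorm A (?a \<ominus> ?b)) / 2"
      using norm_triangle[of "(?a \<ominus> ?b) \<otimes> ?a" "?b \<otimes> (?a \<ominus> ?b)"]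
        cnorm_mult[of "?a \<ominus> ?b" ?a] cnorm_mult[of ?b "?a \<ominus> ?b"] by simp
    also have "\<dots> \<le> ((q (Suc n) - q n) * q (Suc n) + q n * (q (Suc n) - q n)) / 2"
      using Suc Yq q_range order_trans[OF norm_nonneg Suc]
      by (intro divide_right_mono add_mono mult_mono) (auto simp: norm_nonneg)
    \<comment> \<open>Half of the difference of the squares of \<open>q (Suc n)\<close> and
      \<open>q n\<close> is the next increment of the scalar iteration.\<close>
    also have "\<dots> = q (Suc (Suc n)) - q (Suc n)"
      by (simp only: qS[of "Suc n"] qS[of n]) (simp add: field_simps)
    finally show ?case .
  qed
  \<comment> \<open>Monotonicity comes for free, because each increment of \<open>q\<close>
    dominates a norm.\<close>
  have "q n \<le> q (Suc n)" for n
    using order_trans[OF norm_nonneg step, of n] by simp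
  then have "incseq q" by (rule incseq_SucI)
  then have "convergent q"
    using q_range by (intro Bseq_mono_convergent BseqI'[of _ 1]) (auto simp: incseq_def)
  then obtain y where y: "tends A Y y"
    using cauchy_majorant[of Y q] step cauchy_tends by auto
  then have yc: "y \<in> carrier A" by (simp add: tends_def)
  have "tends A (\<lambda>n. Y (Suc n)) ((1/2) \<odot> (z \<oplus> y \<otimes> y))"
    unfolding YS using y z by (intro tends_smult tends_add tends_mult) simp_all
  then have "y = (1/2) \<odot> (z \<oplus> y \<otimes> y)"
    using tends_Suc[OF y] tends_unique by blast
  then have "y \<oplus> y = (1/2) \<odot> (z \<oplus> y \<otimes> y) \<oplus> (1/2) \<odot> (z \<oplus> y \<otimes> y)" by simp
  also have "\<dots> = z \<oplus> y \<otimes> y"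
    using yc z by (simp add: smult_add_left[symmetric])
  finally have eq: "y \<oplus> y = z \<oplus> y \<otimes> y" .
  have "star A y = y"
    using tends_unique[OF tends_star[OF y]] y by (simp add: Ystar)
  moreover have "cnorm A y \<le> cnorm A z"
    using tends_norm_le[OF y] Yq by blast
  ultimately show thesis
    using that subalgebra_tends[OF sub YG y] eq by blast
qed

end

section \<open>Positive elements\<close>

text \<open>In spectral terms the inequality confines the spectrum of a self-adjoint
  \<open>x\<close> to the interval from 0 to \<open>2 t\<close>. With \<open>t\<close> existential,
  closure under sums and nonnegative multiples is immediate: the witnesses add and scale.\<close>

definition pos :: "'a cstar \<Rightarrow> 'a \<Rightarrow> bool"
  where "pos A x \<longleftrightarrow> x \<in> carrier A \<and> star A x = x \<and>
    (\<exists>t. cnorm A (complex_of_real t \<odot>\<^bsub>A\<^esub> \<one>\<^bsub>A\<^esub> \<ominus>\<^bsub>A\<^esub> x) \<le> t)"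

sublocale unital_cstar_algebra \<subseteq> U: ring A
proof (rule ringI)
  show "abelian_group A" by (rule M.abelian_group_axioms)
  show "monoid A" by (rule monoidI) (auto simp: one_closed one_left one_right mult_assoc)
qed (simp_all add: mult_add_left mult_add_right)

context unital_cstar_algebra
begin

lemmas ring_nf = U.ring_simprules U.r_one

lemma star_one [simp]: "star A \<one> = \<one>"
  using star_mult[of "star A \<one>" \<one>] by simp

text \<open>Only an inequality, because the zero algebra is allowed and its unit has norm 0.\<close>

lemma norm_one: "cnorm A \<one> \<le> 1"
proof -
  have "cnorm A \<one> = (cnorm A \<one>)\<^sup>2" using norm_square[of \<one>] by simp
  then have "cnorm A \<one> = 0 \<or> cnorm A \<one> = 1" by (simp add: power2_eq_square)
  then show ?thesis by auto
qed

lemma norm_scalar: "t \<ge> 0 \<Longrightarrow> cnorm A (complex_of_real t \<odot> \<one>) \<le> t"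
  using mult_left_mono[OF norm_one, of t] by (simp add: norm_smult)

text \<open>The Neumann series, with \<open>W\<close> its partial sums. Since the inverse lies in
  the algebra generated by 1 and \<open>z\<close>, it belongs to every subalgebra that contains
  both.\<close>

lemma inverse_one_minus:
  assumes z: "z \<in> carrier A" "cnorm A z < 1"
  obtains w where "w \<in> cstar_generated A {\<one>, z}" "w \<otimes> (\<one> \<ominus> z) = \<one>" "(\<one> \<ominus> z) \<otimes> w = \<one>"
proof -
  define W where "W = rec_nat \<one> (\<lambda>_ u. \<one> \<oplus> z \<otimes> u)"
  have W0: "W 0 = \<one>" and WS: "W (Suc n) = \<one> \<oplus> z \<otimes> W n" for n by (simp_all add: W_def)
  let ?G = "cstar_generated A {\<one>, z}" and ?c = "cnorm A z"
  have sub: "cstar_subalgebra ?G A" using z by (intro subalgebra_generated) simp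
  have in_G: "z \<in> ?G" "\<one> \<in> ?G" using generated_superset[of "{\<one>, z}"] by auto
  have WG: "W n \<in> ?G" for n
    by (induction n) (auto simp: W0 WS in_G intro!: subalgebra_add[OF sub] subalgebra_mult[OF sub])
  then have Wc [simp]: "W n \<in> carrier A" for n using subalgebra_carrier[OF sub] by blast
  have Wz: "W n \<otimes> z = z \<otimes> W n" for n
    by (induction n) (simp_all add: W0 WS z mult_add_left mult_add_right mult_assoc)
  have step: "cnorm A (W (Suc n) \<ominus> W n) \<le> ?c ^ Suc n" for n
  proof (induction n)
    case 0
    have "W (Suc 0) \<ominus> W 0 = z" using z(1) unfolding WS W0 by (simp add: ring_nf)
    then show ?case by simp
  next
    case (Suc n)
    have "W (Suc (Suc n)) \<ominus> W (Suc n) = (\<one> \<oplus> z \<otimes> W (Suc n)) \<ominus> (\<one> \<oplus> z \<otimes> W n)" by (simp only: WS)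
    also have "\<dots> = z \<otimes> (W (Suc n) \<ominus> W n)"
      using z by (subst add_minus_add) (simp_all add: mult_minus_right)
    finally have "cnorm A (W (Suc (Suc n)) \<ominus> W (Suc n)) \<le> ?c * cnorm A (W (Suc n) \<ominus> W n)"
      using z by (simp add: cnorm_mult)
    also have "\<dots> \<le> ?c * ?c ^ Suc n" using Suc z by (intro mult_left_mono) (auto simp: norm_nonneg)
    finally show ?case by simp
  qed
  \<comment> \<open>Minus the tail of the geometric series: the increments are the required powers,
    and the sequence tends to 0.\<close>
  define g where "g n = - (?c ^ Suc n / (1 - ?c))" for n
  have "- (c * x / (1 - c)) - - (x / (1 - c)) = x" if "c < 1" for c x :: real
    using that by (simp add: divide_simps) (simp add: algebra_simps)
  from this[OF z(2)] have "g (Suc n) - g n = ?c ^ Suc n" for n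
    unfolding g_def power_Suc[of ?c "Suc n"] .
  moreover have "g \<longlonglongrightarrow> - (0 / (1 - ?c))"
    unfolding g_def using z norm_nonneg[OF z(1)]
    by (intro tendsto_minus tendsto_divide LIMSEQ_Suc[OF LIMSEQ_power_zero] tendsto_const) auto
  ultimately have "cauchy A W"
    using step by (intro cauchy_majorant[of W g] convergentI) simp_all
  then obtain w where w: "tends A W w" using cauchy_tends by blast
  then have wc: "w \<in> carrier A" by (simp add: tends_def)
  have "tends A (\<lambda>n. W (Suc n)) (\<one> \<oplus> z \<otimes> w)"
    unfolding WS using w z by (intro tends_add tends_mult_left) simp_all
  then have eq: "w = \<one> \<oplus> z \<otimes> w" using tends_Suc[OF w] tends_unique by blast
  have comm: "w \<otimes> z = z \<otimes> w"
    using tends_unique[OF tends_mult_right[OF w z(1)]] tends_mult_left[OF w z(1)] by (simp add: Wz)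
  have "(\<one> \<ominus> z) \<otimes> w = w \<ominus> z \<otimes> w" using z wc by (simp add: mult_minus_left)
  also have "\<dots> = (\<one> \<oplus> z \<otimes> w) \<ominus> z \<otimes> w" using eq by simp
  also have "\<dots> = \<one>" using z(1) wc by algebra
  finally have inv: "(\<one> \<ominus> z) \<otimes> w = \<one>" .
  moreover have "w \<otimes> (\<one> \<ominus> z) = (\<one> \<ominus> z) \<otimes> w"
    using z wc comm by (simp add: mult_minus_left mult_minus_right)
  ultimately show thesis using that subalgebra_tends[OF sub WG w] by simp
qed

text \<open>The root is presented as \<open>\<one> \<ominus> y\<close> because \<open>y\<close> lies
  in the algebra generated by \<open>z\<close> without the unit, and because the bound on
  \<open>y\<close> makes the root invertible as soon as
  \<open>\<parallel>z\<parallel> < 1\<close>.\<close>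

lemma sqrt_one_minus:
  assumes z: "z \<in> carrier A" "star A z = z" "cnorm A z \<le> 1"
  obtains y where "y \<in> cstar_generated A {z}" "y \<in> carrier A" "star A y = y" "cnorm A y \<le> cnorm A z"
    "(\<one> \<ominus> y) \<otimes> (\<one> \<ominus> y) = \<one> \<ominus> z"
proof -
  obtain y where y: "y \<in> cstar_generated A {z}" "star A y = y" "cnorm A y \<le> cnorm A z"
      "y \<oplus> y = z \<oplus> y \<otimes> y"
    using sqrt_iteration[OF z] .
  have yc: "y \<in> carrier A"
    using y(1) z(1) subalgebra_carrier[OF subalgebra_generated[of "{z}"]] by simp
  have "(\<one> \<ominus> y) \<otimes> (\<one> \<ominus> y) = (\<one> \<ominus> (y \<oplus> y)) \<oplus> y \<otimes> y"
    using yc by (simp add: ring_nf)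
  also have "\<dots> = \<one> \<ominus> z" unfolding y(4) using yc z(1) by algebra
  finally show thesis using that y yc by blast
qed

text \<open>With \<open>u = h + i s\<close> one has \<open>u\<^sup>* u = h\<^sup>2 + s\<^sup>2\<close>, and \<open>h\<close> is the real part of \<open>u\<close>.\<close>

lemma norm_square_le_add_square:
  assumes h: "h \<in> carrier A" "star A h = h" and s: "s \<in> carrier A" "star A s = s"
    and comm: "h \<otimes> s = s \<otimes> h"
  shows "cnorm A (h \<otimes> h) \<le> cnorm A (h \<otimes> h \<oplus> s \<otimes> s)"
proof -
  define u where "u = h \<oplus> \<i> \<odot> s"
  have uc: "u \<in> carrier A" using h s by (simp add: u_def)
  have "star A u \<otimes> u = h \<otimes> h \<oplus> \<i> \<odot> (s \<otimes> h) \<oplus> ((-\<i>) \<odot> (s \<otimes> h) \<oplus> s \<otimes> s)"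
    unfolding u_def using h s
    by (simp add: star_add star_smult mult_add_left mult_add_right mult_smult_left mult_smult_right
        comm smult_add_right M.a_ac)
  also have "\<dots> = h \<otimes> h \<oplus> ((\<i> \<odot> (s \<otimes> h) \<oplus> (-\<i>) \<odot> (s \<otimes> h)) \<oplus> s \<otimes> s)"
    using h s by (simp add: M.a_assoc)
  also have "\<i> \<odot> (s \<otimes> h) \<oplus> (-\<i>) \<odot> (s \<otimes> h) = \<zero>"
    using h s by (simp add: smult_add_left[symmetric])
  finally have "(cnorm A u)\<^sup>2 = cnorm A (h \<otimes> h \<oplus> s \<otimes> s)"
    using h s uc by (simp add: cnorm_star_mult[symmetric])
  moreover have "u \<oplus> star A u = 2 \<odot> h \<oplus> (\<i> \<odot> s \<oplus> (-\<i>) \<odot> s)"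
  proof -
    have "u \<oplus> star A u = (h \<oplus> h) \<oplus> (\<i> \<odot> s \<oplus> (-\<i>) \<odot> s)"
      unfolding u_def using h s by (simp add: star_add star_smult M.a_ac)
    also have "h \<oplus> h = 2 \<odot> h" using h smult_add_left[of h 1 1] by simp
    finally show ?thesis .
  qed
  then have "2 \<odot> h = u \<oplus> star A u" using h s by (simp add: smult_add_left[symmetric])
  then have "2 * cnorm A h \<le> cnorm A u + cnorm A u"
    using norm_triangle[of u "star A u"] norm_smult[of h 2] h uc by simp
  then have "(cnorm A h)\<^sup>2 \<le> (cnorm A u)\<^sup>2" using h by (intro power_mono) (auto simp: norm_nonneg)
  ultimately show ?thesis using h by (simp add: norm_square)
qed

text \<open>Scaling by \<open>1 / sqrt t\<close> reduces the claim to \<open>t = 1\<close>. There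
  \<open>\<one> \<ominus> g \<otimes> g\<close> is itself the square of a self-adjoint element that
  commutes with \<open>g\<close>. The two squares add up to 1, so
  \<open>norm_square_le_add_square\<close> bounds the first by the norm of the unit.\<close>

lemma norm_scalar_minus_square:
  assumes h: "h \<in> carrier A" "star A h = h" "(cnorm A h)\<^sup>2 \<le> t"
  shows "cnorm A (complex_of_real t \<odot> \<one> \<ominus> h \<otimes> h) \<le> t"
proof (cases "t = 0")
  case True
  then have "h = \<zero>" using h norm_eq_0 by simp
  then show ?thesis using True by simp
next
  case False
  then have t: "t > 0" using h(3) zero_le_power2[of "cnorm A h"] by linarith
  define g where "g = complex_of_real (1 / sqrt t) \<odot> h"
  have g: "g \<in> carrier A" "star A g = g" using h by (simp_all add: g_def star_smult)
  have gg: "g \<otimes> g = complex_of_real (1 / t) \<odot> (h \<otimes> h)"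
    using h t by (simp add: g_def mult_smult_left mult_smult_right of_real_mult[symmetric] del: of_real_mult of_real_divide)
  have "cnorm A (g \<otimes> g) \<le> 1"
    unfolding gg using h t by (simp add: norm_smult norm_square divide_simps norm_divide)
  then obtain y where y: "y \<in> cstar_generated A {g \<otimes> g}" "y \<in> carrier A" "star A y = y"
      "(\<one> \<ominus> y) \<otimes> (\<one> \<ominus> y) = \<one> \<ominus> g \<otimes> g"
    using sqrt_one_minus[of "g \<otimes> g"] g by (auto simp: star_mult)
  have "y \<otimes> g = g \<otimes> y"
    using generated_commute[of "g \<otimes> g" y g] y g by (simp add: star_mult mult_assoc)
  then have comm: "(\<one> \<ominus> y) \<otimes> g = g \<otimes> (\<one> \<ominus> y)"
    using y g by (simp add: mult_minus_left mult_minus_right)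
  have "cnorm A (\<one> \<ominus> g \<otimes> g) \<le> cnorm A ((\<one> \<ominus> g \<otimes> g) \<oplus> g \<otimes> g)"
    using norm_square_le_add_square[OF _ _ g comm] y by (simp add: star_minus)
  also have "(\<one> \<ominus> g \<otimes> g) \<oplus> g \<otimes> g = \<one>" using g(1) by algebra
  finally have "cnorm A (\<one> \<ominus> g \<otimes> g) \<le> 1" using norm_one by simp
  moreover have "complex_of_real t \<odot> \<one> \<ominus> h \<otimes> h = complex_of_real t \<odot> (\<one> \<ominus> g \<otimes> g)"
    using t h g by (simp add: smult_minus_right gg)
  ultimately show ?thesis using t g by (simp add: norm_smult)
qed

lemma
  assumes "pos A x"
  shows pos_carrier [simp]: "x \<in> carrier A" and pos_star: "star A x = x"
  using assms by (simp_all add: pos_def)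

lemma pos_square: "\<lbrakk>h \<in> carrier A; star A h = h\<rbrakk> \<Longrightarrow> pos A (h \<otimes> h)"
  unfolding pos_def using norm_scalar_minus_square[of h "(cnorm A h)\<^sup>2"] 
  by (auto simp: star_mult simp del: of_real_power)

lemma pos_add: "\<lbrakk>pos A x; pos A y\<rbrakk> \<Longrightarrow> pos A (x \<oplus> y)"
proof -
  assume x: "pos A x" and y: "pos A y"
  then obtain s t where st: "cnorm A (complex_of_real s \<odot> \<one> \<ominus> x) \<le> s" "cnorm A (complex_of_real t \<odot> \<one> \<ominus> y) \<le> t"
    by (auto simp: pos_def)
  have "complex_of_real (s + t) \<odot> \<one> \<ominus> (x \<oplus> y) = (complex_of_real s \<odot> \<one> \<ominus> x) \<oplus> (complex_of_real t \<odot> \<one> \<ominus> y)"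
    using x y by (simp add: smult_add_left add_minus_add)
  then have "cnorm A (complex_of_real (s + t) \<odot> \<one> \<ominus> (x \<oplus> y)) \<le> s + t"
    using norm_triangle[of "complex_of_real s \<odot> \<one> \<ominus> x" "complex_of_real t \<odot> \<one> \<ominus> y"] st x y by simp
  then show ?thesis
    unfolding pos_def using x y by (auto simp: star_add pos_star intro: exI[of _ "s + t"])
qed

lemma pos_smult: "\<lbrakk>pos A x; t \<ge> 0\<rbrakk> \<Longrightarrow> pos A (complex_of_real t \<odot> x)"
proof -
  assume x: "pos A x" and t: "t \<ge> 0"
  then obtain s where s: "cnorm A (complex_of_real s \<odot> \<one> \<ominus> x) \<le> s" by (auto simp: pos_def)
  have "complex_of_real (t * s) \<odot> \<one> \<ominus> complex_of_real t \<odot> x = complex_of_real t \<odot> (complex_of_real s \<odot> \<one> \<ominus> x)"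
    using x by (simp add: smult_minus_right)
  then have "cnorm A (complex_of_real (t * s) \<odot> \<one> \<ominus> complex_of_real t \<odot> x) \<le> t * s"
    using s x t by (simp add: norm_smult mult_left_mono)
  then show ?thesis
    unfolding pos_def using x by (auto simp: star_smult pos_star intro: exI[of _ "t * s"])
qed

lemma pos_scalar_minus:
  assumes "h \<in> carrier A" "star A h = h" "cnorm A h \<le> t"
  shows "pos A (complex_of_real t \<odot> \<one> \<ominus> h)"
proof -
  have "complex_of_real t \<odot> \<one> \<ominus> (complex_of_real t \<odot> \<one> \<ominus> h) = h"
    using assms(1) smult_in[OF one_closed, of "complex_of_real t"] by algebra
  then show ?thesis
    unfolding pos_def using assms by (auto simp: star_minus star_smult intro: exI[of _ t])
qed


text \<open>Dividing by the witness \<open>t\<close> of positivity turns \<open>x\<close> into a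
  multiple of \<open>\<one> \<ominus> z\<close> with \<open>\<parallel>z\<parallel> \<le> 1\<close>,
  to which the square root iteration applies. The commutation clause lets roots of commuting
  elements be multiplied and rearranged later.\<close>

lemma pos_sqrt:
  assumes x: "pos A x"
  obtains r where "pos A r" "r \<otimes> r = x"
    "\<And>c. \<lbrakk>c \<in> carrier A; x \<otimes> c = c \<otimes> x\<rbrakk> \<Longrightarrow> r \<otimes> c = c \<otimes> r"
proof -
  obtain t where t: "cnorm A (complex_of_real t \<odot> \<one> \<ominus> x) \<le> t" using x by (auto simp: pos_def)
  then have "t \<ge> 0" using x norm_nonneg[of "complex_of_real t \<odot> \<one> \<ominus> x"] by simp
  show thesis
  proof (cases "t = 0")
    case True
    then have "\<zero> \<ominus> x = \<zero>"
      using x t norm_nonneg[of "\<zero> \<ominus> x"] norm_eq_0[of "\<zero> \<ominus> x"] by simp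
    then have "x = \<zero>" using minus_eq_zero[of \<zero> x] x by simp
    moreover have "pos A \<zero>" using pos_square[of \<zero>] by simp
    ultimately show thesis using that[of \<zero>] by simp
  next
    case False
    with \<open>t \<ge> 0\<close> have tp: "t > 0" by simp
    define z where "z = \<one> \<ominus> complex_of_real (1/t) \<odot> x"
    have zc: "z \<in> carrier A" "star A z = z"
      using x by (simp_all add: z_def star_minus star_smult pos_star)
    have "complex_of_real (1/t) \<odot> (complex_of_real t \<odot> \<one> \<ominus> x) = z"
      using x tp by (simp add: z_def smult_minus_right)
    then have "cnorm A z = (1/t) * cnorm A (complex_of_real t \<odot> \<one> \<ominus> x)"
      using x tp norm_smult[of "complex_of_real t \<odot> \<one> \<ominus> x" "complex_of_real (1/t)"]
      by (simp add: norm_divide)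
    then have "t * cnorm A z \<le> t * 1" using t tp by simp
    then have "cnorm A z \<le> 1" using tp by (simp only: mult_le_cancel_left_pos)
    then obtain y where y: "y \<in> cstar_generated A {z}" "y \<in> carrier A" "star A y = y"
        "cnorm A y \<le> cnorm A z" "(\<one> \<ominus> y) \<otimes> (\<one> \<ominus> y) = \<one> \<ominus> z"
      using sqrt_one_minus zc by metis
    define r where "r = complex_of_real (sqrt t) \<odot> (\<one> \<ominus> y)"
    have "pos A (\<one> \<ominus> y)"
      using pos_scalar_minus[of y 1] y \<open>cnorm A z \<le> 1\<close> by simp
    then have "pos A r" unfolding r_def using \<open>t \<ge> 0\<close> by (intro pos_smult) auto
    moreover have "r \<otimes> r = x"
    proof -
      have "r \<otimes> r = complex_of_real (sqrt t * sqrt t) \<odot> (\<one> \<ominus> z)"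
        unfolding r_def using y zc
        by (simp add: mult_smult_left mult_smult_right del: real_sqrt_mult_self)
      also have "\<one> \<ominus> z = complex_of_real (1/t) \<odot> x"
        unfolding z_def using x smult_in[OF pos_carrier[OF x], of "complex_of_real (1/t)"] by algebra
      finally show ?thesis using x tp by simp
    qed
    moreover have "r \<otimes> c = c \<otimes> r" if c: "c \<in> carrier A" "x \<otimes> c = c \<otimes> x" for c
    proof -
      have "z \<otimes> c = c \<otimes> z"
        unfolding z_def using c x by (simp add: mult_minus_left mult_minus_right mult_smult_left mult_smult_right)
      then have "y \<otimes> c = c \<otimes> y" using generated_commute zc y(1) c by blast
      then show ?thesis
        unfolding r_def using c y
        by (simp add: mult_minus_left mult_minus_right mult_smult_left mult_smult_right)
    qed
    ultimately show thesis using that by blast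
  qed
qed

text \<open>Commuting positive elements have commuting square roots, and for these the claim is
  \<open>norm_square_le_add_square\<close>.\<close>

lemma norm_le_add_commute:
  assumes x: "pos A x" and y: "pos A y" and comm: "x \<otimes> y = y \<otimes> x"
  shows "cnorm A x \<le> cnorm A (x \<oplus> y)"
proof -
  obtain r where r: "pos A r" "r \<otimes> r = x" and rc: "\<And>c. \<lbrakk>c \<in> carrier A; x \<otimes> c = c \<otimes> x\<rbrakk> \<Longrightarrow> r \<otimes> c = c \<otimes> r"
    using pos_sqrt[OF x] by metis
  obtain s where s: "pos A s" "s \<otimes> s = y" and sc: "\<And>c. \<lbrakk>c \<in> carrier A; y \<otimes> c = c \<otimes> y\<rbrakk> \<Longrightarrow> s \<otimes> c = c \<otimes> s"
    using pos_sqrt[OF y] by metis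
  have "s \<otimes> r = r \<otimes> s" using sc[of r] rc[of y] comm r y by simp
  then show ?thesis
    using norm_square_le_add_square[of r s] r s by (simp add: pos_star)
qed

text \<open>The square roots commute, so their product is self-adjoint and its square is
  \<open>x \<otimes> y\<close>.\<close>

lemma pos_mult_commute:
  assumes x: "pos A x" and y: "pos A y" and comm: "x \<otimes> y = y \<otimes> x"
  shows "pos A (x \<otimes> y)"
proof -
  obtain r where r: "pos A r" "r \<otimes> r = x" and rc: "\<And>c. \<lbrakk>c \<in> carrier A; x \<otimes> c = c \<otimes> x\<rbrakk> \<Longrightarrow> r \<otimes> c = c \<otimes> r"
    using pos_sqrt[OF x] by metis
  obtain s where s: "pos A s" "s \<otimes> s = y" and sc: "\<And>c. \<lbrakk>c \<in> carrier A; y \<otimes> c = c \<otimes> y\<rbrakk> \<Longrightarrow> s \<otimes> c = c \<otimes> s"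
    using pos_sqrt[OF y] by metis
  have rs: "s \<otimes> r = r \<otimes> s" using sc[of r] rc[of y] comm r y by simp
  have "(r \<otimes> s) \<otimes> (r \<otimes> s) = r \<otimes> (s \<otimes> r) \<otimes> s" using r s by (simp add: mult_assoc)
  also have "\<dots> = (r \<otimes> r) \<otimes> (s \<otimes> s)" unfolding rs using r(1) s(1) by (simp add: mult_assoc)
  finally have "(r \<otimes> s) \<otimes> (r \<otimes> s) = x \<otimes> y" by (simp add: r s)
  then show ?thesis
    using pos_square[of "r \<otimes> s"] r s rs by (simp add: star_mult pos_star)
qed

text \<open>As \<open>x\<close> and \<open>y\<close> need not commute, \<open>y\<close> is first
  replaced by the scalar \<open>\<parallel>y\<parallel>\<close>, which dominates \<open>y\<close>
  and hence \<open>x\<close>. Now \<open>x\<close> commutes with the difference of this scalar and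
  \<open>x\<close>, and the commuting case applies to these two positive elements.\<close>

lemma norm_mono:
  assumes x: "pos A x" and y: "y \<in> carrier A" and xy: "pos A (y \<ominus> x)"
  shows "cnorm A x \<le> cnorm A y"
proof -
  let ?t = "complex_of_real (cnorm A y) \<odot> \<one>"
  have "y = (y \<ominus> x) \<oplus> x" using x y by (simp add: minus_add_cancel)
  then have "star A y = y" using pos_star[OF pos_add[OF xy x]] by simp
  then have "pos A (?t \<ominus> y)" using pos_scalar_minus y by simp
  moreover have "(?t \<ominus> y) \<oplus> (y \<ominus> x) = ?t \<ominus> x"
    using x y by (simp add: minus_add_minus[of _ y x, symmetric])
  ultimately have p: "pos A (?t \<ominus> x)" using pos_add xy by metis
  have "cnorm A x \<le> cnorm A (x \<oplus> (?t \<ominus> x))"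
    using x by (intro norm_le_add_commute p) (simp_all add: mult_minus_left mult_minus_right
        mult_smult_left mult_smult_right one_left one_right)
  also have "x \<oplus> (?t \<ominus> x) = ?t" using x by (simp add: M.a_comm[of x] minus_add_cancel)
  also have "cnorm A ?t \<le> cnorm A y" using y by (intro norm_scalar) (simp add: norm_nonneg)
  finally show ?thesis .
qed

end

section \<open>Positivity of \<open>x\<^sup>* x\<close>\<close>

context unital_cstar_algebra
begin

lemma norm_add_self: "x \<in> carrier A \<Longrightarrow> cnorm A (x \<oplus> x) = 2 * cnorm A x"
  using smult_add_left[of x 1 1] norm_smult[of x 2] by simp

text \<open>Here \<open>a\<close> and \<open>b\<close> are, up to sign, twice the real and imaginary
  parts of \<open>c\<close>, so
  \<open>2 c c\<^sup>* + 2 c\<^sup>* c = a\<^sup>2 + b\<^sup>2\<close>. Hence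
  \<open>2 c c\<^sup>* = a\<^sup>2 + b\<^sup>2 + 2 q\<close> is a sum of positive elements.\<close>

lemma pos_mult_star_of_neg:
  assumes c: "c \<in> carrier A" and q: "pos A q" "star A c \<otimes> c = \<ominus> q"
  shows "pos A (c \<otimes> star A c)"
proof -
  define a where "a = c \<oplus> star A c"
  define b where "b = \<i> \<odot> (c \<ominus> star A c)"
  have ab: "a \<in> carrier A" "star A a = a" "b \<in> carrier A" "star A b = b"
    using c by (simp_all add: a_def b_def star_add star_smult minus_smult smult_add_right M.a_comm)
  have bb: "b \<otimes> b = \<ominus> ((c \<ominus> star A c) \<otimes> (c \<ominus> star A c))"
    using c by (simp add: b_def mult_smult_left mult_smult_right neg_smult)
  have "c \<otimes> star A c \<oplus> c \<otimes> star A c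
      = (a \<otimes> a \<oplus> b \<otimes> b) \<ominus> (star A c \<otimes> c \<oplus> star A c \<otimes> c)"
    unfolding bb unfolding a_def using c star_closed[OF c] by algebra
  also have "\<dots> = (a \<otimes> a \<oplus> b \<otimes> b) \<oplus> (q \<oplus> q)"
    unfolding q(2) using ab q(1) pos_carrier[OF q(1)] by algebra
  finally have "pos A (c \<otimes> star A c \<oplus> c \<otimes> star A c)"
    using ab q(1) by (simp add: pos_add pos_square)
  then have "pos A (complex_of_real (1/2) \<odot> (c \<otimes> star A c \<oplus> c \<otimes> star A c))"
    by (rule pos_smult) simp
  then show ?thesis
    using c by (simp add: smult_add_right smult_add_left[symmetric])
qed

text \<open>The usual argument compares the spectra of \<open>c\<^sup>* c\<close> and
  \<open>c c\<^sup>*\<close>; here norms suffice. The element \<open>p = c c\<^sup>*\<close> is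
  positive of norm \<open>t\<close>, so \<open>\<parallel>t - p\<parallel> \<le> t\<close>, and
  \<open>c\<^sup>* (t - p) c = - (t q + q\<^sup>2)\<close> has norm at most
  \<open>t\<^sup>2\<close>. But \<open>0 \<le> q \<le> t\<close> gives
  \<open>2 q\<^sup>2 \<le> t q + q\<^sup>2\<close>, and since
  \<open>\<parallel>q\<parallel> = t\<close>, monotonicity of the norm yields
  \<open>2 t\<^sup>2 \<le> t\<^sup>2\<close>.\<close>

lemma neg_star_mult_zero:
  assumes c: "c \<in> carrier A" and q: "pos A q" "star A c \<otimes> c = \<ominus> q"
  shows "c = \<zero>"
proof -
  define t where "t = (cnorm A c)\<^sup>2"
  define p where "p = c \<otimes> star A c"
  let ?t = "complex_of_real t \<odot> \<one>"
  have pp: "pos A p" unfolding p_def by (rule pos_mult_star_of_neg[OF assms])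
  have qc: "q \<in> carrier A" using q by simp
  have qt: "cnorm A q = t" using cnorm_star_mult[OF c] q by (simp add: t_def)
  have "pos A (?t \<ominus> q)" using pos_scalar_minus[OF qc] pos_star q qt by simp
  moreover have "q \<otimes> (?t \<ominus> q) = (?t \<ominus> q) \<otimes> q"
    using qc by (simp add: mult_minus_left mult_minus_right mult_smult_left mult_smult_right)
  ultimately have w: "pos A (q \<otimes> (?t \<ominus> q))" using pos_mult_commute q(1) by blast
  have "cnorm A (q \<otimes> q \<oplus> q \<otimes> q) \<le> cnorm A (q \<otimes> ?t \<oplus> q \<otimes> q)"
  proof (rule norm_mono)
    show "pos A (q \<otimes> q \<oplus> q \<otimes> q)" using qc q pos_star by (intro pos_add pos_square) auto
    have "q \<otimes> ?t \<oplus> q \<otimes> q \<ominus> (q \<otimes> q \<oplus> q \<otimes> q) = q \<otimes> (?t \<ominus> q)"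
      using qc smult_in[OF one_closed, of "complex_of_real t"] by algebra
    then show "pos A (q \<otimes> ?t \<oplus> q \<otimes> q \<ominus> (q \<otimes> q \<oplus> q \<otimes> q))" using w by simp
  qed (use qc in simp)
  also have "cnorm A (q \<otimes> ?t \<oplus> q \<otimes> q) \<le> t * t"
  proof -
    obtain r where r: "pos A r" "r \<otimes> r = p" using pos_sqrt[OF pp] by metis
    have "(cnorm A r)\<^sup>2 = t" using r norm_square[of r] pos_star[of r] norm_mult_star[OF c] by (simp add: t_def p_def)
    then have m: "cnorm A (?t \<ominus> p) \<le> t"
      using norm_scalar_minus_square[of r t] r pos_star[of r] by simp
    have "star A c \<otimes> (?t \<ominus> p) \<otimes> c
        = (star A c \<otimes> c) \<otimes> ?t \<ominus> (star A c \<otimes> c) \<otimes> (star A c \<otimes> c)"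
      unfolding p_def using c
      by (simp add: mult_minus_left mult_minus_right mult_smult_left mult_smult_right mult_assoc)
    also have "\<dots> = \<ominus> (q \<otimes> ?t \<oplus> q \<otimes> q)"
      unfolding q(2) using qc smult_in[OF one_closed, of "complex_of_real t"] by algebra
    finally have "cnorm A (q \<otimes> ?t \<oplus> q \<otimes> q) = cnorm A (star A c \<otimes> (?t \<ominus> p) \<otimes> c)"
      using qc by simp
    also have "\<dots> \<le> cnorm A (star A c) * cnorm A (?t \<ominus> p) * cnorm A c"
      using c pp cnorm_mult[of "star A c" "?t \<ominus> p"] norm_nonneg[OF c]
      by (intro order_trans[OF cnorm_mult]) (auto intro: mult_right_mono)
    also have "\<dots> = t * cnorm A (?t \<ominus> p)" using c by (simp add: t_def power2_eq_square)
    also have "\<dots> \<le> t * t" using m by (intro mult_left_mono) (simp_all add: t_def)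
    finally show ?thesis .
  qed
  also have "cnorm A (q \<otimes> q \<oplus> q \<otimes> q) = 2 * (t * t)"
    using norm_add_self[of "q \<otimes> q"] norm_square[OF qc] pos_star[OF q(1)] qc qt by (simp add: power2_eq_square)
  finally have "t * t \<le> 0" by simp
  then have "t = 0" by (simp add: t_def)
  then show ?thesis using c norm_eq_0 by (simp add: t_def)
qed

text \<open>The element \<open>m\<close> is the absolute value of \<open>h\<close>, and
  \<open>f = m - h\<close> is twice the negative part, so \<open>h f = - m f\<close>. With
  \<open>d\<close> the product of the root of \<open>m\<close> and \<open>f\<close>, one gets
  \<open>(x f)\<^sup>* (x f) = f h f = - d\<^sup>2\<close>, and \<open>neg_star_mult_zero\<close>
  forces \<open>x f = 0\<close>. Then \<open>d = 0\<close>, so \<open>m f = 0\<close>, so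
  \<open>f\<^sup>2 = m f - h f = 0\<close> and \<open>h = m\<close>.\<close>

theorem pos_star_mult:
  assumes x: "x \<in> carrier A"
  shows "pos A (star A x \<otimes> x)"
proof -
  define h where "h = star A x \<otimes> x"
  have h: "h \<in> carrier A" "star A h = h" using x by (simp_all add: h_def star_mult)
  obtain m where m: "pos A m" "m \<otimes> m = h \<otimes> h"
      and mc: "\<And>c. \<lbrakk>c \<in> carrier A; (h \<otimes> h) \<otimes> c = c \<otimes> (h \<otimes> h)\<rbrakk> \<Longrightarrow> m \<otimes> c = c \<otimes> m"
    using pos_sqrt[OF pos_square[OF h]] by metis
  have mh: "m \<otimes> h = h \<otimes> m" using h by (intro mc) (simp_all add: mult_assoc)
  have mcl: "m \<in> carrier A" using m by simp
  define f where "f = m \<ominus> h"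
  have f: "f \<in> carrier A" "star A f = f" using mcl h pos_star[OF m(1)] by (simp_all add: f_def star_minus)
  have mf: "m \<otimes> f = f \<otimes> m" using mcl h mh by (simp add: f_def mult_minus_left mult_minus_right)
  have hf: "h \<otimes> f = \<ominus> (m \<otimes> f)"
    using mcl h by (simp add: f_def mult_minus_right m(2) neg_minus mh)
  obtain r where r: "pos A r" "r \<otimes> r = m"
      and rc: "\<And>c. \<lbrakk>c \<in> carrier A; m \<otimes> c = c \<otimes> m\<rbrakk> \<Longrightarrow> r \<otimes> c = c \<otimes> r"
    using pos_sqrt[OF m(1)] by metis
  have rf: "r \<otimes> f = f \<otimes> r" and rcl: "r \<in> carrier A" using rc f mf r by simp_all
  define d where "d = r \<otimes> f"
  have d: "d \<in> carrier A" "star A d = d" using f rcl rf pos_star[OF r(1)] by (simp_all add: d_def star_mult)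
  have "star A (x \<otimes> f) \<otimes> (x \<otimes> f) = f \<otimes> (h \<otimes> f)"
    using x f by (simp add: star_mult h_def mult_assoc)
  also have "\<dots> = \<ominus> (f \<otimes> (r \<otimes> (r \<otimes> f)))"
    unfolding hf using f rcl mcl by (simp add: mult_neg_right mult_assoc flip: r(2))
  also have "f \<otimes> (r \<otimes> (r \<otimes> f)) = d \<otimes> d"
    using f rcl by (simp add: d_def rf[symmetric] mult_assoc[symmetric])
  finally have eq: "star A (x \<otimes> f) \<otimes> (x \<otimes> f) = \<ominus> (d \<otimes> d)" .
  then have "x \<otimes> f = \<zero>"
    using neg_star_mult_zero[of "x \<otimes> f" "d \<otimes> d"] pos_square[OF d] x f by simp
  then have "\<ominus> (d \<otimes> d) = \<zero>" using eq by simp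
  then have "cnorm A (\<ominus> (d \<otimes> d)) = 0" by (simp only: norm_zero)
  then have "d = \<zero>" using norm_square[OF d] norm_eq_0[OF d(1)] d(1) by simp
  then have mf0: "m \<otimes> f = \<zero>"
    using r(2) rcl f mult_assoc[of r r f] by (simp add: d_def)
  then have "f \<otimes> f = \<zero>"
    using hf f mcl h mult_minus_left[of m h f] by (simp add: f_def[symmetric])
  then have "f = \<zero>" using norm_square[OF f] norm_eq_0[OF f(1)] by simp
  then have "m = h" using minus_eq_zero[of m h] mcl h by (simp add: f_def)
  then show ?thesis using m(1) by (simp add: h_def)
qed

lemma pos_conjugate:
  assumes q: "pos A q" and a: "a \<in> carrier A"
  shows "pos A (star A a \<otimes> q \<otimes> a)"
proof -
  obtain r where r: "pos A r" "r \<otimes> r = q" using pos_sqrt[OF q] by metis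
  then have "star A (r \<otimes> a) \<otimes> (r \<otimes> a) = star A a \<otimes> q \<otimes> a"
    using a by (simp add: star_mult pos_star mult_assoc flip: r(2))
  then show ?thesis using pos_star_mult[of "r \<otimes> a"] r a by simp
qed

section \<open>Norms and unitary equivalence of projections\<close>

lemma norm_projection: "projection A p \<Longrightarrow> cnorm A p \<le> 1"
proof -
  assume p: "projection A p"
  then have "cnorm A p = cnorm A p * cnorm A p"
    using norm_square[of p] by (simp add: projection_def power2_eq_square)
  then have "cnorm A p = 0 \<or> cnorm A p = 1" by simp
  then show ?thesis by auto
qed

lemma unitarily_equivalent_trans:
  assumes "unitarily_equivalent A p q" "unitarily_equivalent A q r" "p \<in> carrier A"
  shows "unitarily_equivalent A p r"
proof -
  obtain u v where u: "unitary A u" "q = u \<otimes> p \<otimes> star A u" and v: "unitary A v" "r = v \<otimes> q \<otimes> star A v"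
    using assms(1,2) by (auto simp: unitarily_equivalent_def)
  have uc: "u \<in> carrier A" "v \<in> carrier A" using u v by (auto simp: unitary_def)
  have "star A (v \<otimes> u) \<otimes> (v \<otimes> u) = star A u \<otimes> (star A v \<otimes> v) \<otimes> u"
    and "(v \<otimes> u) \<otimes> star A (v \<otimes> u) = v \<otimes> (u \<otimes> star A u) \<otimes> star A v"
    using uc by (simp_all add: star_mult mult_assoc)
  then have "unitary A (v \<otimes> u)"
    using u v uc by (simp add: unitary_def)
  moreover have "r = (v \<otimes> u) \<otimes> p \<otimes> star A (v \<otimes> u)"
    using u v uc assms(3) by (simp add: star_mult mult_assoc)
  ultimately show ?thesis by (auto simp: unitarily_equivalent_def)
qed

text \<open>The element \<open>w = q p + (1 - q) (1 - p)\<close> intertwines \<open>p\<close> and \<open>q\<close>, and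
  \<open>w\<^sup>* w = w w\<^sup>* = 1 - (p - q)\<^sup>2\<close>, so the unitary part of \<open>w\<close> conjugates \<open>p\<close> into \<open>q\<close>.\<close>

lemma unitarily_equivalent_close:
  assumes p: "projection A p" and q: "projection A q" and close: "cnorm A (p \<ominus> q) < 1"
  shows "unitarily_equivalent A p q"
proof -
  have pc: "p \<in> carrier A" "star A p = p" "p \<otimes> p = p" and qc: "q \<in> carrier A" "star A q = q" "q \<otimes> q = q"
    using p q by (auto simp: projection_def)
  have ppx: "p \<otimes> (p \<otimes> x) = p \<otimes> x" and qqx: "q \<otimes> (q \<otimes> x) = q \<otimes> x" if "x \<in> carrier A" for x
    using that pc qc by (simp_all add: mult_assoc[symmetric])
  note pq_simps = pc qc ppx qqx
  define z where "z = (p \<ominus> q) \<otimes> (p \<ominus> q)"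
  have z: "z \<in> carrier A" "star A z = z" using pc qc by (simp_all add: z_def star_mult star_minus)
  have nz: "cnorm A z < 1"
    using norm_square[of "p \<ominus> q"] pc qc close norm_nonneg[of "p \<ominus> q"]
    by (simp add: z_def star_minus power_less_one_iff)
  \<comment> \<open>The square of \<open>p \<ominus> q\<close> commutes with both projections, and
    this passes to the root \<open>s\<close> and its inverse \<open>g\<close>. Therefore dividing
    \<open>w\<close> by \<open>s\<close>, its absolute value, still leaves an element intertwining
    \<open>p\<close> and \<open>q\<close>.\<close>
  have zp: "z \<otimes> p = p \<otimes> z" "z \<otimes> q = q \<otimes> z"
    unfolding z_def by (simp_all add: ring_nf pq_simps)
  obtain y where y: "y \<in> cstar_generated A {z}" "y \<in> carrier A" "star A y = y"
      "cnorm A y \<le> cnorm A z" "(\<one> \<ominus> y) \<otimes> (\<one> \<ominus> y) = \<one> \<ominus> z"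
    using sqrt_one_minus[OF z] nz by (metis less_imp_le)
  have yp: "y \<otimes> p = p \<otimes> y" "y \<otimes> q = q \<otimes> y" using generated_commute z y(1) zp pc qc by auto
  define s where "s = \<one> \<ominus> y"
  have s: "s \<in> carrier A" "star A s = s" "s \<otimes> s = \<one> \<ominus> z" using y by (simp_all add: s_def star_minus)
  have sp: "s \<otimes> p = p \<otimes> s" "s \<otimes> q = q \<otimes> s"
    using y yp pc qc by (simp_all add: s_def mult_minus_left mult_minus_right)
  have "cnorm A y < 1" using y(4) nz by simp
  then obtain g where "g \<in> cstar_generated A {\<one>, y}" and gs: "g \<otimes> s = \<one>" "s \<otimes> g = \<one>"
    using inverse_one_minus[OF y(2)] unfolding s_def by metis
  then have g: "g \<in> carrier A" "g \<otimes> s = \<one>" "s \<otimes> g = \<one>"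
    using subalgebra_carrier[OF subalgebra_generated[of "{\<one>, y}"]] y(2) by auto
  have sg: "star A g = g"
  proof -
    have "star A g = star A g \<otimes> (s \<otimes> g)" using g by simp
    also have "\<dots> = star A (s \<otimes> g) \<otimes> g" using g(1) s by (simp add: star_mult mult_assoc)
    finally show ?thesis using g by simp
  qed
  have g_comm: "g \<otimes> c = c \<otimes> g" if c: "c \<in> carrier A" "s \<otimes> c = c \<otimes> s" for c
  proof -
    have "g \<otimes> c = g \<otimes> (c \<otimes> s) \<otimes> g" using g c s by (simp add: mult_assoc)
    also have "\<dots> = (g \<otimes> s) \<otimes> c \<otimes> g" using g(1) c s(1) by (simp add: mult_assoc flip: c(2))
    finally show ?thesis using g c by simp
  qed
  define w where "w = q \<otimes> p \<oplus> (\<one> \<ominus> q) \<otimes> (\<one> \<ominus> p)"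
  have w: "w \<in> carrier A" using pc qc by (simp add: w_def)
  have sw: "star A w = p \<otimes> q \<oplus> (\<one> \<ominus> p) \<otimes> (\<one> \<ominus> q)"
    using pc qc by (simp add: w_def star_add star_mult star_minus)
  have ww: "star A w \<otimes> w = \<one> \<ominus> z" "w \<otimes> star A w = \<one> \<ominus> z"
    unfolding sw unfolding w_def z_def by (simp_all add: ring_nf pq_simps)
  have wp: "w \<otimes> p = q \<otimes> w" unfolding w_def by (simp add: ring_nf pq_simps)
  have swc: "s \<otimes> w = w \<otimes> s"
    unfolding w_def using s sp pc qc
    by (simp add: mult_add_left mult_add_right mult_minus_left mult_minus_right one_left one_right)
      (simp add: mult_assoc[symmetric] sp, simp add: mult_assoc sp)
  have gw: "g \<otimes> w = w \<otimes> g" "g \<otimes> p = p \<otimes> g" using g_comm w swc sp pc by auto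
  define u where "u = w \<otimes> g"
  have "star A u \<otimes> u = g \<otimes> (star A w \<otimes> w) \<otimes> g" using w g sg by (simp add: u_def star_mult mult_assoc)
  also have "\<dots> = (g \<otimes> s) \<otimes> (s \<otimes> g)" unfolding ww s(3)[symmetric] using g(1) s(1) by (simp add: mult_assoc)
  finally have 1: "star A u \<otimes> u = \<one>" using g by simp
  have "u = g \<otimes> w" by (simp add: u_def gw)
  moreover have "star A (g \<otimes> w) = star A w \<otimes> g"
    using star_mult[OF g(1) w] by (simp only: sg)
  ultimately have "u \<otimes> star A u = (g \<otimes> w) \<otimes> (star A w \<otimes> g)" by simp
  also have "\<dots> = g \<otimes> (w \<otimes> star A w) \<otimes> g" using w g(1) by (simp add: mult_assoc)
  also have "\<dots> = (g \<otimes> s) \<otimes> (s \<otimes> g)" unfolding ww s(3)[symmetric] using g(1) s(1) by (simp add: mult_assoc)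
  finally have 2: "u \<otimes> star A u = \<one>" using g by simp
  have uc: "u \<in> carrier A" using w g(1) by (simp add: u_def)
  have "u \<otimes> p = w \<otimes> (g \<otimes> p)" using w g(1) pc(1) by (simp only: u_def mult_assoc)
  also have "\<dots> = (w \<otimes> p) \<otimes> g" using w g(1) pc(1) by (simp only: gw(2) mult_assoc)
  also have "\<dots> = q \<otimes> u" using w g(1) qc(1) by (simp only: wp u_def mult_assoc)
  finally have "u \<otimes> p \<otimes> star A u = q \<otimes> (u \<otimes> star A u)" using uc qc(1) by (simp add: mult_assoc)
  then have "q = u \<otimes> p \<otimes> star A u" using qc(1) by (simp add: 2)
  moreover have "unitary A u" using 1 2 uc by (simp add: unitary_def)
  ultimately show ?thesis by (auto simp: unitarily_equivalent_def)
qed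

end

section \<open>Operator norms\<close>

text \<open>The axioms of a C*-algebra that do not mention the norm. The unitization and the matrix
  algebras satisfy them by computation; the norm axioms then come from an action.\<close>

locale star_algebra = module "ring_of_type_algebra :: complex ring" E
  for E :: "'e cstar" (structure) +
  assumes mult_closed: "\<lbrakk>x \<in> carrier E; y \<in> carrier E\<rbrakk> \<Longrightarrow> x \<otimes> y \<in> carrier E"
    and mult_assoc: "\<lbrakk>x \<in> carrier E; y \<in> carrier E; z \<in> carrier E\<rbrakk>
      \<Longrightarrow> (x \<otimes> y) \<otimes> z = x \<otimes> (y \<otimes> z)"
    and mult_add_left: "\<lbrakk>x \<in> carrier E; y \<in> carrier E; z \<in> carrier E\<rbrakk>
      \<Longrightarrow> (x \<oplus> y) \<otimes> z = x \<otimes> z \<oplus> y \<otimes> z"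
    and mult_add_right: "\<lbrakk>x \<in> carrier E; y \<in> carrier E; z \<in> carrier E\<rbrakk>
      \<Longrightarrow> z \<otimes> (x \<oplus> y) = z \<otimes> x \<oplus> z \<otimes> y"
    and mult_smult_left: "\<lbrakk>x \<in> carrier E; y \<in> carrier E\<rbrakk> \<Longrightarrow> (c \<odot> x) \<otimes> y = c \<odot> (x \<otimes> y)"
    and mult_smult_right: "\<lbrakk>x \<in> carrier E; y \<in> carrier E\<rbrakk> \<Longrightarrow> x \<otimes> (c \<odot> y) = c \<odot> (x \<otimes> y)"
    and star_closed: "x \<in> carrier E \<Longrightarrow> star E x \<in> carrier E"
    and star_star: "x \<in> carrier E \<Longrightarrow> star E (star E x) = x"
    and star_add: "\<lbrakk>x \<in> carrier E; y \<in> carrier E\<rbrakk> \<Longrightarrow> star E (x \<oplus> y) = star E x \<oplus> star E y"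
    and star_smult: "x \<in> carrier E \<Longrightarrow> star E (c \<odot> x) = cnj c \<odot> star E x"
    and star_mult: "\<lbrakk>x \<in> carrier E; y \<in> carrier E\<rbrakk> \<Longrightarrow> star E (x \<otimes> y) = star E y \<otimes> star E x"

text \<open>A *-algebra acting on a set \<open>V\<close> of vectors with a length function \<open>\<nu>\<close>. Only the lengths
  of vectors enter, so linearity of \<open>V\<close> is not required; \<open>adjoint_le\<close> is what remains of the
  Cauchy--Schwarz inequality and yields the C*-identity for the operator norm.\<close>

locale operator_norm = star_algebra E
  for E :: "'e cstar" (structure) +
  fixes V :: "'x set" and \<nu> :: "'x \<Rightarrow> real" and act :: "'e \<Rightarrow> 'x \<Rightarrow> 'x" and scale :: "real \<Rightarrow> 'x \<Rightarrow> 'x"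
  assumes small_vector: "\<exists>x\<in>V. \<nu> x \<le> 1"
    and length_nonneg: "x \<in> V \<Longrightarrow> 0 \<le> \<nu> x"
    and act_closed: "\<lbrakk>T \<in> carrier E; x \<in> V\<rbrakk> \<Longrightarrow> act T x \<in> V"
    and act_add: "\<lbrakk>S \<in> carrier E; T \<in> carrier E; x \<in> V\<rbrakk> \<Longrightarrow> \<nu> (act (S \<oplus> T) x) \<le> \<nu> (act S x) + \<nu> (act T x)"
    and act_smult: "\<lbrakk>T \<in> carrier E; x \<in> V\<rbrakk> \<Longrightarrow> \<nu> (act (c \<odot> T) x) = cmod c * \<nu> (act T x)"
    and act_mult: "\<lbrakk>S \<in> carrier E; T \<in> carrier E; x \<in> V\<rbrakk> \<Longrightarrow> \<nu> (act (S \<otimes> T) x) = \<nu> (act S (act T x))"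
    and act_bounded: "T \<in> carrier E \<Longrightarrow> \<exists>C. \<forall>x\<in>V. \<nu> (act T x) \<le> C * \<nu> x"
    and scale_closed: "\<lbrakk>x \<in> V; r > 0\<rbrakk> \<Longrightarrow> scale r x \<in> V"
    and scale_length: "\<lbrakk>x \<in> V; r > 0\<rbrakk> \<Longrightarrow> \<nu> (scale r x) = r * \<nu> x"
    and act_scale: "\<lbrakk>T \<in> carrier E; x \<in> V; r > 0\<rbrakk> \<Longrightarrow> \<nu> (act T (scale r x)) = r * \<nu> (act T x)"
    and adjoint_le: "\<lbrakk>T \<in> carrier E; x \<in> V\<rbrakk> \<Longrightarrow> (\<nu> (act T x))\<^sup>2 \<le> \<nu> x * \<nu> (act (star E T \<otimes> T) x)"
    and act_faithful: "\<lbrakk>T \<in> carrier E; \<And>x. x \<in> V \<Longrightarrow> \<nu> (act T x) = 0\<rbrakk> \<Longrightarrow> T = \<zero>"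
    and cnorm_eq: "T \<in> carrier E \<Longrightarrow> cnorm E T = (SUP x\<in>{x \<in> V. \<nu> x \<le> 1}. \<nu> (act T x))"
begin

lemma bdd_above_act: "T \<in> carrier E \<Longrightarrow> bdd_above ((\<lambda>x. \<nu> (act T x)) ` {x \<in> V. \<nu> x \<le> 1})"
proof -
  assume T: "T \<in> carrier E"
  then obtain C where C: "\<And>x. x \<in> V \<Longrightarrow> \<nu> (act T x) \<le> C * \<nu> x" using act_bounded by blast
  have "\<nu> (act T x) \<le> \<bar>C\<bar>" if "x \<in> V" "\<nu> x \<le> 1" for x
  proof -
    have "C * \<nu> x \<le> \<bar>C\<bar> * 1" using that length_nonneg by (intro mult_mono) auto
    with C[OF that(1)] show ?thesis by simp
  qed
  then show ?thesis by (intro bdd_aboveI2) auto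
qed

lemma length_act_le: "\<lbrakk>T \<in> carrier E; x \<in> V\<rbrakk> \<Longrightarrow> \<nu> (act T x) \<le> cnorm E T * \<nu> x"
proof (cases "\<nu> x = 0")
  \<comment> \<open>A vector of length 0 cannot be normalised, but boundedness forces its image to
    have length 0.\<close>
  case True
  assume "T \<in> carrier E" "x \<in> V"
  with True act_bounded[of T] show ?thesis by auto
next
  case False
  assume T: "T \<in> carrier E" and x: "x \<in> V"
  with False have pos: "\<nu> x > 0" using length_nonneg[of x] by simp
  let ?y = "scale (1 / \<nu> x) x"
  have "\<nu> (act T ?y) \<le> cnorm E T"
    unfolding cnorm_eq[OF T] using T x pos
    by (intro cSUP_upper bdd_above_act) (simp_all add: scale_closed scale_length)
  then show ?thesis using T x pos by (simp add: act_scale field_simps)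
qed

lemma cnorm_leI: "\<lbrakk>T \<in> carrier E; \<And>x. \<lbrakk>x \<in> V; \<nu> x \<le> 1\<rbrakk> \<Longrightarrow> \<nu> (act T x) \<le> b\<rbrakk> \<Longrightarrow> cnorm E T \<le> b"
  unfolding cnorm_eq using small_vector by (intro cSUP_least) auto

lemma op_norm_nonneg: "T \<in> carrier E \<Longrightarrow> 0 \<le> cnorm E T"
proof -
  assume T: "T \<in> carrier E"
  obtain x where x: "x \<in> V" "\<nu> x \<le> 1" using small_vector by blast
  have "0 \<le> \<nu> (act T x)" using T x act_closed length_nonneg by blast
  also have "\<dots> \<le> cnorm E T"
    unfolding cnorm_eq[OF T] using T x by (intro cSUP_upper bdd_above_act) auto
  finally show ?thesis .
qed

lemma length_act_le_norm: "\<lbrakk>T \<in> carrier E; x \<in> V; \<nu> x \<le> 1\<rbrakk> \<Longrightarrow> \<nu> (act T x) \<le> cnorm E T"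
  using length_act_le[of T x] mult_left_mono[of "\<nu> x" 1 "cnorm E T"] op_norm_nonneg by fastforce

lemma normed_module: "normed_module E"
proof
  have smult_in: "c \<odot> x \<in> carrier E" if "x \<in> carrier E" for c x
    using smult_closed[of c x] that by (simp add: ring_of_type_algebra_def)
  fix S T c
  assume S: "S \<in> carrier E"
  show "0 \<le> cnorm E S" using S by (rule op_norm_nonneg)
  have zero: "0 \<odot> S = \<zero>" using smult_l_null[OF S] by (simp add: ring_of_type_algebra_def)
  have cN: "cnorm E (c \<odot> S) \<le> cmod c * cnorm E S" if S: "S \<in> carrier E" for S c
  proof (rule cnorm_leI)
    fix x assume x: "x \<in> V" "\<nu> x \<le> 1"
    show "\<nu> (act (c \<odot> S) x) \<le> cmod c * cnorm E S"
      using act_smult[OF S x(1)] length_act_le_norm[OF S x] by (simp add: mult_left_mono)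
  qed (simp add: smult_in S)
  show "cnorm E S = 0 \<longleftrightarrow> S = \<zero>"
  proof
    assume "cnorm E S = 0"
    show "S = \<zero>"
    proof (rule act_faithful[OF S])
      fix x assume x: "x \<in> V"
      show "\<nu> (act S x) = 0"
        using length_act_le[OF S x] length_nonneg[OF act_closed[OF S x]] \<open>cnorm E S = 0\<close> by simp
    qed
  next
    assume "S = \<zero>"
    then show "cnorm E S = 0" using cN[OF S, of 0] zero op_norm_nonneg[OF S] by simp
  qed
  \<comment> \<open>The missing inequality is \<open>cN\<close> for the scalar
    \<open>1 / c\<close>.\<close>
  show "cnorm E (c \<odot> S) = cmod c * cnorm E S"
  proof (cases "c = 0")
    case True
    then show ?thesis using cN[OF S, of 0] op_norm_nonneg[OF smult_in[OF S], of 0] by simp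
  next
    case False
    have "S = (1 / c) \<odot> (c \<odot> S)"
      using False S smult_assoc1[of "1 / c" c S] smult_one[of S] by (simp add: ring_of_type_algebra_def)
    then have "cnorm E S \<le> cmod (1 / c) * cnorm E (c \<odot> S)" using cN[of "c \<odot> S" "1 / c"] S smult_in by simp
    then have "cmod c * cnorm E S \<le> cnorm E (c \<odot> S)" using False by (simp add: norm_divide field_simps)
    with cN[OF S, of c] show ?thesis by simp
  qed
  assume T: "T \<in> carrier E"
  show "cnorm E (S \<oplus> T) \<le> cnorm E S + cnorm E T"
  proof (rule cnorm_leI)
    fix x assume x: "x \<in> V" "\<nu> x \<le> 1"
    show "\<nu> (act (S \<oplus> T) x) \<le> cnorm E S + cnorm E T"
      using act_add[OF S T x(1)] length_act_le_norm[OF S x] length_act_le_norm[OF T x] by simp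
  qed (use S T in simp)
qed

lemma op_norm_mult:
  assumes S: "S \<in> carrier E" and T: "T \<in> carrier E"
  shows "cnorm E (S \<otimes> T) \<le> cnorm E S * cnorm E T"
proof (rule cnorm_leI)
  fix x assume x: "x \<in> V" "\<nu> x \<le> 1"
  have "\<nu> (act (S \<otimes> T) x) \<le> cnorm E S * \<nu> (act T x)"
    using act_mult[OF S T x(1)] length_act_le[OF S act_closed[OF T x(1)]] by simp
  also have "\<dots> \<le> cnorm E S * cnorm E T"
    using length_act_le_norm[OF T x] op_norm_nonneg[OF S] by (intro mult_left_mono)
  finally show "\<nu> (act (S \<otimes> T) x) \<le> cnorm E S * cnorm E T" .
qed (use S T mult_closed in simp)

text \<open>From \<open>adjoint_le\<close> comes \<open>\<parallel>T\<parallel>\<^sup>2 \<le>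
  \<parallel>T\<^sup>* T\<parallel>\<close>. With submultiplicativity this gives
  \<open>\<parallel>T\<parallel> \<le> \<parallel>T\<^sup>*\<parallel>\<close>; the same for the
  adjoint yields the reverse inequality.\<close>

lemma op_norm_star_mult:
  assumes T: "T \<in> carrier E"
  shows "cnorm E (star E T \<otimes> T) = (cnorm E T)\<^sup>2"
proof -
  let ?n = "cnorm E"
  have le: "(?n T)\<^sup>2 \<le> ?n (star E T \<otimes> T)" if T: "T \<in> carrier E" for T
  proof -
    have TT: "star E T \<otimes> T \<in> carrier E" using T mult_closed star_closed by simp
    have "?n T \<le> sqrt (?n (star E T \<otimes> T))"
    proof (rule cnorm_leI[OF T])
      fix x assume x: "x \<in> V" "\<nu> x \<le> 1"
      have "(\<nu> (act T x))\<^sup>2 \<le> \<nu> x * \<nu> (act (star E T \<otimes> T) x)" using adjoint_le[OF T x(1)] .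
      also have "\<dots> \<le> 1 * ?n (star E T \<otimes> T)"
        using x length_act_le_norm[OF TT x] length_nonneg act_closed[OF TT x(1)] by (intro mult_mono) auto
      finally show "\<nu> (act T x) \<le> sqrt (?n (star E T \<otimes> T))" by (simp add: real_le_rsqrt)
    qed
    then have "(?n T)\<^sup>2 \<le> (sqrt (?n (star E T \<otimes> T)))\<^sup>2" using op_norm_nonneg[OF T] by (intro power_mono)
    then show ?thesis using op_norm_nonneg[OF TT] by simp
  qed
  have star_le: "?n T \<le> ?n (star E T)" if T: "T \<in> carrier E" for T
  proof (cases "?n T = 0")
    case False
    have "?n T * ?n T \<le> ?n (star E T) * ?n T"
      using le[OF T] op_norm_mult[OF star_closed[OF T] T] by (simp add: power2_eq_square)
    with False op_norm_nonneg[OF T] show ?thesis by simp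
  qed (simp add: op_norm_nonneg star_closed T)
  have "?n (star E T) \<le> ?n T" using star_le[OF star_closed[OF T]] star_star[OF T] by simp
  then have "?n (star E T) * ?n T \<le> ?n T * ?n T" using op_norm_nonneg[OF T] by (intro mult_right_mono)
  then show ?thesis
    using le[OF T] op_norm_mult[OF star_closed[OF T] T] by (simp add: power2_eq_square)
qed

text \<open>Completeness is the one axiom that an action does not provide.\<close>

lemma cstar_algebraI:
  assumes "\<And>f. cauchy E f \<Longrightarrow> \<exists>l. tends E f l"
  shows "cstar_algebra E"
proof -
  interpret N: normed_module E by (rule normed_module)
  have "Metric_space.mcomplete (carrier E) (cdist E)" using N.mcomplete_iff assms by simp
  then show ?thesis
    by unfold_locales (simp_all add: mult_closed mult_assoc mult_add_left mult_add_right mult_smult_left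
        mult_smult_right star_closed star_star star_add star_smult star_mult N.norm_nonneg N.norm_eq_0
        N.norm_triangle N.norm_smult op_norm_mult op_norm_star_mult)
qed

end

section \<open>The unitization is a C*-algebra\<close>

lemma module_complexI:
  fixes E :: "'e cstar" (structure)
  assumes "abelian_group E"
    and "\<And>c x. x \<in> carrier E \<Longrightarrow> c \<odot> x \<in> carrier E"
    and "\<And>c d x. x \<in> carrier E \<Longrightarrow> (c + d) \<odot> x = c \<odot> x \<oplus> d \<odot> x"
    and "\<And>c x y. \<lbrakk>x \<in> carrier E; y \<in> carrier E\<rbrakk> \<Longrightarrow> c \<odot> (x \<oplus> y) = c \<odot> x \<oplus> c \<odot> y"
    and "\<And>c d x. x \<in> carrier E \<Longrightarrow> (c * d) \<odot> x = c \<odot> (d \<odot> x)"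
    and "\<And>x. x \<in> carrier E \<Longrightarrow> 1 \<odot> x = x"
  shows "module (ring_of_type_algebra :: complex ring) E"
  by (rule moduleI[OF cring_from_type_algebra assms(1)])
    (simp_all add: ring_of_type_algebra_def assms(2-))

context cstar_algebra
begin

abbreviation At :: "('a \<times> complex) cstar" where "At \<equiv> unitization A"

lemma unitization_simps:
  "carrier At = (if has_unit A then carrier A \<times> {0} else carrier A \<times> UNIV)"
  "(a, s) \<otimes>\<^bsub>At\<^esub> (b, t) = ((a \<otimes> b \<oplus> s \<odot> b) \<oplus> t \<odot> a, s * t)"
  "\<one>\<^bsub>At\<^esub> = (if has_unit A then (THE e. is_unit_of A e, 0) else (\<zero>, 1))"
  "\<zero>\<^bsub>At\<^esub> = (\<zero>, 0)"
  "(a, s) \<oplus>\<^bsub>At\<^esub> (b, t) = (a \<oplus> b, s + t)"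
  "c \<odot>\<^bsub>At\<^esub> (a, s) = (c \<odot> a, c * s)"
  "star At (a, s) = (star A a, cnj s)"
  by (simp_all add: unitization_def)

lemma in_unitization: "x \<in> carrier At \<Longrightarrow> fst x \<in> carrier A"
  by (auto simp: unitization_simps split: if_splits)

lemma is_unit_unique: "\<lbrakk>is_unit_of A e; is_unit_of A f\<rbrakk> \<Longrightarrow> e = f"
  unfolding is_unit_of_def by metis

lemma unit_of_the: "has_unit A \<Longrightarrow> is_unit_of A (THE e. is_unit_of A e)"
  unfolding has_unit_def by (metis is_unit_unique theI)

text \<open>By the C*-identity the supremum is attained at the adjoint of \<open>a\<close> divided
  by \<open>\<parallel>a\<parallel>\<close>. The summand with coefficient 0 keeps the shape of the
  norm formula for the unitization.\<close>

lemma norm_left_mult_eq: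
  assumes a: "a \<in> carrier A"
  shows "(SUP x\<in>{x \<in> carrier A. cnorm A x \<le> 1}. cnorm A (a \<otimes> x \<oplus> 0 \<odot> x)) = cnorm A a"
proof (rule antisym)
  have le: "cnorm A (a \<otimes> x \<oplus> 0 \<odot> x) \<le> cnorm A a" if "x \<in> carrier A" "cnorm A x \<le> 1" for x
    using a that order_trans[OF cnorm_mult[OF a that(1)] mult_left_mono[OF that(2) norm_nonneg[OF a]]] by simp
  show "(SUP x\<in>{x \<in> carrier A. cnorm A x \<le> 1}. cnorm A (a \<otimes> x \<oplus> 0 \<odot> x)) \<le> cnorm A a"
    by (rule cSUP_least) (use le zero_in in \<open>auto intro!: exI[of _ \<zero>]\<close>)
  have bdd: "bdd_above ((\<lambda>x. cnorm A (a \<otimes> x \<oplus> 0 \<odot> x)) ` {x \<in> carrier A. cnorm A x \<le> 1})"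
    by (rule bdd_aboveI2[of _ _ "cnorm A a"]) (use le in auto)
  show "cnorm A a \<le> (SUP x\<in>{x \<in> carrier A. cnorm A x \<le> 1}. cnorm A (a \<otimes> x \<oplus> 0 \<odot> x))"
  proof (cases "cnorm A a = 0")
    case True
    then have "a = \<zero>" using a norm_eq_0 by simp
    have "cnorm A (a \<otimes> \<zero> \<oplus> 0 \<odot> \<zero>) \<le> (SUP x\<in>{x \<in> carrier A. cnorm A x \<le> 1}. cnorm A (a \<otimes> x \<oplus> 0 \<odot> x))"
      by (rule cSUP_upper[OF _ bdd]) simp
    with True a show ?thesis by simp
  next
    case False
    then have n: "cnorm A a > 0" using norm_nonneg[OF a] by simp
    define x where "x = complex_of_real (1 / cnorm A a) \<odot> star A a"
    have x: "x \<in> carrier A" "cnorm A x \<le> 1" using a n by (simp_all add: x_def norm_smult norm_divide)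
    have "cnorm A (a \<otimes> x \<oplus> 0 \<odot> x) = cnorm A a"
      using a n x by (simp add: x_def mult_smult_right norm_smult norm_mult_star norm_divide power2_eq_square)
    moreover have "cnorm A (a \<otimes> x \<oplus> 0 \<odot> x) \<le> (SUP x\<in>{x \<in> carrier A. cnorm A x \<le> 1}. cnorm A (a \<otimes> x \<oplus> 0 \<odot> x))"
      by (rule cSUP_upper[OF _ bdd]) (use x in simp)
    ultimately show ?thesis by simp
  qed
qed

text \<open>One formula for both branches of the definition, so that the operator norm argument
  needs no case distinction on the existence of a unit.\<close>

lemma cnorm_unitization:
  assumes "x \<in> carrier At"
  shows "cnorm At x = (SUP y\<in>{y \<in> carrier A. cnorm A y \<le> 1}. cnorm A (fst x \<otimes> y \<oplus> snd x \<odot> y))"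
  using assms norm_left_mult_eq[OF in_unitization[OF assms]]
  by (cases x) (auto simp: unitization_def)

lemma cnorm_unitization_embed: "a \<in> carrier A \<Longrightarrow> cnorm At (a, 0) = cnorm A a"
  using cnorm_unitization[of "(a, 0)"] norm_left_mult_eq[of a] by (simp add: unitization_simps)

lemma unitization_module: "module (ring_of_type_algebra :: complex ring) At"
proof (rule module_complexI)
  show "abelian_group At"
  proof (rule abelian_groupI)
    fix x assume x: "x \<in> carrier At"
    show "\<exists>y\<in>carrier At. y \<oplus>\<^bsub>At\<^esub> x = \<zero>\<^bsub>At\<^esub>"
      by (rule bexI[of _ "(\<ominus> fst x, - snd x)"])
        (use x in \<open>auto simp: unitization_simps M.l_neg split: if_splits\<close>)
  qed (auto simp: unitization_simps M.a_ac split: if_splits)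
qed (auto simp: unitization_simps smult_add_left smult_add_right algebra_simps split: if_splits)

lemma unitization_star_algebra: "star_algebra At"
proof (intro star_algebra.intro star_algebra_axioms.intro unitization_module)
  fix x y z assume x: "x \<in> carrier At" and y: "y \<in> carrier At" and z: "z \<in> carrier At"
  obtain a s b t c u where eq: "x = (a, s)" "y = (b, t)" "z = (c, u)" by (metis surj_pair)
  have cl: "a \<in> carrier A" "b \<in> carrier A" "c \<in> carrier A"
    using in_unitization[OF x] in_unitization[OF y] in_unitization[OF z] eq by simp_all
  show "(x \<otimes>\<^bsub>At\<^esub> y) \<otimes>\<^bsub>At\<^esub> z = x \<otimes>\<^bsub>At\<^esub> (y \<otimes>\<^bsub>At\<^esub> z)"
    using cl by (simp add: eq unitization_simps mult_add_left mult_add_right mult_smult_left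
        mult_smult_right mult_assoc smult_add_right M.a_ac mult.commute)
  show "(x \<oplus>\<^bsub>At\<^esub> y) \<otimes>\<^bsub>At\<^esub> z = x \<otimes>\<^bsub>At\<^esub> z \<oplus>\<^bsub>At\<^esub> y \<otimes>\<^bsub>At\<^esub> z"
    using cl by (simp add: eq unitization_simps mult_add_left mult_add_right
        smult_add_right smult_add_left M.a_ac algebra_simps)
  show "z \<otimes>\<^bsub>At\<^esub> (x \<oplus>\<^bsub>At\<^esub> y) = z \<otimes>\<^bsub>At\<^esub> x \<oplus>\<^bsub>At\<^esub> z \<otimes>\<^bsub>At\<^esub> y"
    using cl by (simp add: eq unitization_simps mult_add_left mult_add_right
        smult_add_right smult_add_left M.a_ac algebra_simps)
qed (auto simp: unitization_simps star_mult star_add star_smult mult_smult_left mult_smult_right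
      smult_add_right M.a_ac mult.commute split: if_splits)

text \<open>The algebra \<open>A\<close> serves as its own space of vectors. The adjoint inequality
  follows from \<open>x\<^sup>* (T\<^sup>* T x) = (T x)\<^sup>* (T x)\<close> and the C*-identity;
  faithfulness is where the restriction of the carrier in the unital case matters.\<close>

lemma unitization_operator_norm:
  "operator_norm At (carrier A) (cnorm A) (\<lambda>(a, s) x. a \<otimes> x \<oplus> s \<odot> x) (\<lambda>r x. complex_of_real r \<odot> x)"
proof (intro operator_norm.intro operator_norm_axioms.intro unitization_star_algebra)
  show "\<exists>x\<in>carrier A. cnorm A x \<le> 1" by (rule bexI[of _ \<zero>]) simp_all
next
  fix S T x c
  assume S: "S \<in> carrier At" and T: "T \<in> carrier At" and x: "x \<in> carrier A"
  obtain a s b t where eq: "S = (a, s)" "T = (b, t)" by (metis surj_pair)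
  have cl: "a \<in> carrier A" "b \<in> carrier A" using in_unitization[OF S] in_unitization[OF T] eq by simp_all
  have "(case S \<oplus>\<^bsub>At\<^esub> T of (a, s) \<Rightarrow> \<lambda>x. a \<otimes> x \<oplus> s \<odot> x) x
      = (case S of (a, s) \<Rightarrow> \<lambda>x. a \<otimes> x \<oplus> s \<odot> x) x \<oplus> (case T of (a, s) \<Rightarrow> \<lambda>x. a \<otimes> x \<oplus> s \<odot> x) x"
    using cl x by (simp add: eq unitization_simps mult_add_left smult_add_left M.a_ac)
  then show "cnorm A ((case S \<oplus>\<^bsub>At\<^esub> T of (a, s) \<Rightarrow> \<lambda>x. a \<otimes> x \<oplus> s \<odot> x) x)
      \<le> cnorm A ((case S of (a, s) \<Rightarrow> \<lambda>x. a \<otimes> x \<oplus> s \<odot> x) x) + cnorm A ((case T of (a, s) \<Rightarrow> \<lambda>x. a \<otimes> x \<oplus> s \<odot> x) x)"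
    using cl x eq by (simp add: norm_triangle)
  show "cnorm A ((case S \<otimes>\<^bsub>At\<^esub> T of (a, s) \<Rightarrow> \<lambda>x. a \<otimes> x \<oplus> s \<odot> x) x)
      = cnorm A ((case S of (a, s) \<Rightarrow> \<lambda>x. a \<otimes> x \<oplus> s \<odot> x) ((case T of (a, s) \<Rightarrow> \<lambda>x. a \<otimes> x \<oplus> s \<odot> x) x))"
    using cl x by (simp add: eq unitization_simps mult_add_left mult_add_right mult_smult_left
        mult_smult_right mult_assoc smult_add_right M.a_ac)
next
  fix T x c
  assume T: "T \<in> carrier At" and x: "x \<in> carrier A"
  obtain b t where eq: "T = (b, t)" by (metis surj_pair)
  have cl: "b \<in> carrier A" using in_unitization[OF T] eq by simp
  let ?act = "\<lambda>T x. (case T of (a, s) \<Rightarrow> \<lambda>x. a \<otimes> x \<oplus> s \<odot> x) x"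
  show "?act T x \<in> carrier A" using cl x by (simp add: eq)
  have "?act (c \<odot>\<^bsub>At\<^esub> T) x = c \<odot> ?act T x"
    using cl x by (simp add: eq unitization_simps smult_add_right mult_smult_left)
  then show "cnorm A (?act (c \<odot>\<^bsub>At\<^esub> T) x) = cmod c * cnorm A (?act T x)"
    using cl x by (simp add: eq norm_smult)
  have "?act (star At T \<otimes>\<^bsub>At\<^esub> T) x = star A b \<otimes> ?act T x \<oplus> cnj t \<odot> ?act T x"
    using cl x by (simp add: eq unitization_simps mult_add_left mult_add_right mult_smult_left
        mult_smult_right mult_assoc smult_add_right M.a_ac)
  then have "star A x \<otimes> ?act (star At T \<otimes>\<^bsub>At\<^esub> T) x = star A (?act T x) \<otimes> ?act T x"
    using cl x by (simp add: eq star_add star_mult star_smult mult_add_left mult_add_right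
        mult_smult_left mult_smult_right mult_assoc smult_add_right M.a_ac mult.commute)
  then have "(cnorm A (?act T x))\<^sup>2 = cnorm A (star A x \<otimes> ?act (star At T \<otimes>\<^bsub>At\<^esub> T) x)"
    using cl x by (simp add: eq cnorm_star_mult)
  also have "\<dots> \<le> cnorm A (star A x) * cnorm A (?act (star At T \<otimes>\<^bsub>At\<^esub> T) x)"
    using cl x by (intro cnorm_mult) (simp_all add: eq unitization_simps)
  finally show "(cnorm A (?act T x))\<^sup>2 \<le> cnorm A x * cnorm A (?act (star At T \<otimes>\<^bsub>At\<^esub> T) x)"
    using x by simp
  fix r :: real
  assume r: "r > 0"
  have "?act T (complex_of_real r \<odot> x) = complex_of_real r \<odot> ?act T x"
    using cl x by (simp add: eq smult_add_right mult_smult_right mult.commute)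
  then show "cnorm A (?act T (complex_of_real r \<odot> x)) = r * cnorm A (?act T x)"
    using cl x r by (simp add: eq norm_smult)
next
  fix T assume T: "T \<in> carrier At"
  obtain b t where eq: "T = (b, t)" by (metis surj_pair)
  have b: "b \<in> carrier A" using in_unitization[OF T] eq by simp
  have "cnorm A (b \<otimes> x \<oplus> t \<odot> x) \<le> (cnorm A b + cmod t) * cnorm A x" if x: "x \<in> carrier A" for x
    using norm_triangle[of "b \<otimes> x" "t \<odot> x"] cnorm_mult[OF b x] b x by (simp add: norm_smult algebra_simps)
  then show "\<exists>C. \<forall>x\<in>carrier A. cnorm A ((case T of (a, s) \<Rightarrow> \<lambda>x. a \<otimes> x \<oplus> s \<odot> x) x) \<le> C * cnorm A x"
    by (auto simp: eq)
  show "cnorm At T = (SUP x\<in>{x \<in> carrier A. cnorm A x \<le> 1}. cnorm A ((case T of (a, s) \<Rightarrow> \<lambda>x. a \<otimes> x \<oplus> s \<odot> x) x))"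
    using cnorm_unitization[OF T] by (simp add: eq)
  assume ker: "\<And>x. x \<in> carrier A \<Longrightarrow> cnorm A ((case T of (a, s) \<Rightarrow> \<lambda>x. a \<otimes> x \<oplus> s \<odot> x) x) = 0"
  then have ker: "b \<otimes> x \<oplus> t \<odot> x = \<zero>" if "x \<in> carrier A" for x
    using that b norm_eq_0[of "b \<otimes> x \<oplus> t \<odot> x"] by (simp add: eq)
  show "T = \<zero>\<^bsub>At\<^esub>"
  proof (cases "t = 0")
    case True
    then have "b \<otimes> star A b = \<zero>" using ker[of "star A b"] b by simp
    then have "b = \<zero>" using norm_mult_star[OF b] norm_eq_0[OF b] by simp
    with True show ?thesis by (simp add: eq unitization_simps)
  next
    case False
    \<comment> \<open>If \<open>b + t 1\<close> kills \<open>A\<close> and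
      \<open>t \<noteq> 0\<close>, then \<open>- b / t\<close> is a left unit. Its adjoint is a
      right unit, so the two coincide and \<open>A\<close> has a unit. But then the carrier holds
      only pairs with second component 0.\<close>
    define e where "e = (- 1 / t) \<odot> b"
    have e: "e \<in> carrier A" using b by (simp add: e_def)
    have l: "e \<otimes> x = x" if x: "x \<in> carrier A" for x
    proof -
      have "b \<otimes> x = (- t) \<odot> x"
        using M.minus_equality[OF ker[OF x]] b x smult_add_left[of x "-t" t] M.minus_equality[of "(-t) \<odot> x" "t \<odot> x"]
        by simp
      then show ?thesis using x b False by (simp add: e_def mult_smult_left)
    qed
    have r: "x \<otimes> star A e = x" if x: "x \<in> carrier A" for x
      using l[of "star A x"] star_mult[of e "star A x"] x e by simp
    have "star A e = e" using l[of "star A e"] r[of e] e by simp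
    then have "is_unit_of A e" using l r e by (simp add: is_unit_of_def)
    then have "t = 0" using T by (auto simp: eq unitization_simps has_unit_def split: if_splits)
    with False show ?thesis by simp
  qed
qed (simp_all add: norm_nonneg norm_smult)

text \<open>In the non-unital case the scalar part is a bounded functional, because \<open>A\<close> is complete and
  therefore closed in its unitization.\<close>

lemma unitization_complete:
  assumes f: "cauchy At f"
  shows "\<exists>l. tends At f l"
proof -
  interpret O: operator_norm "At" "carrier A" "cnorm A" "\<lambda>(a, s) x. a \<otimes> x \<oplus> s \<odot> x" "\<lambda>r x. complex_of_real r \<odot> x"
    by (rule unitization_operator_norm)
  interpret N: normed_module "At" by (rule O.normed_module)
  have minus: "(a, s) \<ominus>\<^bsub>At\<^esub> (b, t) = (a \<ominus> b, s - t)"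
    if "(a, s) \<in> carrier At" "(b, t) \<in> carrier At" for a s b t
    using that in_unitization[OF that(1)] in_unitization[OF that(2)]
    by (simp add: N.minus_smult unitization_simps minus_smult)
  have fc: "f n \<in> carrier At" for n using f by (simp add: cauchy_def)
  define a s where "a n = fst (f n)" and "s n = snd (f n)" for n
  have fas: "f n = (a n, s n)" for n by (simp add: a_def s_def)
  have ac: "a n \<in> carrier A" for n using in_unitization[OF fc] by (simp add: a_def)
  have embed_in: "(x, 0) \<in> carrier At" if "x \<in> carrier A" for x using that by (simp add: unitization_simps)
  show ?thesis
  proof (cases "has_unit A")
    case True
    then have s0: "s n = 0" for n using fc[of n] by (auto simp: fas unitization_simps)
    then have "cnorm A (a m \<ominus> a n) = cnorm At (f m \<ominus>\<^bsub>At\<^esub> f n)" for m n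
      using ac fc[of m] fc[of n] by (simp add: fas minus cnorm_unitization_embed)
    then have "cauchy A a" using f ac by (simp add: cauchy_def)
    then obtain l where l: "tends A a l" using cauchy_tends by blast
    then have lc: "l \<in> carrier A" by (simp add: tends_def)
    have "cnorm A (a n \<ominus> l) = cnorm At (f n \<ominus>\<^bsub>At\<^esub> (l, 0))" for n
      using ac lc fc[of n] s0 by (simp add: fas minus embed_in cnorm_unitization_embed)
    then have "tends At f (l, 0)" using l fc lc by (simp add: tends_def embed_in)
    then show ?thesis by blast
  next
    case False
    then have in_At: "(x, u) \<in> carrier At \<longleftrightarrow> x \<in> carrier A" for x u by (simp add: unitization_simps)
    let ?N = "cnorm At"
    have triangle: "?N (x \<oplus> y, u + v) \<le> ?N (x, u) + ?N (y, v)" if "x \<in> carrier A" "y \<in> carrier A" for x y u v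
      using N.norm_triangle[of "(x, u)" "(y, v)"] that by (simp add: in_At unitization_simps(5))
    have scalar: "?N (\<zero>, u) \<le> cmod u" for u
    proof (rule O.cnorm_leI)
      show "cnorm A ((case (\<zero>, u) of (a, s) \<Rightarrow> \<lambda>x. a \<otimes> x \<oplus> s \<odot> x) x) \<le> cmod u"
        if "x \<in> carrier A" "cnorm A x \<le> 1" for x
        using that mult_left_mono[OF that(2), of "cmod u"] by (simp add: norm_smult)
    qed (simp add: in_At)
    \<comment> \<open>The gap \<open>d\<close> is a lower bound for the distance from 1 to the copy
      of \<open>A\<close>. If it were missing, elements \<open>b n\<close> of \<open>A\<close> would
      approach -1; they form a Cauchy sequence, and their limit \<open>l\<close> in \<open>A\<close>
      would give \<open>l + 1 = 0\<close>.\<close>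
    have "\<exists>d>0. \<forall>x\<in>carrier A. d \<le> ?N (x, 1)"
    proof (rule ccontr)
      assume "\<not> ?thesis"
      then have "\<exists>x\<in>carrier A. ?N (x, 1) < 1 / Suc n" for n
        using of_nat_0_less_iff[of "Suc n"] by (metis not_le zero_less_Suc zero_less_divide_1_iff)
      then obtain b where b: "\<And>n. b n \<in> carrier A" "\<And>n. ?N (b n, 1) < 1 / Suc n" by metis
      have dist: "cnorm A (b m \<ominus> b n) \<le> ?N (b m, 1) + ?N (b n, 1)" for m n
        using N.norm_minus_triangle[of "(b m, 1)" "(b n, 1)"] b(1)
        by (simp add: in_At minus cnorm_unitization_embed)
      have "cauchy A b"
        unfolding cauchy_def
      proof (intro conjI allI impI)
        fix e :: real assume "e > 0"
        then obtain N where N: "1 / Suc N < e / 2" using nat_approx_posE[of "e / 2"] by auto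
        have small: "?N (b m, 1) < e / 2" if "m \<ge> N" for m
        proof -
          have "1 / Suc m \<le> 1 / Suc N" using that by (intro divide_left_mono) auto
          with b(2)[of m] N show ?thesis by linarith
        qed
        have "cnorm A (b m \<ominus> b n) < e" if "m \<ge> N" "n \<ge> N" for m n
          using dist[of m n] small[OF that(1)] small[OF that(2)] by simp
        then show "\<exists>N. \<forall>m\<ge>N. \<forall>n\<ge>N. cnorm A (b m \<ominus> b n) < e" by blast
      qed (rule b)
      then obtain l where l: "tends A b l" using cauchy_tends by blast
      then have lc: "l \<in> carrier A" by (simp add: tends_def)
      have "?N (l, 1) \<le> cnorm A (b n \<ominus> l) + 1 / Suc n" for n
      proof -
        have "(l, 1 :: complex) = (l \<ominus> b n \<oplus> b n, 0 + 1)" using lc b(1) by (simp add: minus_add_cancel)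
        then have "?N (l, 1) \<le> ?N (l \<ominus> b n, 0) + ?N (b n, 1)"
          using triangle[of "l \<ominus> b n" "b n" 0 1] lc b(1) by simp
        then show ?thesis
          using b(2)[of n] lc b(1) by (simp add: cnorm_unitization_embed norm_minus_commute[of l])
      qed
      moreover have "(\<lambda>n. cnorm A (b n \<ominus> l) + 1 / Suc n) \<longlonglongrightarrow> 0 + 0"
        using l LIMSEQ_inverse_real_of_nat
        by (intro tendsto_add) (simp_all add: tends_def inverse_eq_divide)
      ultimately have "?N (l, 1) \<le> 0" by (intro LIMSEQ_le_const) auto
      then have "?N (l, 1) = 0" using N.norm_nonneg[of "(l, 1)"] lc by (simp add: in_At)
      then show False using N.norm_eq_0[of "(l, 1)"] lc by (simp add: in_At unitization_simps(4))
    qed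
    then obtain d where d: "d > 0" "\<And>x. x \<in> carrier A \<Longrightarrow> d \<le> ?N (x, 1)" by blast
    \<comment> \<open>By homogeneity the gap bounds the scalar part of every element. The scalar
      parts of a Cauchy sequence are then Cauchy, and so are the parts in \<open>A\<close>.\<close>
    have sd: "cmod u * d \<le> ?N (x, u)" if x: "x \<in> carrier A" for x u
    proof (cases "u = 0")
      case True
      then show ?thesis using N.norm_nonneg[of "(x, u)"] x by (simp add: in_At)
    next
      case False
      then have "(x, u) = u \<odot>\<^bsub>At\<^esub> ((1 / u) \<odot> x, 1)" using x by (simp add: unitization_simps)
      then have "?N (x, u) = cmod u * ?N ((1 / u) \<odot> x, 1)"
        using N.norm_smult[of "((1 / u) \<odot> x, 1)" u] x by (simp add: in_At)
      then show ?thesis using d(2)[of "(1 / u) \<odot> x"] x by (simp add: mult_left_mono)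
    qed
    have fmn: "f m \<ominus>\<^bsub>At\<^esub> f n = (a m \<ominus> a n, s m - s n)" for m n
      using fc[of m] fc[of n] by (simp add: fas minus)
    have s_le: "cmod (s m - s n) \<le> ?N (f m \<ominus>\<^bsub>At\<^esub> f n) / d" for m n
      using sd[of "a m \<ominus> a n" "s m - s n"] ac d(1) by (simp add: fmn field_simps)
    have a_le: "cnorm A (a m \<ominus> a n) \<le> ?N (f m \<ominus>\<^bsub>At\<^esub> f n) * (1 + 1 / d)" for m n
    proof -
      have "cnorm A (a m \<ominus> a n) = ?N (a m \<ominus> a n \<oplus> \<zero>, (s m - s n) + (s n - s m))"
        using ac by (simp add: cnorm_unitization_embed)
      also have "\<dots> \<le> ?N (a m \<ominus> a n, s m - s n) + ?N (\<zero>, s n - s m)"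
        using ac by (intro triangle) simp_all
      also have "\<dots> \<le> ?N (f m \<ominus>\<^bsub>At\<^esub> f n) + ?N (f m \<ominus>\<^bsub>At\<^esub> f n) / d"
        using scalar[of "s n - s m"] s_le[of m n] by (simp add: fmn Real_Vector_Spaces.norm_minus_commute[of "s n"])
      finally show ?thesis by (simp add: algebra_simps)
    qed
    have small: "\<exists>N. \<forall>m\<ge>N. \<forall>n\<ge>N. ?N (f m \<ominus>\<^bsub>At\<^esub> f n) * K < e" if "e > 0" "K > 0" for e K
    proof -
      have "\<exists>N. \<forall>m\<ge>N. \<forall>n\<ge>N. ?N (f m \<ominus>\<^bsub>At\<^esub> f n) < e / K"
        using f that by (simp add: cauchy_def)
      then show ?thesis using that by (simp add: field_simps)
    qed
    have "Cauchy s"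
      unfolding Cauchy_def dist_norm
    proof (intro allI impI)
      fix e :: real assume "e > 0"
      then show "\<exists>N. \<forall>m\<ge>N. \<forall>n\<ge>N. cmod (s m - s n) < e"
        using small[of e "1 / d"] d(1) s_le by (simp, meson le_less_trans)
    qed
    then obtain t where t: "s \<longlonglongrightarrow> t" using Cauchy_convergent_iff convergent_def by blast
    have "cauchy A a"
      unfolding cauchy_def
    proof (intro conjI allI impI ac)
      fix e :: real assume "e > 0"
      then show "\<exists>N. \<forall>m\<ge>N. \<forall>n\<ge>N. cnorm A (a m \<ominus> a n) < e"
        using small[of e "1 + 1 / d"] d(1) a_le by (simp add: add_pos_pos, meson le_less_trans)
    qed
    then obtain l where l: "tends A a l" using cauchy_tends by blast
    then have lc: "l \<in> carrier A" by (simp add: tends_def)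
    have "tends At f (l, t)"
    proof (rule N.tendsI[where g = "\<lambda>n. cnorm A (a n \<ominus> l) + cmod (s n - t)"])
      show "(\<lambda>n. cnorm A (a n \<ominus> l) + cmod (s n - t)) \<longlonglongrightarrow> 0"
        using l tendsto_norm_zero[OF LIM_zero[OF t]]
        by (intro tendsto_add_zero) (simp_all add: tends_def)
      show "?N (f n \<ominus>\<^bsub>At\<^esub> (l, t)) \<le> cnorm A (a n \<ominus> l) + cmod (s n - t)" for n
        using triangle[of "a n \<ominus> l" \<zero> 0 "s n - t"] scalar[of "s n - t"] ac lc fc[of n]
        by (simp add: fas minus in_At cnorm_unitization_embed)
    qed (use lc fc in \<open>simp_all add: in_At\<close>)
    then show ?thesis by blast
  qed
qed

theorem unital_unitization: "unital_cstar_algebra At"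
proof -
  interpret O: operator_norm "At" "carrier A" "cnorm A" "\<lambda>(a, s) x. a \<otimes> x \<oplus> s \<odot> x" "\<lambda>r x. complex_of_real r \<odot> x"
    by (rule unitization_operator_norm)
  have "cstar_algebra At" by (rule O.cstar_algebraI[OF unitization_complete])
  moreover have "unital_cstar_algebra_axioms At"
  proof (cases "has_unit A")
    case True
    define e where "e = (THE e. is_unit_of A e)"
    have "is_unit_of A e" unfolding e_def by (rule unit_of_the[OF True])
    then show ?thesis
      by unfold_locales (use True in \<open>auto simp: unitization_simps is_unit_of_def e_def[symmetric]\<close>)
  next
    case False
    then show ?thesis by unfold_locales (auto simp: unitization_simps)
  qed
  ultimately show ?thesis by (rule unital_cstar_algebra.intro)
qed

text \<open>The elements of \<open>A\<close> whose copy lies in \<open>D\<close> form a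
  C*-subalgebra containing the generators, hence all of \<open>A\<close>; in the non-unital case the
  multiples of the unit supply the rest.\<close>

lemma unitization_generated:
  assumes gen: "carrier A = cstar_generated A S" and D: "cstar_subalgebra D At"
    and one: "\<one>\<^bsub>At\<^esub> \<in> D" and S: "(\<lambda>a. (a, 0)) ` S \<subseteq> D" "S \<subseteq> carrier A"
  shows "D = carrier At"
proof -
  interpret E: unital_cstar_algebra "At" by (rule unital_unitization)
  have embed_in: "(x, 0) \<in> carrier At" if "x \<in> carrier A" for x using that by (simp add: unitization_simps)
  have minus: "(a, 0) \<ominus>\<^bsub>At\<^esub> (b, 0) = (a \<ominus> b, 0)" if "a \<in> carrier A" "b \<in> carrier A" for a b
    using that by (simp add: E.minus_smult embed_in) (simp add: unitization_simps minus_smult)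
  have "cstar_subalgebra {a \<in> carrier A. (a, 0) \<in> D} A"
    unfolding subalgebra_iff
  proof (intro conjI ballI allI impI)
    fix f l assume fl: "(\<forall>n. f n \<in> {a \<in> carrier A. (a, 0) \<in> D}) \<and> tends A f l"
    then have "tends At (\<lambda>n. (f n, 0)) (l, 0)"
      by (simp add: tends_def embed_in minus cnorm_unitization_embed)
    then have "(l, 0) \<in> D" using fl E.subalgebra_tends[OF D, of "\<lambda>n. (f n, 0)"] by simp
    then show "l \<in> {a \<in> carrier A. (a, 0) \<in> D}" using fl by (simp add: tends_def)
  next
    fix x y assume "x \<in> {a \<in> carrier A. (a, 0) \<in> D}" "y \<in> {a \<in> carrier A. (a, 0) \<in> D}"
    then show "x \<oplus> y \<in> {a \<in> carrier A. (a, 0) \<in> D}" "x \<otimes> y \<in> {a \<in> carrier A. (a, 0) \<in> D}"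
      using E.subalgebra_add[OF D, of "(x, 0)" "(y, 0)"] E.subalgebra_mult[OF D, of "(x, 0)" "(y, 0)"]
      by (simp_all add: unitization_simps)
  next
    fix x c assume "x \<in> {a \<in> carrier A. (a, 0) \<in> D}"
    then show "c \<odot> x \<in> {a \<in> carrier A. (a, 0) \<in> D}" "star A x \<in> {a \<in> carrier A. (a, 0) \<in> D}"
      using E.subalgebra_smult[OF D, of "(x, 0)" c] E.subalgebra_star[OF D, of "(x, 0)"]
      by (simp_all add: unitization_simps)
  qed (use E.subalgebra_zero[OF D] in \<open>auto simp: unitization_simps\<close>)
  then have "cstar_generated A S \<subseteq> {a \<in> carrier A. (a, 0) \<in> D}"
    by (rule generated_minimal) (use S in auto)
  then have aD: "(a, 0) \<in> D" if "a \<in> carrier A" for a using that gen by blast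
  have "x \<in> D" if x: "x \<in> carrier At" for x
  proof (cases "has_unit A")
    case True
    then show ?thesis using x aD by (auto simp: unitization_simps)
  next
    case False
    obtain a s where eq: "x = (a, s)" by fastforce
    then have "a \<in> carrier A" using in_unitization[OF x] by simp
    moreover have "x = (a, 0) \<oplus>\<^bsub>At\<^esub> s \<odot>\<^bsub>At\<^esub> \<one>\<^bsub>At\<^esub>"
      using False calculation by (simp add: unitization_simps eq)
    ultimately show ?thesis
      using E.subalgebra_add[OF D aD E.subalgebra_smult[OF D one]] by simp
  qed
  then show ?thesis using E.subalgebra_carrier[OF D] by blast
qed

end

section \<open>The Hilbert module of columns\<close>

lemma (in abelian_monoid) finsum_swap:
  assumes "finite I" "finite J" "\<And>i j. \<lbrakk>i \<in> I; j \<in> J\<rbrakk> \<Longrightarrow> f i j \<in> carrier G"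
  shows "(\<Oplus>i\<in>I. \<Oplus>j\<in>J. f i j) = (\<Oplus>j\<in>J. \<Oplus>i\<in>I. f i j)"
  using assms(1,3)
proof (induction I)
  case (insert i I)
  have fi: "(\<lambda>j. f i j) \<in> J \<rightarrow> carrier G" "(\<lambda>j. \<Oplus>i\<in>I. f i j) \<in> J \<rightarrow> carrier G"
    "(\<lambda>i. \<Oplus>j\<in>J. f i j) \<in> I \<rightarrow> carrier G" "(\<Oplus>j\<in>J. f i j) \<in> carrier G"
    using insert by (auto intro!: finsum_closed)
  have "(\<Oplus>i\<in>insert i I. \<Oplus>j\<in>J. f i j) = (\<Oplus>j\<in>J. f i j) \<oplus> (\<Oplus>i\<in>I. \<Oplus>j\<in>J. f i j)"
    using insert fi by (subst finsum_insert) auto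
  also have "\<dots> = (\<Oplus>j\<in>J. f i j \<oplus> (\<Oplus>i\<in>I. f i j))"
    using insert fi by (simp add: finsum_addf)
  also have "\<dots> = (\<Oplus>j\<in>J. \<Oplus>i\<in>insert i I. f i j)"
    using insert by (intro finsum_cong' refl) (auto intro!: finsum_closed)
  finally show ?case .
qed (simp add: finsum_zero)

lemma (in abelian_monoid) finsum_delta:
  assumes "finite I" "j \<in> I" "x \<in> carrier G"
  shows "(\<Oplus>i\<in>I. if i = j then x else \<zero>) = x"
  using finsum_singleton[of j I "\<lambda>_. x"] assms by (simp add: eq_commute[of j] cong: if_cong)

context unital_cstar_algebra
begin

lemma finsum_in: "(\<And>i. i \<in> I \<Longrightarrow> f i \<in> carrier A) \<Longrightarrow> (\<Oplus>i\<in>I. f i) \<in> carrier A"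
  by (rule M.finsum_closed) auto

lemma finsum_eqI: "\<lbrakk>\<And>i. i \<in> I \<Longrightarrow> f i = g i; \<And>i. i \<in> I \<Longrightarrow> g i \<in> carrier A\<rbrakk>
    \<Longrightarrow> (\<Oplus>i\<in>I. f i) = (\<Oplus>i\<in>I. g i)"
  by (rule M.finsum_cong') auto

lemma star_finsum: "(\<And>i. i \<in> I \<Longrightarrow> f i \<in> carrier A) \<Longrightarrow> star A (\<Oplus>i\<in>I. f i) = (\<Oplus>i\<in>I. star A (f i))"
proof (induction I rule: infinite_finite_induct)
  case (insert i I)
  then show ?case by (simp add: M.finsum_insert Pi_def star_add finsum_in)
qed (simp_all add: M.finsum_infinite)

lemma finsum_smult: "(\<And>i. i \<in> I \<Longrightarrow> f i \<in> carrier A) \<Longrightarrow> c \<odot> (\<Oplus>i\<in>I. f i) = (\<Oplus>i\<in>I. c \<odot> f i)"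
proof (induction I rule: infinite_finite_induct)
  case (insert i I)
  then show ?case by (simp add: M.finsum_insert Pi_def smult_add_right finsum_in)
qed (simp_all add: M.finsum_infinite)

lemma finsum_mult_right: "\<lbrakk>\<And>i. i \<in> I \<Longrightarrow> f i \<in> carrier A; a \<in> carrier A\<rbrakk> \<Longrightarrow> (\<Oplus>i\<in>I. f i) \<otimes> a = (\<Oplus>i\<in>I. f i \<otimes> a)"
proof (induction I rule: infinite_finite_induct)
  case (insert i I)
  then show ?case by (simp add: M.finsum_insert Pi_def mult_add_left finsum_in)
qed (simp_all add: M.finsum_infinite)

lemma finsum_mult_left: "\<lbrakk>\<And>i. i \<in> I \<Longrightarrow> f i \<in> carrier A; a \<in> carrier A\<rbrakk> \<Longrightarrow> a \<otimes> (\<Oplus>i\<in>I. f i) = (\<Oplus>i\<in>I. a \<otimes> f i)"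
proof (induction I rule: infinite_finite_induct)
  case (insert i I)
  then show ?case by (simp add: M.finsum_insert Pi_def mult_add_right finsum_in)
qed (simp_all add: M.finsum_infinite)

lemma finsum_add: "\<lbrakk>\<And>i. i \<in> I \<Longrightarrow> f i \<in> carrier A; \<And>i. i \<in> I \<Longrightarrow> g i \<in> carrier A\<rbrakk>
    \<Longrightarrow> (\<Oplus>i\<in>I. f i \<oplus> g i) = (\<Oplus>i\<in>I. f i) \<oplus> (\<Oplus>i\<in>I. g i)"
  by (rule M.finsum_addf) auto

lemmas finsum_lessThan_simps =
  star_finsum[of "{..<k}" for k, simplified] finsum_smult[of "{..<k}" for k, simplified]
  finsum_mult_right[of "{..<k}" for k, simplified] finsum_mult_left[of "{..<k}" for k, simplified]

lemma pos_finsum: "(\<And>i. i \<in> I \<Longrightarrow> pos A (f i)) \<Longrightarrow> pos A (\<Oplus>i\<in>I. f i)"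
proof (induction I rule: infinite_finite_induct)
  case (insert i I)
  then show ?case by (simp add: M.finsum_insert Pi_def pos_add)
qed (use pos_square[of \<zero>] in \<open>simp_all add: M.finsum_infinite\<close>)

definition ip :: "nat \<Rightarrow> (nat \<Rightarrow> 'a) \<Rightarrow> (nat \<Rightarrow> 'a) \<Rightarrow> 'a"
  where "ip k x y = (\<Oplus>i\<in>{..<k}. star A (x i) \<otimes> y i)"

lemma column_norm_eq: "column_norm A k x = sqrt (cnorm A (ip k x x))"
  by (simp add: column_norm_def ip_def)

abbreviation cols where "cols k \<equiv> {..<k} \<rightarrow> carrier A"

lemma ip_closed [simp]: "\<lbrakk>x \<in> cols k; y \<in> cols k\<rbrakk> \<Longrightarrow> ip k x y \<in> carrier A"
  unfolding ip_def by (rule finsum_in) auto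

lemma star_ip: "\<lbrakk>x \<in> cols k; y \<in> cols k\<rbrakk> \<Longrightarrow> star A (ip k x y) = ip k y x"
  unfolding ip_def by (subst star_finsum) (auto simp: Pi_iff star_mult intro!: finsum_eqI)

lemma ip_add_right: "\<lbrakk>x \<in> cols k; y \<in> cols k; z \<in> cols k\<rbrakk> \<Longrightarrow> ip k x (\<lambda>i. y i \<oplus> z i) = ip k x y \<oplus> ip k x z"
proof -
  assume "x \<in> cols k" "y \<in> cols k" "z \<in> cols k"
  then have cl: "x i \<in> carrier A" "y i \<in> carrier A" "z i \<in> carrier A" if "i < k" for i
    using that by auto
  have "ip k x (\<lambda>i. y i \<oplus> z i) = (\<Oplus>i\<in>{..<k}. star A (x i) \<otimes> y i \<oplus> star A (x i) \<otimes> z i)"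
    unfolding ip_def using cl by (intro finsum_eqI) (simp_all add: mult_add_right)
  also have "\<dots> = ip k x y \<oplus> ip k x z"
    unfolding ip_def using cl by (intro finsum_add) simp_all
  finally show ?thesis .
qed

lemma ip_mult_right: "\<lbrakk>x \<in> cols k; y \<in> cols k; a \<in> carrier A\<rbrakk> \<Longrightarrow> ip k x (\<lambda>i. y i \<otimes> a) = ip k x y \<otimes> a"
  unfolding ip_def by (subst finsum_mult_right) (auto simp: Pi_iff mult_assoc intro!: finsum_eqI)

lemma ip_smult_right: "\<lbrakk>x \<in> cols k; y \<in> cols k\<rbrakk> \<Longrightarrow> ip k x (\<lambda>i. c \<odot> y i) = c \<odot> ip k x y"
  unfolding ip_def by (subst finsum_smult) (auto simp: Pi_iff mult_smult_right intro!: finsum_eqI)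

lemma pos_ip: "x \<in> cols k \<Longrightarrow> pos A (ip k x x)"
  unfolding ip_def by (intro pos_finsum pos_star_mult) auto

lemma column_norm_nonneg: "x \<in> cols k \<Longrightarrow> 0 \<le> column_norm A k x"
  by (simp add: column_norm_eq norm_nonneg)

lemma column_norm_square: "x \<in> cols k \<Longrightarrow> (column_norm A k x)\<^sup>2 = cnorm A (ip k x x)"
  by (simp add: column_norm_eq norm_nonneg)

text \<open>Columns are functions on all natural numbers, but only the values below \<open>k\<close>
  count. Equalities between columns are therefore proved pointwise below \<open>k\<close> and enter
  norms through this rule.\<close>

lemma column_norm_cong: "\<lbrakk>\<And>i. i < k \<Longrightarrow> x i = y i; y \<in> cols k\<rbrakk> \<Longrightarrow> column_norm A k x = column_norm A k y"
  unfolding column_norm_def by (subst finsum_eqI[where g = "\<lambda>i. star A (y i) \<otimes> y i"]) auto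

text \<open>One summand of the inner product is dominated by the whole, since the others are
  positive, and the norm is monotone. This is a place where positivity of \<open>x\<^sup>* x\<close>
  is indispensable.\<close>

lemma norm_entry_le:
  assumes x: "x \<in> cols k" and i: "i < k"
  shows "cnorm A (x i) \<le> column_norm A k x"
proof -
  have xi: "x j \<in> carrier A" if "j < k" for j using x that by auto
  let ?f = "\<lambda>i. star A (x i) \<otimes> x i"
  have "{..<k} = insert i ({..<k} - {i})" using i by auto
  then have "ip k x x = (\<Oplus>j\<in>insert i ({..<k} - {i}). ?f j)" by (simp add: ip_def)
  also have "\<dots> = ?f i \<oplus> (\<Oplus>j\<in>{..<k} - {i}. ?f j)"
    using xi i by (subst M.finsum_insert) auto
  finally have eq: "ip k x x = ?f i \<oplus> (\<Oplus>j\<in>{..<k} - {i}. ?f j)" .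
  have rest: "pos A (\<Oplus>j\<in>{..<k} - {i}. ?f j)" using xi by (intro pos_finsum pos_star_mult) auto
  have "cnorm A (?f i) \<le> cnorm A (ip k x x)"
  proof (rule norm_mono)
    have "ip k x x \<ominus> ?f i = (\<Oplus>j\<in>{..<k} - {i}. ?f j)"
      unfolding eq using xi[OF i] pos_carrier[OF rest] mult_closed[of "star A (x i)" "x i"]
      by (simp add: M.minus_eq M.a_ac M.r_neg2)
    then show "pos A (ip k x x \<ominus> ?f i)" using rest by simp
  qed (use x xi[OF i] in \<open>simp_all add: pos_star_mult\<close>)
  then have "(cnorm A (x i))\<^sup>2 \<le> (column_norm A k x)\<^sup>2"
    using xi[OF i] x by (simp add: cnorm_star_mult column_norm_square)
  then show ?thesis using column_norm_nonneg[OF x] by (rule power2_le_imp_le)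
qed

text \<open>A sum of squares is at most the square of the sum. Together with
  \<open>norm_entry_le\<close>, convergence of columns becomes convergence of entries.\<close>

lemma column_norm_le_sum: "x \<in> cols k \<Longrightarrow> column_norm A k x \<le> (\<Sum>i<k. cnorm A (x i))"
proof -
  assume x: "x \<in> cols k"
  then have xi: "x j \<in> carrier A" if "j < k" for j using that by auto
  let ?S = "\<Sum>i<k. cnorm A (x i)"
  have S0: "0 \<le> ?S" using xi by (intro sum_nonneg norm_nonneg) auto
  have "cnorm A (ip k x x) \<le> (\<Sum>i<k. cnorm A (star A (x i) \<otimes> x i))"
    unfolding ip_def using xi by (intro norm_finsum) auto
  also have "\<dots> = (\<Sum>i<k. cnorm A (x i) * cnorm A (x i))"
    using xi by (intro sum.cong refl) (simp add: cnorm_star_mult power2_eq_square)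
  also have "\<dots> \<le> (\<Sum>i<k. cnorm A (x i) * ?S)"
    using xi by (intro sum_mono mult_left_mono norm_nonneg member_le_sum) (auto simp: norm_nonneg)
  also have "\<dots> = ?S\<^sup>2" by (simp add: sum_distrib_right power2_eq_square)
  finally have "(column_norm A k x)\<^sup>2 \<le> ?S\<^sup>2" using x by (simp add: column_norm_square)
  then show ?thesis using S0 by (rule power2_le_imp_le)
qed

text \<open>Expand \<open>\<langle>x a - t y, x a - t y\<rangle> \<ge> 0\<close> for \<open>a = \<langle>x, y\<rangle>\<close> and \<open>t = \<parallel>\<langle>x, x\<rangle>\<parallel>\<close>.\<close>

lemma cauchy_schwarz:
  assumes x: "x \<in> cols k" and y: "y \<in> cols k"
  shows "cnorm A (ip k x y) \<le> column_norm A k x * column_norm A k y"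
proof -
  define a where "a = ip k x y"
  define q where "q = ip k x x"
  define Y where "Y = ip k y y"
  define t where "t = cnorm A q"
  let ?t = "complex_of_real t"
  have cl: "a \<in> carrier A" "q \<in> carrier A" "Y \<in> carrier A" "star A a = ip k y x" "star A q = q" "star A Y = Y"
    using x y by (simp_all add: a_def q_def Y_def star_ip)
  have t0: "t \<ge> 0" using cl by (simp add: t_def norm_nonneg)
  have "(cnorm A a)\<^sup>2 \<le> t * cnorm A Y"
  proof (cases "t = 0")
    \<comment> \<open>Here every relevant entry of \<open>x\<close> vanishes by
      \<open>norm_entry_le\<close>.\<close>
    case True
    then have cx: "column_norm A k x = 0" by (simp add: column_norm_eq t_def q_def)
    have "x i = \<zero>" if "i < k" for i
    proof -
      have xi: "x i \<in> carrier A" using x that by auto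
      then have "cnorm A (x i) = 0" using norm_entry_le[OF x that] norm_nonneg[OF xi] cx by simp
      then show ?thesis using norm_eq_0 xi by simp
    qed
    then have "a = (\<Oplus>i\<in>{..<k}. \<zero>)" unfolding a_def ip_def using y by (intro finsum_eqI) (auto simp: Pi_iff)
    then have "a = \<zero>" by simp
    then show ?thesis using True by simp
  next
    case False
    with t0 have tp: "t > 0" by simp
    define z where "z = (\<lambda>i. x i \<otimes> a \<oplus> (- ?t) \<odot> y i)"
    have z: "z \<in> cols k" "(\<lambda>i. x i \<otimes> a) \<in> cols k" "(\<lambda>i. (- ?t) \<odot> y i) \<in> cols k"
      using x y cl by (auto simp: z_def Pi_iff)
    have ipz: "ip k w z = ip k w x \<otimes> a \<oplus> (- ?t) \<odot> ip k w y" if w: "w \<in> cols k" for w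
      unfolding z_def using ip_add_right[OF w z(2,3)] ip_mult_right[OF w x cl(1)] ip_smult_right[OF w y] by simp
    have xz: "ip k x z = q \<otimes> a \<oplus> (- ?t) \<odot> a" and yz: "ip k y z = star A a \<otimes> a \<oplus> (- ?t) \<odot> Y"
      using ipz[OF x] ipz[OF y] cl by (simp_all add: a_def q_def Y_def)
    have zx: "ip k z x = star A a \<otimes> q \<oplus> (- ?t) \<odot> star A a"
      and zy: "ip k z y = star A a \<otimes> a \<oplus> (- ?t) \<odot> Y"
      using star_ip[OF x z(1)] star_ip[OF y z(1)] cl(1,2,3,5,6) unfolding xz yz
      by (simp_all add: star_add star_mult star_smult)
    have zz: "ip k z z = star A a \<otimes> q \<otimes> a \<oplus> ((- ?t) \<odot> (star A a \<otimes> a) \<oplus>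
        ((- ?t) \<odot> (star A a \<otimes> a) \<oplus> (?t * ?t) \<odot> Y))"
      unfolding ipz[OF z(1)] zx zy using cl(1,2,3)
      by (simp add: mult_add_left mult_smult_left smult_add_right mult_assoc M.a_ac)
    \<comment> \<open>Since \<open>q\<close> is at most its norm \<open>t\<close>, adding the
      positive element \<open>a\<^sup>* (t - q) a\<close> removes the unwanted term
      \<open>a\<^sup>* q a\<close> from the expansion. What remains is
      \<open>t a\<^sup>* a \<le> t\<^sup>2 Y\<close>; monotonicity of the norm and division by
      \<open>t\<close> finish.\<close>
    have "pos A (star A a \<otimes> (?t \<odot> \<one> \<ominus> q) \<otimes> a)"
      using pos_scalar_minus[of q t] cl by (intro pos_conjugate) (simp_all add: t_def)
    then have "pos A (ip k z z \<oplus> star A a \<otimes> (?t \<odot> \<one> \<ominus> q) \<otimes> a)"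
      using pos_ip[OF z(1)] by (rule pos_add[rotated])
    also have "star A a \<otimes> (?t \<odot> \<one> \<ominus> q) \<otimes> a = ?t \<odot> (star A a \<otimes> a) \<ominus> star A a \<otimes> q \<otimes> a"
      using cl(1,2) by (simp add: mult_minus_left mult_minus_right mult_smult_left mult_smult_right)
    also have "ip k z z \<oplus> \<dots> = (?t * ?t) \<odot> Y \<ominus> ?t \<odot> (star A a \<otimes> a)"
    proof -
      have neg: "(- ?t) \<odot> (star A a \<otimes> a) = \<ominus> (?t \<odot> (star A a \<otimes> a))" using cl(1) by (simp add: neg_smult)
      have "u \<oplus> (\<ominus> v \<oplus> (\<ominus> v \<oplus> w)) \<oplus> (v \<ominus> u) = w \<ominus> v"
        if "u \<in> carrier A" "v \<in> carrier A" "w \<in> carrier A" for u v w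
        using that by algebra
      then show ?thesis unfolding zz neg using cl(1,2,3) by simp
    qed
    finally have p: "pos A ((?t * ?t) \<odot> Y \<ominus> ?t \<odot> (star A a \<otimes> a))" .
    have "cnorm A (?t \<odot> (star A a \<otimes> a)) \<le> cnorm A ((?t * ?t) \<odot> Y)"
      using cl t0 by (intro norm_mono p pos_smult pos_star_mult) simp_all
    then have "t * (cnorm A a)\<^sup>2 \<le> t * (t * cnorm A Y)"
      using cl(1,3) t0 by (simp add: norm_smult cnorm_star_mult norm_mult)
    then show ?thesis using tp by simp
  qed
  also have "\<dots> = (column_norm A k x * column_norm A k y)\<^sup>2"
    using x y by (simp add: power_mult_distrib column_norm_square t_def q_def Y_def)
  finally have "(cnorm A a)\<^sup>2 \<le> (column_norm A k x * column_norm A k y)\<^sup>2" .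
  then show ?thesis
    unfolding a_def by (rule power2_le_imp_le) (simp add: column_norm_nonneg x y)
qed

lemma column_norm_add:
  assumes x: "x \<in> cols k" and y: "y \<in> cols k"
  shows "column_norm A k (\<lambda>i. x i \<oplus> y i) \<le> column_norm A k x + column_norm A k y"
proof -
  let ?z = "\<lambda>i. x i \<oplus> y i" and ?n = "column_norm A k"
  have z: "?z \<in> cols k" using x y by (auto simp: Pi_iff)
  have zx: "ip k ?z x = ip k x x \<oplus> ip k y x" and zy: "ip k ?z y = ip k x y \<oplus> ip k y y"
    by (simp_all add: star_ip[OF x z, symmetric] star_ip[OF y z, symmetric] ip_add_right[OF _ x y] x y
        star_add star_ip)
  have "(?n ?z)\<^sup>2 = cnorm A ((ip k x x \<oplus> ip k y x) \<oplus> (ip k x y \<oplus> ip k y y))"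
    using column_norm_square[OF z] ip_add_right[OF z x y] zx zy by simp
  also have "\<dots> \<le> (cnorm A (ip k x x) + cnorm A (ip k y x)) + (cnorm A (ip k x y) + cnorm A (ip k y y))"
    using x y by (intro order_trans[OF norm_triangle] add_mono norm_triangle) simp_all
  also have "\<dots> \<le> ((?n x)\<^sup>2 + ?n y * ?n x) + (?n x * ?n y + (?n y)\<^sup>2)"
    using cauchy_schwarz[OF x y] cauchy_schwarz[OF y x] column_norm_square[OF x] column_norm_square[OF y]
    by (simp add: mult.commute[of "?n y"])
  also have "\<dots> = (?n x + ?n y)\<^sup>2" by (simp add: power2_eq_square algebra_simps)
  finally have "(?n ?z)\<^sup>2 \<le> (?n x + ?n y)\<^sup>2" .
  then show ?thesis by (rule power2_le_imp_le) (simp add: column_norm_nonneg x y)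
qed

lemma column_norm_smult:
  assumes x: "x \<in> cols k"
  shows "column_norm A k (\<lambda>i. c \<odot> x i) = cmod c * column_norm A k x"
proof -
  have cx: "(\<lambda>i. c \<odot> x i) \<in> cols k" using x by (auto simp: Pi_iff)
  have "ip k (\<lambda>i. c \<odot> x i) x = cnj c \<odot> ip k x x"
    using star_ip[OF x cx] ip_smult_right[OF x x, of c] star_ip[OF x x] x by (simp add: star_smult)
  then have "ip k (\<lambda>i. c \<odot> x i) (\<lambda>i. c \<odot> x i) = (c * cnj c) \<odot> ip k x x"
    using ip_smult_right[OF cx x] x by simp
  then show ?thesis
    using x by (simp add: column_norm_eq norm_smult norm_mult real_sqrt_mult)
qed

end

section \<open>Matrix algebras are C*-algebras\<close>

locale matrices = unital_cstar_algebra A for A :: "'a cstar" (structure) + fixes k :: nat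
begin

abbreviation E :: "'a mat cstar" where "E \<equiv> mat_cstar k A"

lemma E_carrier: "M \<in> carrier E \<longleftrightarrow> M \<in> carrier_mat k k \<and> (\<forall>i<k. \<forall>j<k. M $$ (i, j) \<in> carrier A)"
  by (simp add: mat_cstar_def)

lemma entry [simp]: "\<lbrakk>M \<in> carrier E; i < k; j < k\<rbrakk> \<Longrightarrow> M $$ (i, j) \<in> carrier A"
  by (simp add: E_carrier)

lemma mat_in: "(\<And>i j. \<lbrakk>i < k; j < k\<rbrakk> \<Longrightarrow> f (i, j) \<in> carrier A) \<Longrightarrow> mat k k f \<in> carrier E"
  by (simp add: E_carrier)

lemma E_eqI: "\<lbrakk>M \<in> carrier E; N \<in> carrier E; \<And>i j. \<lbrakk>i < k; j < k\<rbrakk> \<Longrightarrow> M $$ (i, j) = N $$ (i, j)\<rbrakk> \<Longrightarrow> M = N"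
  by (rule eq_matI) (auto simp: E_carrier)

lemma E_entries [simp]:
  assumes "i < k" "j < k"
  shows "(M \<otimes>\<^bsub>E\<^esub> N) $$ (i, j) = (\<Oplus>l\<in>{..<k}. M $$ (i, l) \<otimes> N $$ (l, j))"
    and "(M \<oplus>\<^bsub>E\<^esub> N) $$ (i, j) = M $$ (i, j) \<oplus> N $$ (i, j)"
    and "(c \<odot>\<^bsub>E\<^esub> M) $$ (i, j) = c \<odot> M $$ (i, j)"
    and "(star E M) $$ (i, j) = star A (M $$ (j, i))"
    and "\<one>\<^bsub>E\<^esub> $$ (i, j) = (if i = j then \<one> else \<zero>)"
    and "\<zero>\<^bsub>E\<^esub> $$ (i, j) = \<zero>"
  unfolding mat_cstar_def using assms by simp_all

lemma E_closed [simp, intro]: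
  "\<lbrakk>M \<in> carrier E; N \<in> carrier E\<rbrakk> \<Longrightarrow> M \<otimes>\<^bsub>E\<^esub> N \<in> carrier E"
  "\<lbrakk>M \<in> carrier E; N \<in> carrier E\<rbrakk> \<Longrightarrow> M \<oplus>\<^bsub>E\<^esub> N \<in> carrier E"
  "M \<in> carrier E \<Longrightarrow> c \<odot>\<^bsub>E\<^esub> M \<in> carrier E"
  "M \<in> carrier E \<Longrightarrow> star E M \<in> carrier E"
  "\<one>\<^bsub>E\<^esub> \<in> carrier E" "\<zero>\<^bsub>E\<^esub> \<in> carrier E"
  unfolding mat_cstar_def by (auto intro!: finsum_in)

lemma E_module: "module (ring_of_type_algebra :: complex ring) E"
proof (rule module_complexI)
  show "abelian_group E"
  proof (rule abelian_groupI)
    fix M assume M: "M \<in> carrier E"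
    show "\<exists>N\<in>carrier E. N \<oplus>\<^bsub>E\<^esub> M = \<zero>\<^bsub>E\<^esub>"
    proof
      show "(-1) \<odot>\<^bsub>E\<^esub> M \<oplus>\<^bsub>E\<^esub> M = \<zero>\<^bsub>E\<^esub>"
        using M by (intro E_eqI) (simp_all add: M.l_neg flip: neg_smult)
    qed (use M in simp)
  qed (auto intro!: E_eqI simp: M.a_ac)
qed (auto intro!: E_eqI simp: smult_add_left smult_add_right)

lemma E_star_algebra: "star_algebra E"
proof (intro star_algebra.intro star_algebra_axioms.intro E_module)
  fix M N P assume M: "M \<in> carrier E" and N: "N \<in> carrier E" and P: "P \<in> carrier E"
  show "(M \<otimes>\<^bsub>E\<^esub> N) \<otimes>\<^bsub>E\<^esub> P = M \<otimes>\<^bsub>E\<^esub> (N \<otimes>\<^bsub>E\<^esub> P)"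
  proof (rule E_eqI)
    fix i j assume ij: "i < k" "j < k"
    let ?f = "\<lambda>l m. M $$ (i, m) \<otimes> N $$ (m, l) \<otimes> P $$ (l, j)"
    have "((M \<otimes>\<^bsub>E\<^esub> N) \<otimes>\<^bsub>E\<^esub> P) $$ (i, j) = (\<Oplus>l\<in>{..<k}. \<Oplus>m\<in>{..<k}. ?f l m)"
      using ij M N P by (auto intro!: finsum_eqI finsum_in simp: finsum_lessThan_simps)
    also have "\<dots> = (\<Oplus>m\<in>{..<k}. \<Oplus>l\<in>{..<k}. ?f l m)"
      using ij M N P by (intro M.finsum_swap) auto
    also have "\<dots> = (M \<otimes>\<^bsub>E\<^esub> (N \<otimes>\<^bsub>E\<^esub> P)) $$ (i, j)"
      using ij M N P by (auto intro!: finsum_eqI finsum_in simp: finsum_lessThan_simps mult_assoc)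
    finally show "((M \<otimes>\<^bsub>E\<^esub> N) \<otimes>\<^bsub>E\<^esub> P) $$ (i, j) = (M \<otimes>\<^bsub>E\<^esub> (N \<otimes>\<^bsub>E\<^esub> P)) $$ (i, j)" .
  qed (use M N P in simp_all)
  show "(M \<oplus>\<^bsub>E\<^esub> N) \<otimes>\<^bsub>E\<^esub> P = M \<otimes>\<^bsub>E\<^esub> P \<oplus>\<^bsub>E\<^esub> N \<otimes>\<^bsub>E\<^esub> P"
  proof (rule E_eqI)
    fix i j assume ij: "i < k" "j < k"
    have "((M \<oplus>\<^bsub>E\<^esub> N) \<otimes>\<^bsub>E\<^esub> P) $$ (i, j)
        = (\<Oplus>l\<in>{..<k}. M $$ (i, l) \<otimes> P $$ (l, j) \<oplus> N $$ (i, l) \<otimes> P $$ (l, j))"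
      using ij M N P by (simp only: E_entries, intro finsum_eqI) (auto simp: mult_add_left)
    also have "\<dots> = (M \<otimes>\<^bsub>E\<^esub> P \<oplus>\<^bsub>E\<^esub> N \<otimes>\<^bsub>E\<^esub> P) $$ (i, j)"
      using ij M N P by (subst finsum_add) auto
    finally show "((M \<oplus>\<^bsub>E\<^esub> N) \<otimes>\<^bsub>E\<^esub> P) $$ (i, j) = (M \<otimes>\<^bsub>E\<^esub> P \<oplus>\<^bsub>E\<^esub> N \<otimes>\<^bsub>E\<^esub> P) $$ (i, j)" .
  qed (use M N P in simp_all)
  show "P \<otimes>\<^bsub>E\<^esub> (M \<oplus>\<^bsub>E\<^esub> N) = P \<otimes>\<^bsub>E\<^esub> M \<oplus>\<^bsub>E\<^esub> P \<otimes>\<^bsub>E\<^esub> N"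
  proof (rule E_eqI)
    fix i j assume ij: "i < k" "j < k"
    have "(P \<otimes>\<^bsub>E\<^esub> (M \<oplus>\<^bsub>E\<^esub> N)) $$ (i, j)
        = (\<Oplus>l\<in>{..<k}. P $$ (i, l) \<otimes> M $$ (l, j) \<oplus> P $$ (i, l) \<otimes> N $$ (l, j))"
      using ij M N P by (simp only: E_entries, intro finsum_eqI) (auto simp: mult_add_right)
    also have "\<dots> = (P \<otimes>\<^bsub>E\<^esub> M \<oplus>\<^bsub>E\<^esub> P \<otimes>\<^bsub>E\<^esub> N) $$ (i, j)"
      using ij M N P by (subst finsum_add) auto
    finally show "(P \<otimes>\<^bsub>E\<^esub> (M \<oplus>\<^bsub>E\<^esub> N)) $$ (i, j) = (P \<otimes>\<^bsub>E\<^esub> M \<oplus>\<^bsub>E\<^esub> P \<otimes>\<^bsub>E\<^esub> N) $$ (i, j)" .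
  qed (use M N P in simp_all)
next
  fix M N c assume M: "M \<in> carrier E" and N: "N \<in> carrier E"
  show "(c \<odot>\<^bsub>E\<^esub> M) \<otimes>\<^bsub>E\<^esub> N = c \<odot>\<^bsub>E\<^esub> (M \<otimes>\<^bsub>E\<^esub> N)"
    using M N by (intro E_eqI) (auto simp: finsum_lessThan_simps mult_smult_left intro!: finsum_eqI)
  show "M \<otimes>\<^bsub>E\<^esub> (c \<odot>\<^bsub>E\<^esub> N) = c \<odot>\<^bsub>E\<^esub> (M \<otimes>\<^bsub>E\<^esub> N)"
    using M N by (intro E_eqI) (auto simp: finsum_lessThan_simps mult_smult_right intro!: finsum_eqI)
  show "star E (M \<otimes>\<^bsub>E\<^esub> N) = star E N \<otimes>\<^bsub>E\<^esub> star E M"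
    using M N by (intro E_eqI) (auto simp: finsum_lessThan_simps star_mult intro!: finsum_eqI)
qed (auto intro!: E_eqI simp: star_add star_smult)

section \<open>Matrices as bounded adjointable operators on columns\<close>

lemma mat_apply_closed: "\<lbrakk>M \<in> carrier E; x \<in> cols k\<rbrakk> \<Longrightarrow> mat_apply A k M x \<in> cols k"
  unfolding mat_apply_def by (auto simp: Pi_iff intro!: finsum_in)

lemma mat_apply_mult:
  assumes M: "M \<in> carrier E" and N: "N \<in> carrier E" and x: "x \<in> cols k" and i: "i < k"
  shows "mat_apply A k (M \<otimes>\<^bsub>E\<^esub> N) x i = mat_apply A k M (mat_apply A k N x) i"
proof -
  have xi: "x j \<in> carrier A" if "j < k" for j using x that by auto
  let ?f = "\<lambda>j l. M $$ (i, l) \<otimes> N $$ (l, j) \<otimes> x j"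
  have "mat_apply A k (M \<otimes>\<^bsub>E\<^esub> N) x i = (\<Oplus>j\<in>{..<k}. \<Oplus>l\<in>{..<k}. ?f j l)"
    unfolding mat_apply_def using i M N xi by (auto intro!: finsum_eqI finsum_in simp: finsum_lessThan_simps)
  also have "\<dots> = (\<Oplus>l\<in>{..<k}. \<Oplus>j\<in>{..<k}. ?f j l)"
    using i M N xi by (intro M.finsum_swap) auto
  also have "\<dots> = mat_apply A k M (mat_apply A k N x) i"
    unfolding mat_apply_def using i M N xi by (auto intro!: finsum_eqI finsum_in simp: finsum_lessThan_simps mult_assoc)
  finally show ?thesis .
qed

lemma ip_adjoint:
  assumes M: "M \<in> carrier E" and x: "x \<in> cols k" and y: "y \<in> cols k"
  shows "ip k (mat_apply A k M x) y = ip k x (mat_apply A k (star E M) y)"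
proof -
  have xi: "x j \<in> carrier A" "y j \<in> carrier A" if "j < k" for j using x y that by auto
  let ?f = "\<lambda>i j. star A (x j) \<otimes> star A (M $$ (i, j)) \<otimes> y i"
  have "ip k (mat_apply A k M x) y = (\<Oplus>i\<in>{..<k}. \<Oplus>j\<in>{..<k}. ?f i j)"
    unfolding ip_def mat_apply_def using M xi
    by (auto intro!: finsum_eqI finsum_in simp: finsum_lessThan_simps star_mult)
  also have "\<dots> = (\<Oplus>j\<in>{..<k}. \<Oplus>i\<in>{..<k}. ?f i j)"
    using M xi by (intro M.finsum_swap) auto
  also have "\<dots> = ip k x (mat_apply A k (star E M) y)"
    unfolding ip_def mat_apply_def using M xi
    by (auto intro!: finsum_eqI finsum_in simp: finsum_lessThan_simps mult_assoc)
  finally show ?thesis .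
qed

lemma column_norm_mat_apply_le:
  assumes M: "M \<in> carrier E" and x: "x \<in> cols k"
  shows "column_norm A k (mat_apply A k M x) \<le> (\<Sum>i<k. \<Sum>j<k. cnorm A (M $$ (i, j))) * column_norm A k x"
proof -
  have xi: "x j \<in> carrier A" if "j < k" for j using x that by auto
  have "column_norm A k (mat_apply A k M x) \<le> (\<Sum>i<k. cnorm A (mat_apply A k M x i))"
    by (rule column_norm_le_sum[OF mat_apply_closed[OF M x]])
  also have "\<dots> \<le> (\<Sum>i<k. \<Sum>j<k. cnorm A (M $$ (i, j)) * column_norm A k x)"
  proof (rule sum_mono)
    fix i assume i: "i \<in> {..<k}"
    have "cnorm A (mat_apply A k M x i) \<le> (\<Sum>j<k. cnorm A (M $$ (i, j) \<otimes> x j))"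
      unfolding mat_apply_def using i M xi by (intro norm_finsum) auto
    also have "\<dots> \<le> (\<Sum>j<k. cnorm A (M $$ (i, j)) * column_norm A k x)"
    proof (rule sum_mono)
      fix j assume j: "j \<in> {..<k}"
      have "cnorm A (M $$ (i, j) \<otimes> x j) \<le> cnorm A (M $$ (i, j)) * cnorm A (x j)"
        using i j M xi by (intro cnorm_mult) auto
      also have "\<dots> \<le> cnorm A (M $$ (i, j)) * column_norm A k x"
        using i j M norm_entry_le[OF x, of j] by (intro mult_left_mono) (auto simp: norm_nonneg)
      finally show "cnorm A (M $$ (i, j) \<otimes> x j) \<le> cnorm A (M $$ (i, j)) * column_norm A k x" .
    qed
    finally show "cnorm A (mat_apply A k M x i) \<le> (\<Sum>j<k. cnorm A (M $$ (i, j)) * column_norm A k x)" .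
  qed
  finally show ?thesis by (simp add: sum_distrib_right)
qed

definition unit_col :: "nat \<Rightarrow> nat \<Rightarrow> 'a"
  where "unit_col j i = (if i = j then \<one> else \<zero>)"

text \<open>Standard basis columns read off the entries of a matrix. This yields faithfulness of the
  action and, because their norm is at most 1, the bound of each entry by the matrix norm.\<close>

lemma unit_col:
  assumes j: "j < k"
  shows "unit_col j \<in> cols k" "column_norm A k (unit_col j) \<le> 1"
    and "\<lbrakk>M \<in> carrier E; i < k\<rbrakk> \<Longrightarrow> mat_apply A k M (unit_col j) i = M $$ (i, j)"
proof -
  show "unit_col j \<in> cols k" by (auto simp: unit_col_def)
  have "ip k (unit_col j) (unit_col j) = (\<Oplus>i\<in>{..<k}. if i = j then \<one> else \<zero>)"
    unfolding ip_def unit_col_def by (intro finsum_eqI) auto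
  also have "\<dots> = \<one>" using j by (intro M.finsum_delta) auto
  finally show "column_norm A k (unit_col j) \<le> 1"
    using norm_one norm_nonneg[OF one_closed] by (simp add: column_norm_eq)
  assume M: "M \<in> carrier E" and i: "i < k"
  have "mat_apply A k M (unit_col j) i = (\<Oplus>l\<in>{..<k}. if l = j then M $$ (i, j) else \<zero>)"
    unfolding mat_apply_def unit_col_def using M i j by (intro finsum_eqI) auto
  also have "\<dots> = M $$ (i, j)" using M i j by (intro M.finsum_delta) auto
  finally show "mat_apply A k M (unit_col j) i = M $$ (i, j)" .
qed

text \<open>The adjoint inequality is Cauchy-Schwarz applied to \<open>\<langle>T x, T x\<rangle> =
  \<langle>x, T\<^sup>* T x\<rangle>\<close>, the triangle inequality is that of columns, and
  boundedness is the crude estimate by the sum of the norms of all entries.\<close>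

lemma E_operator_norm:
  "operator_norm E (cols k) (column_norm A k) (mat_apply A k) (\<lambda>r x i. complex_of_real r \<odot> x i)"
proof (intro operator_norm.intro operator_norm_axioms.intro E_star_algebra)
  show "\<exists>x\<in>cols k. column_norm A k x \<le> 1"
  proof
    show "column_norm A k (\<lambda>_. \<zero>) \<le> 1"
      using column_norm_smult[of "\<lambda>_. \<zero>" k 0] by simp
  qed simp
next
  fix S T x c assume S: "S \<in> carrier E" and T: "T \<in> carrier E" and x: "x \<in> cols k"
  have xi: "x j \<in> carrier A" if "j < k" for j using x that by auto
  have "mat_apply A k (S \<oplus>\<^bsub>E\<^esub> T) x i = mat_apply A k S x i \<oplus> mat_apply A k T x i" if "i < k" for i
  proof -
    have "mat_apply A k (S \<oplus>\<^bsub>E\<^esub> T) x i = (\<Oplus>j\<in>{..<k}. S $$ (i, j) \<otimes> x j \<oplus> T $$ (i, j) \<otimes> x j)"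
      unfolding mat_apply_def using that S T xi by (intro finsum_eqI) (auto simp: mult_add_left)
    also have "\<dots> = mat_apply A k S x i \<oplus> mat_apply A k T x i"
      unfolding mat_apply_def using that S T xi by (intro finsum_add) auto
    finally show ?thesis .
  qed
  then have "column_norm A k (mat_apply A k (S \<oplus>\<^bsub>E\<^esub> T) x)
      = column_norm A k (\<lambda>i. mat_apply A k S x i \<oplus> mat_apply A k T x i)"
    using mat_apply_closed[OF S x] mat_apply_closed[OF T x] by (intro column_norm_cong) (auto simp: Pi_iff)
  then show "column_norm A k (mat_apply A k (S \<oplus>\<^bsub>E\<^esub> T) x)
      \<le> column_norm A k (mat_apply A k S x) + column_norm A k (mat_apply A k T x)"
    using column_norm_add[OF mat_apply_closed[OF S x] mat_apply_closed[OF T x]] by simp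
  show "column_norm A k (mat_apply A k (S \<otimes>\<^bsub>E\<^esub> T) x)
      = column_norm A k (mat_apply A k S (mat_apply A k T x))"
    by (intro column_norm_cong mat_apply_mult S T x mat_apply_closed)
next
  fix T x c assume T: "T \<in> carrier E" and x: "x \<in> cols k"
  have xi: "x j \<in> carrier A" if "j < k" for j using x that by auto
  note Tx = mat_apply_closed[OF T x]
  show "mat_apply A k T x \<in> cols k" by (rule Tx)
  have "mat_apply A k (c \<odot>\<^bsub>E\<^esub> T) x i = c \<odot> mat_apply A k T x i" if "i < k" for i
    unfolding mat_apply_def using that T xi
    by (subst finsum_smult) (auto intro!: finsum_eqI simp: mult_smult_left)
  then have "column_norm A k (mat_apply A k (c \<odot>\<^bsub>E\<^esub> T) x) = column_norm A k (\<lambda>i. c \<odot> mat_apply A k T x i)"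
    using Tx by (intro column_norm_cong) (auto simp: Pi_iff)
  then show "column_norm A k (mat_apply A k (c \<odot>\<^bsub>E\<^esub> T) x) = cmod c * column_norm A k (mat_apply A k T x)"
    using column_norm_smult[OF Tx] by simp
  have TT: "star E T \<otimes>\<^bsub>E\<^esub> T \<in> carrier E" using T by simp
  have "ip k (mat_apply A k T x) (mat_apply A k T x) = ip k x (mat_apply A k (star E T) (mat_apply A k T x))"
    by (rule ip_adjoint[OF T x Tx])
  then have "(column_norm A k (mat_apply A k T x))\<^sup>2 = cnorm A (ip k x (mat_apply A k (star E T) (mat_apply A k T x)))"
    using column_norm_square[OF Tx] by simp
  also have "\<dots> \<le> column_norm A k x * column_norm A k (mat_apply A k (star E T) (mat_apply A k T x))"
    using T by (intro cauchy_schwarz x mat_apply_closed Tx) simp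
  also have "column_norm A k (mat_apply A k (star E T) (mat_apply A k T x))
      = column_norm A k (mat_apply A k (star E T \<otimes>\<^bsub>E\<^esub> T) x)"
    using T by (intro column_norm_cong mat_apply_mult[symmetric] x mat_apply_closed TT) simp
  finally show "(column_norm A k (mat_apply A k T x))\<^sup>2
      \<le> column_norm A k x * column_norm A k (mat_apply A k (star E T \<otimes>\<^bsub>E\<^esub> T) x)" .
  fix r :: real assume r: "r > 0"
  have "mat_apply A k T (\<lambda>i. complex_of_real r \<odot> x i) i = complex_of_real r \<odot> mat_apply A k T x i" if "i < k" for i
    unfolding mat_apply_def using that T xi
    by (subst finsum_smult) (auto intro!: finsum_eqI simp: mult_smult_right)
  then have "column_norm A k (mat_apply A k T (\<lambda>i. complex_of_real r \<odot> x i))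
      = column_norm A k (\<lambda>i. complex_of_real r \<odot> mat_apply A k T x i)"
    using Tx by (intro column_norm_cong) (auto simp: Pi_iff)
  then show "column_norm A k (mat_apply A k T (\<lambda>i. complex_of_real r \<odot> x i)) = r * column_norm A k (mat_apply A k T x)"
    using column_norm_smult[OF Tx] r by simp
next
  fix T assume T: "T \<in> carrier E"
  show "\<exists>C. \<forall>x\<in>cols k. column_norm A k (mat_apply A k T x) \<le> C * column_norm A k x"
    using column_norm_mat_apply_le[OF T] by blast
  show "cnorm E T = (SUP x\<in>{x \<in> cols k. column_norm A k x \<le> 1}. column_norm A k (mat_apply A k T x))"
    by (simp only: mat_cstar_def cstar.simps)
  assume ker: "\<And>x. x \<in> cols k \<Longrightarrow> column_norm A k (mat_apply A k T x) = 0"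
  show "T = \<zero>\<^bsub>E\<^esub>"
  proof (rule E_eqI[OF T])
    fix i j assume ij: "i < k" "j < k"
    have "cnorm A (T $$ (i, j)) \<le> column_norm A k (mat_apply A k T (unit_col j))"
      using norm_entry_le[OF mat_apply_closed[OF T unit_col(1)[OF ij(2)]] ij(1)] unit_col(3)[OF ij(2) T ij(1)] by simp
    also have "\<dots> = 0" using ker unit_col(1)[OF ij(2)] .
    finally have "cnorm A (T $$ (i, j)) = 0" using norm_nonneg[of "T $$ (i, j)"] T ij by simp
    then show "T $$ (i, j) = \<zero>\<^bsub>E\<^esub> $$ (i, j)" using norm_eq_0 T ij by simp
  qed simp
next
  fix x and r :: real assume "x \<in> cols k" "r > 0"
  then show "column_norm A k (\<lambda>i. complex_of_real r \<odot> x i) = r * column_norm A k x"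
    by (simp add: column_norm_smult)
qed (auto simp: column_norm_nonneg Pi_iff)

text \<open>With \<open>norm_entry_le_norm\<close> this makes the matrix norm equivalent to
  entrywise norms. It reduces completeness to \<open>A\<close> and turns entrywise estimates for the
  projections into norm estimates.\<close>

lemma norm_mat_le: "M \<in> carrier E \<Longrightarrow> cnorm E M \<le> (\<Sum>i<k. \<Sum>j<k. cnorm A (M $$ (i, j)))"
proof -
  assume M: "M \<in> carrier E"
  have S0: "0 \<le> (\<Sum>i<k. \<Sum>j<k. cnorm A (M $$ (i, j)))" using M by (intro sum_nonneg norm_nonneg) auto
  show ?thesis
  proof (rule operator_norm.cnorm_leI[OF E_operator_norm M])
    fix x assume x: "x \<in> cols k" "column_norm A k x \<le> 1"
    show "column_norm A k (mat_apply A k M x) \<le> (\<Sum>i<k. \<Sum>j<k. cnorm A (M $$ (i, j)))"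
      using column_norm_mat_apply_le[OF M x(1)] mult_left_mono[OF x(2) S0] by simp
  qed
qed

lemma norm_entry_le_norm: "\<lbrakk>M \<in> carrier E; i < k; j < k\<rbrakk> \<Longrightarrow> cnorm A (M $$ (i, j)) \<le> cnorm E M"
proof -
  assume M: "M \<in> carrier E" and ij: "i < k" "j < k"
  have "cnorm A (M $$ (i, j)) \<le> column_norm A k (mat_apply A k M (unit_col j))"
    using norm_entry_le[OF mat_apply_closed[OF M unit_col(1)[OF ij(2)]] ij(1)] unit_col(3)[OF ij(2) M ij(1)] by simp
  also have "\<dots> \<le> cnorm E M"
    by (rule operator_norm.length_act_le_norm[OF E_operator_norm]) (use M unit_col(1,2)[OF ij(2)] in simp_all)
  finally show ?thesis .
qed

sublocale EN: normed_module E
  by (rule operator_norm.normed_module[OF E_operator_norm])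

lemma E_minus_entry [simp]:
  "\<lbrakk>M \<in> carrier E; N \<in> carrier E; i < k; j < k\<rbrakk> \<Longrightarrow> (M \<ominus>\<^bsub>E\<^esub> N) $$ (i, j) = M $$ (i, j) \<ominus> N $$ (i, j)"
  by (simp add: EN.minus_smult minus_smult)

lemma E_tendsI:
  assumes f: "\<And>n. f n \<in> carrier E" and L: "L \<in> carrier E"
    and lim: "\<And>i j. \<lbrakk>i < k; j < k\<rbrakk> \<Longrightarrow> tends A (\<lambda>n. f n $$ (i, j)) (L $$ (i, j))"
  shows "tends E f L"
proof (rule EN.tendsI[where g = "\<lambda>n. \<Sum>i<k. \<Sum>j<k. cnorm A (f n $$ (i, j) \<ominus> L $$ (i, j))"])
  show "(\<lambda>n. \<Sum>i<k. \<Sum>j<k. cnorm A (f n $$ (i, j) \<ominus> L $$ (i, j))) \<longlonglongrightarrow> 0"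
    using lim by (intro tendsto_null_sum) (simp add: tends_def)
  show "cnorm E (f n \<ominus>\<^bsub>E\<^esub> L) \<le> (\<Sum>i<k. \<Sum>j<k. cnorm A (f n $$ (i, j) \<ominus> L $$ (i, j)))" for n
    using norm_mat_le[of "f n \<ominus>\<^bsub>E\<^esub> L"] f L by simp
qed (use f L in simp_all)

text \<open>The entries of a Cauchy sequence are Cauchy in \<open>A\<close>, and the matrix of their
  limits is the limit because the norm is controlled by the entries.\<close>

theorem unital_matrices: "unital_cstar_algebra E"
proof (rule unital_cstar_algebra.intro)
  show "cstar_algebra E"
  proof (rule operator_norm.cstar_algebraI[OF E_operator_norm])
    fix f assume f: "cauchy E f"
    then have fc: "f n \<in> carrier E" for n by (simp add: cauchy_def)
    have "\<exists>l. tends A (\<lambda>n. f n $$ (i, j)) l" if ij: "i < k" "j < k" for i j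
    proof (rule cauchy_tends)
      have le: "cnorm A (f m $$ (i, j) \<ominus> f n $$ (i, j)) \<le> cnorm E (f m \<ominus>\<^bsub>E\<^esub> f n)" for m n
        using norm_entry_le_norm[of "f m \<ominus>\<^bsub>E\<^esub> f n" i j] fc ij by simp
      show "cauchy A (\<lambda>n. f n $$ (i, j))"
        unfolding cauchy_def
      proof (intro conjI allI impI)
        show "f n $$ (i, j) \<in> carrier A" for n using fc ij by simp
        fix e :: real assume "e > 0"
        then obtain N where "\<forall>m\<ge>N. \<forall>n\<ge>N. cnorm E (f m \<ominus>\<^bsub>E\<^esub> f n) < e" using f by (auto simp: cauchy_def)
        then show "\<exists>N. \<forall>m\<ge>N. \<forall>n\<ge>N. cnorm A (f m $$ (i, j) \<ominus> f n $$ (i, j)) < e"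
          using le by (meson le_less_trans)
      qed
    qed
    then obtain l where l: "\<And>i j. \<lbrakk>i < k; j < k\<rbrakk> \<Longrightarrow> tends A (\<lambda>n. f n $$ (i, j)) (l i j)" by metis
    have "tends E f (mat k k (\<lambda>(i, j). l i j))"
    proof (rule E_tendsI[OF fc])
      show "mat k k (\<lambda>(i, j). l i j) \<in> carrier E" using l by (intro mat_in) (simp add: tends_def)
    qed (simp add: l)
    then show "\<exists>l. tends E f l" by blast
  qed
  have one: "\<one>\<^bsub>E\<^esub> \<otimes>\<^bsub>E\<^esub> M = M" "M \<otimes>\<^bsub>E\<^esub> \<one>\<^bsub>E\<^esub> = M" if M: "M \<in> carrier E" for M
  proof -
    have "(\<one>\<^bsub>E\<^esub> \<otimes>\<^bsub>E\<^esub> M) $$ (i, j) = M $$ (i, j)" "(M \<otimes>\<^bsub>E\<^esub> \<one>\<^bsub>E\<^esub>) $$ (i, j) = M $$ (i, j)"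
      if ij: "i < k" "j < k" for i j
    proof -
      have "(\<one>\<^bsub>E\<^esub> \<otimes>\<^bsub>E\<^esub> M) $$ (i, j) = (\<Oplus>l\<in>{..<k}. if l = i then M $$ (i, j) else \<zero>)"
        using ij M by (simp only: E_entries) (intro finsum_eqI, auto)
      then show "(\<one>\<^bsub>E\<^esub> \<otimes>\<^bsub>E\<^esub> M) $$ (i, j) = M $$ (i, j)" using ij M by (simp add: M.finsum_delta)
      have "(M \<otimes>\<^bsub>E\<^esub> \<one>\<^bsub>E\<^esub>) $$ (i, j) = (\<Oplus>l\<in>{..<k}. if l = j then M $$ (i, j) else \<zero>)"
        using ij M by (simp only: E_entries) (intro finsum_eqI, auto)
      then show "(M \<otimes>\<^bsub>E\<^esub> \<one>\<^bsub>E\<^esub>) $$ (i, j) = M $$ (i, j)" using ij M by (simp add: M.finsum_delta)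
    qed
    then show "\<one>\<^bsub>E\<^esub> \<otimes>\<^bsub>E\<^esub> M = M" "M \<otimes>\<^bsub>E\<^esub> \<one>\<^bsub>E\<^esub> = M" using M by (auto intro!: E_eqI)
  qed
  show "unital_cstar_algebra_axioms E" by unfold_locales (simp_all add: one)
qed

end

section \<open>Matrix units and rank-one projections\<close>

lemma (in normed_module) norm_finsum_minus:
  assumes "finite I" "\<And>i. i \<in> I \<Longrightarrow> f i \<in> carrier A" "\<And>i. i \<in> I \<Longrightarrow> g i \<in> carrier A"
  shows "cnorm A ((\<Oplus>i\<in>I. f i) \<ominus> (\<Oplus>i\<in>I. g i)) \<le> (\<Sum>i\<in>I. cnorm A (f i \<ominus> g i))"
  using assms
proof (induction I)
  case (insert i I)
  have cl: "(\<Oplus>i\<in>I. f i) \<in> carrier A" "(\<Oplus>i\<in>I. g i) \<in> carrier A" "f i \<in> carrier A" "g i \<in> carrier A"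
    using insert by (auto intro!: M.finsum_closed)
  have "(\<Oplus>i\<in>insert i I. f i) \<ominus> (\<Oplus>i\<in>insert i I. g i) = (f i \<ominus> g i) \<oplus> ((\<Oplus>i\<in>I. f i) \<ominus> (\<Oplus>i\<in>I. g i))"
    using insert cl by (subst M.finsum_insert, auto)+ (simp add: add_minus_add)
  also have "cnorm A \<dots> \<le> cnorm A (f i \<ominus> g i) + cnorm A ((\<Oplus>i\<in>I. f i) \<ominus> (\<Oplus>i\<in>I. g i))"
    using cl by (intro norm_triangle) simp_all
  also have "\<dots> \<le> (\<Sum>i\<in>insert i I. cnorm A (f i \<ominus> g i))" using insert by simp
  finally show ?case .
qed simp

context matrices
begin

sublocale EE: unital_cstar_algebra E by (rule unital_matrices)

definition emat :: "nat \<Rightarrow> nat \<Rightarrow> 'a \<Rightarrow> 'a mat"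
  where "emat i j b = mat k k (\<lambda>(r, c). if r = i \<and> c = j then b else \<zero>)"

lemma emat_in [simp, intro]: "b \<in> carrier A \<Longrightarrow> emat i j b \<in> carrier E"
  unfolding emat_def by (rule mat_in) simp

lemma emat_entry [simp]: "\<lbrakk>r < k; c < k\<rbrakk> \<Longrightarrow> emat i j b $$ (r, c) = (if r = i \<and> c = j then b else \<zero>)"
  by (simp add: emat_def)

lemma emat_mult_entry:
  assumes "b \<in> carrier A" "M \<in> carrier E" "j < k" "r < k" "c < k"
  shows "(emat i j b \<otimes>\<^bsub>E\<^esub> M) $$ (r, c) = (if r = i then b \<otimes> M $$ (j, c) else \<zero>)"
proof -
  have "(emat i j b \<otimes>\<^bsub>E\<^esub> M) $$ (r, c) = (\<Oplus>l\<in>{..<k}. if l = j then (if r = i then b \<otimes> M $$ (j, c) else \<zero>) else \<zero>)"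
    using assms by (simp only: E_entries) (intro finsum_eqI, auto)
  also have "\<dots> = (if r = i then b \<otimes> M $$ (j, c) else \<zero>)"
    using assms by (intro M.finsum_delta) auto
  finally show ?thesis .
qed

lemma mult_emat_entry:
  assumes "b \<in> carrier A" "M \<in> carrier E" "i < k" "r < k" "c < k"
  shows "(M \<otimes>\<^bsub>E\<^esub> emat i j b) $$ (r, c) = (if c = j then M $$ (r, i) \<otimes> b else \<zero>)"
proof -
  have "(M \<otimes>\<^bsub>E\<^esub> emat i j b) $$ (r, c) = (\<Oplus>l\<in>{..<k}. if l = i then (if c = j then M $$ (r, i) \<otimes> b else \<zero>) else \<zero>)"
    using assms by (simp only: E_entries) (intro finsum_eqI, auto)
  also have "\<dots> = (if c = j then M $$ (r, i) \<otimes> b else \<zero>)"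
    using assms by (intro M.finsum_delta) auto
  finally show ?thesis .
qed

lemma emat_mult: "\<lbrakk>b \<in> carrier A; d \<in> carrier A; j < k\<rbrakk> \<Longrightarrow> emat i j b \<otimes>\<^bsub>E\<^esub> emat j l d = emat i l (b \<otimes> d)"
  by (rule E_eqI) (auto simp: emat_mult_entry simp del: E_entries)

text \<open>Moves a single entry of \<open>M\<close> to a chosen place; this is how entries of the
  projections are extracted.\<close>

lemma emat_compress:
  "\<lbrakk>b \<in> carrier A; d \<in> carrier A; M \<in> carrier E; r < k; c < k\<rbrakk>
    \<Longrightarrow> emat i r b \<otimes>\<^bsub>E\<^esub> M \<otimes>\<^bsub>E\<^esub> emat c j d = emat i j (b \<otimes> M $$ (r, c) \<otimes> d)"
  by (rule E_eqI) (auto simp: emat_mult_entry mult_emat_entry simp del: E_entries)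

lemma emat_add: "\<lbrakk>b \<in> carrier A; d \<in> carrier A\<rbrakk> \<Longrightarrow> emat i j b \<oplus>\<^bsub>E\<^esub> emat i j d = emat i j (b \<oplus> d)"
  by (rule E_eqI) auto

lemma emat_smult: "b \<in> carrier A \<Longrightarrow> c \<odot>\<^bsub>E\<^esub> emat i j b = emat i j (c \<odot> b)"
  by (rule E_eqI) auto

lemma emat_star: "b \<in> carrier A \<Longrightarrow> star E (emat i j b) = emat j i (star A b)"
  by (rule E_eqI) auto

lemma emat_zero: "emat i j \<zero> = \<zero>\<^bsub>E\<^esub>"
  by (rule E_eqI) auto

lemma tends_emat: "tends A f l \<Longrightarrow> tends E (\<lambda>n. emat i j (f n)) (emat i j l)"
  by (rule E_tendsI) (auto simp: tends_def)

lemma finsum_entry: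
  "\<lbrakk>finite I; \<And>x. x \<in> I \<Longrightarrow> F x \<in> carrier E; i < k; j < k\<rbrakk>
    \<Longrightarrow> (\<Oplus>\<^bsub>E\<^esub>x\<in>I. F x) $$ (i, j) = (\<Oplus>x\<in>I. F x $$ (i, j))"
proof (induction I rule: finite_induct)
  case (insert x I)
  have "(\<Oplus>\<^bsub>E\<^esub>x\<in>insert x I. F x) = F x \<oplus>\<^bsub>E\<^esub> (\<Oplus>\<^bsub>E\<^esub>x\<in>I. F x)"
    using insert by (subst EN.M.finsum_insert) auto
  moreover have "(\<Oplus>x\<in>insert x I. F x $$ (i, j)) = F x $$ (i, j) \<oplus> (\<Oplus>x\<in>I. F x $$ (i, j))"
    using insert by (subst M.finsum_insert) auto
  ultimately show ?case using insert by simp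
qed simp

lemma mat_eq_sum_emat:
  assumes M: "M \<in> carrier E"
  shows "M = (\<Oplus>\<^bsub>E\<^esub>i\<in>{..<k}. \<Oplus>\<^bsub>E\<^esub>j\<in>{..<k}. emat i j (M $$ (i, j)))"
proof (rule E_eqI[OF M])
  have row: "(\<Oplus>\<^bsub>E\<^esub>j\<in>{..<k}. emat i j (M $$ (i, j))) \<in> carrier E" if "i < k" for i
    using that M by (intro EE.finsum_in) auto
  then show "(\<Oplus>\<^bsub>E\<^esub>i\<in>{..<k}. \<Oplus>\<^bsub>E\<^esub>j\<in>{..<k}. emat i j (M $$ (i, j))) \<in> carrier E"
    by (rule EE.finsum_in) auto
  fix r c assume rc: "r < k" "c < k"
  have inner: "(\<Oplus>\<^bsub>E\<^esub>j\<in>{..<k}. emat i j (M $$ (i, j))) $$ (r, c) = (if i = r then M $$ (r, c) else \<zero>)"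
    if i: "i < k" for i
  proof -
    have "(\<Oplus>\<^bsub>E\<^esub>j\<in>{..<k}. emat i j (M $$ (i, j))) $$ (r, c) = (\<Oplus>j\<in>{..<k}. emat i j (M $$ (i, j)) $$ (r, c))"
      using i M rc by (intro finsum_entry) auto
    also have "\<dots> = (\<Oplus>j\<in>{..<k}. if j = c then (if i = r then M $$ (r, c) else \<zero>) else \<zero>)"
      using i M rc by (intro finsum_eqI) auto
    also have "\<dots> = (if i = r then M $$ (r, c) else \<zero>)" using i M rc by (intro M.finsum_delta) auto
    finally show ?thesis .
  qed
  have "(\<Oplus>\<^bsub>E\<^esub>i\<in>{..<k}. \<Oplus>\<^bsub>E\<^esub>j\<in>{..<k}. emat i j (M $$ (i, j))) $$ (r, c)
      = (\<Oplus>i\<in>{..<k}. (\<Oplus>\<^bsub>E\<^esub>j\<in>{..<k}. emat i j (M $$ (i, j))) $$ (r, c))"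
    using row rc by (intro finsum_entry) auto
  also have "\<dots> = (\<Oplus>i\<in>{..<k}. if i = r then M $$ (r, c) else \<zero>)"
    using M rc inner by (intro finsum_eqI) auto
  also have "\<dots> = M $$ (r, c)" using M rc by (intro M.finsum_delta) auto
  finally show "M $$ (r, c) = (\<Oplus>\<^bsub>E\<^esub>i\<in>{..<k}. \<Oplus>\<^bsub>E\<^esub>j\<in>{..<k}. emat i j (M $$ (i, j))) $$ (r, c)" by simp
qed

lemma one_eq_sum_emat: "\<one>\<^bsub>E\<^esub> = (\<Oplus>\<^bsub>E\<^esub>i\<in>{..<k}. emat i i \<one>)"
proof (rule E_eqI)
  fix r c assume rc: "r < k" "c < k"
  have "(\<Oplus>\<^bsub>E\<^esub>i\<in>{..<k}. emat i i \<one>) $$ (r, c) = (\<Oplus>i\<in>{..<k}. emat i i \<one> $$ (r, c))"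
    using rc by (intro finsum_entry) auto
  also have "\<dots> = (\<Oplus>i\<in>{..<k}. if i = r then (if r = c then \<one> else \<zero>) else \<zero>)"
    using rc by (intro finsum_eqI) auto
  also have "\<dots> = (if r = c then \<one> else \<zero>)" using rc by (intro M.finsum_delta) auto
  finally show "\<one>\<^bsub>E\<^esub> $$ (r, c) = (\<Oplus>\<^bsub>E\<^esub>i\<in>{..<k}. emat i i \<one>) $$ (r, c)" using rc by simp
qed (auto intro!: EE.finsum_in)

lemma projection_emat: "i < k \<Longrightarrow> projection E (emat i i \<one>)"
  by (simp add: projection_def emat_star emat_mult)

text \<open>The unitary is the permutation matrix of the transposition of \<open>i\<close> and \<open>j\<close>.\<close>

lemma unitarily_equivalent_emat:
  assumes ij: "i < k" "j < k"
  shows "unitarily_equivalent E (emat i i \<one>) (emat j j \<one>)"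
proof -
  define \<tau> where "\<tau> l = (if l = i then j else if l = j then i else l)" for l
  have \<tau>: "\<tau> (\<tau> l) = l" "\<tau> l < k \<longleftrightarrow> l < k" for l using ij by (auto simp: \<tau>_def)
  have \<tau>_eq: "r = \<tau> l \<longleftrightarrow> l = \<tau> r" for r l using \<tau>(1) by metis
  define u where "u = mat k k (\<lambda>(r, c). if c = \<tau> r then \<one> else \<zero>)"
  have u: "u \<in> carrier E" unfolding u_def by (rule mat_in) simp
  have u_entry: "u $$ (r, c) = (if c = \<tau> r then \<one> else \<zero>)" if "r < k" "c < k" for r c
    using that by (simp add: u_def)
  have su: "star E u = u"
    using u \<tau>_eq by (intro E_eqI) (auto simp: u_entry)
  have uu: "u \<otimes>\<^bsub>E\<^esub> u = \<one>\<^bsub>E\<^esub>"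
  proof (rule E_eqI)
    fix r c assume rc: "r < k" "c < k"
    have "(u \<otimes>\<^bsub>E\<^esub> u) $$ (r, c) = (\<Oplus>l\<in>{..<k}. if l = \<tau> r then (if r = c then \<one> else \<zero>) else \<zero>)"
      using rc \<tau> by (simp only: E_entries) (intro finsum_eqI, auto simp: u_entry)
    also have "\<dots> = (if r = c then \<one> else \<zero>)" using rc \<tau> by (intro M.finsum_delta) auto
    finally show "(u \<otimes>\<^bsub>E\<^esub> u) $$ (r, c) = \<one>\<^bsub>E\<^esub> $$ (r, c)" using rc by simp
  qed (use u in simp_all)
  have "u \<otimes>\<^bsub>E\<^esub> emat i i \<one> = emat j i \<one>"
    using u ij \<tau>_eq by (intro E_eqI) (auto simp: mult_emat_entry u_entry \<tau>_def simp del: E_entries)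
  moreover have "emat j i \<one> \<otimes>\<^bsub>E\<^esub> u = emat j j \<one>"
    using u ij by (intro E_eqI) (auto simp: emat_mult_entry u_entry \<tau>_def simp del: E_entries)
  ultimately have "emat j j \<one> = u \<otimes>\<^bsub>E\<^esub> emat i i \<one> \<otimes>\<^bsub>E\<^esub> star E u" by (simp add: su)
  then show ?thesis using u su uu by (auto simp: unitarily_equivalent_def unitary_def)
qed

definition rank_one :: "(nat \<Rightarrow> 'a) \<Rightarrow> 'a mat"
  where "rank_one v = mat k k (\<lambda>(r, c). v r \<otimes> star A (v c))"

lemma rank_one_in: "v \<in> cols k \<Longrightarrow> rank_one v \<in> carrier E"
  unfolding rank_one_def by (rule mat_in) auto

lemma rank_one_entry [simp]: "\<lbrakk>r < k; c < k\<rbrakk> \<Longrightarrow> rank_one v $$ (r, c) = v r \<otimes> star A (v c)"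
  by (simp add: rank_one_def)

text \<open>In \<open>v v\<^sup>* v v\<^sup>*\<close> the two inner factors form
  \<open>\<langle>v, v\<rangle> = 1\<close>.\<close>

lemma projection_rank_one:
  assumes v: "v \<in> cols k" and one: "ip k v v = \<one>"
  shows "projection E (rank_one v)"
proof -
  have vi: "v j \<in> carrier A" if "j < k" for j using v that by auto
  note R = rank_one_in[OF v]
  have "star E (rank_one v) = rank_one v"
    using R vi by (intro E_eqI) (auto simp: star_mult)
  moreover have "rank_one v \<otimes>\<^bsub>E\<^esub> rank_one v = rank_one v"
  proof (rule E_eqI)
    fix r c assume rc: "r < k" "c < k"
    have "(rank_one v \<otimes>\<^bsub>E\<^esub> rank_one v) $$ (r, c) = (\<Oplus>l\<in>{..<k}. v r \<otimes> (star A (v l) \<otimes> v l) \<otimes> star A (v c))"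
      using rc vi by (simp only: E_entries) (intro finsum_eqI, auto simp: mult_assoc)
    also have "\<dots> = v r \<otimes> ip k v v \<otimes> star A (v c)"
      unfolding ip_def using rc vi by (simp add: finsum_lessThan_simps)
    finally show "(rank_one v \<otimes>\<^bsub>E\<^esub> rank_one v) $$ (r, c) = rank_one v $$ (r, c)"
      using rc vi by (simp add: one)
  qed (use R in simp_all)
  ultimately show ?thesis using R by (simp add: projection_def)
qed

end

section \<open>The generating projections\<close>

text \<open>The vectors \<open>v j = b 0 j e\<^sub>0 + \<dots> + b (j - 1) j e\<^bsub>j - 1\<^esub> + s j e\<^sub>j\<close> are the normalised columns of an
  upper triangular matrix close to the identity. The scalars \<open>b 0 j = \<eta>\<close> tie the coordinates
  together; the other entries are free.\<close>

locale projection_family = matrices A k for A :: "'a cstar" (structure) and k :: nat +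
  fixes b :: "nat \<Rightarrow> nat \<Rightarrow> 'a" and \<eta> :: real
  assumes k_ge: "2 \<le> k" and \<eta>_pos: "0 < \<eta>" and \<eta>_le: "real k * \<eta> \<le> 1" and \<eta>_less: "\<eta> < 1"
    and b_in: "\<lbrakk>i < j; j < k\<rbrakk> \<Longrightarrow> b i j \<in> carrier A"
    and b_norm: "\<lbrakk>i < j; j < k\<rbrakk> \<Longrightarrow> cnorm A (b i j) \<le> \<eta>"
    and b_0: "\<lbrakk>0 < j; j < k\<rbrakk> \<Longrightarrow> b 0 j = complex_of_real \<eta> \<odot> \<one>"
begin

text \<open>The inner square of the part of column \<open>j\<close> above the diagonal. The column
  has length 1 when the self-adjoint diagonal entry has square
  \<open>\<one> \<ominus> z j\<close>.\<close>

definition z :: "nat \<Rightarrow> 'a"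
  where "z j = (\<Oplus>i\<in>{..<j}. star A (b i j) \<otimes> b i j)"

text \<open>The choice fixes one root for each column. Two clauses matter later: membership in the
  algebra generated by \<open>z j\<close> keeps \<open>y j\<close> inside every subalgebra
  containing \<open>z j\<close>, and the norm bound forces \<open>y 0 = \<zero>\<close>.\<close>

definition y :: "nat \<Rightarrow> 'a"
  where "y j = (SOME y. y \<in> cstar_generated A {z j} \<and> y \<in> carrier A \<and> star A y = y \<and>
    cnorm A y \<le> cnorm A (z j) \<and> (\<one> \<ominus> y) \<otimes> (\<one> \<ominus> y) = \<one> \<ominus> z j)"

definition s :: "nat \<Rightarrow> 'a"
  where "s j = \<one> \<ominus> y j"

definition v :: "nat \<Rightarrow> nat \<Rightarrow> 'a"
  where "v j i = (if i < j then b i j else if i = j then s j else \<zero>)"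

definition p :: "nat \<Rightarrow> 'a mat"
  where "p j = rank_one (v j)"

lemma z_in: "j < k \<Longrightarrow> z j \<in> carrier A"
  unfolding z_def by (rule finsum_in) (simp add: b_in)

lemma z_star: "j < k \<Longrightarrow> star A (z j) = z j"
  unfolding z_def by (subst star_finsum) (auto simp: b_in star_mult intro!: finsum_eqI)

text \<open>At most \<open>k\<close> summands of norm at most \<open>\<eta>\<^sup>2\<close>, and
  \<open>k \<eta> \<le> 1\<close> absorbs their number. Thus the diagonal deviates from 1 by no more
  than the bound on the other entries.\<close>

lemma z_norm: "j < k \<Longrightarrow> cnorm A (z j) \<le> \<eta>"
proof -
  assume j: "j < k"
  have "cnorm A (z j) \<le> (\<Sum>i<j. cnorm A (star A (b i j) \<otimes> b i j))"
    unfolding z_def using j by (intro norm_finsum) (auto simp: b_in)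
  also have "\<dots> \<le> (\<Sum>i<j. \<eta> * \<eta>)"
    using j b_in b_norm
    by (intro sum_mono) (auto simp: cnorm_star_mult power2_eq_square norm_nonneg intro!: mult_mono less_imp_le[OF \<eta>_pos])
  also have "\<dots> = (real j * \<eta>) * \<eta>" by simp
  also have "\<dots> \<le> (real k * \<eta>) * \<eta>" using j \<eta>_pos by (intro mult_right_mono) auto
  also have "\<dots> \<le> 1 * \<eta>" using \<eta>_pos \<eta>_le by (intro mult_right_mono) auto
  finally show ?thesis by simp
qed

lemma y:
  assumes "j < k"
  shows "y j \<in> cstar_generated A {z j}" "y j \<in> carrier A" "star A (y j) = y j" "cnorm A (y j) \<le> \<eta>"
    "s j \<otimes> s j = \<one> \<ominus> z j" "cnorm A (y j) \<le> cnorm A (z j)"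
proof -
  have "cnorm A (z j) \<le> 1" using z_norm[OF assms] \<eta>_less by simp
  then have "\<exists>y. y \<in> cstar_generated A {z j} \<and> y \<in> carrier A \<and> star A y = y \<and>
      cnorm A y \<le> cnorm A (z j) \<and> (\<one> \<ominus> y) \<otimes> (\<one> \<ominus> y) = \<one> \<ominus> z j"
    using sqrt_one_minus[OF z_in[OF assms] z_star[OF assms]] by metis
  from someI_ex[OF this] show "y j \<in> cstar_generated A {z j}" "y j \<in> carrier A" "star A (y j) = y j"
    "cnorm A (y j) \<le> \<eta>" "s j \<otimes> s j = \<one> \<ominus> z j" "cnorm A (y j) \<le> cnorm A (z j)"
    using z_norm[OF assms] by (auto simp: y_def[symmetric] s_def)
qed

lemma s_in: "j < k \<Longrightarrow> s j \<in> carrier A" and s_star: "j < k \<Longrightarrow> star A (s j) = s j"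
  using y by (simp_all add: s_def star_minus)

lemma v_in: "\<lbrakk>i < k; j < k\<rbrakk> \<Longrightarrow> v j i \<in> carrier A"
  by (simp add: v_def b_in s_in)

lemma v_cols: "j < k \<Longrightarrow> v j \<in> cols k"
  by (simp add: Pi_iff v_in)

lemma v_unit: "j < k \<Longrightarrow> ip k (v j) (v j) = \<one>"
proof -
  assume j: "j < k"
  let ?f = "\<lambda>i. star A (v j i) \<otimes> v j i"
  have "ip k (v j) (v j) = (\<Oplus>i\<in>insert j {..<j}. ?f i)"
    unfolding ip_def using j v_in
    by (intro M.add.finprod_mono_neutral_cong_right) (auto simp: v_def)
  also have "\<dots> = ?f j \<oplus> (\<Oplus>i\<in>{..<j}. ?f i)"
    using j v_in by (subst M.finsum_insert) auto
  also have "(\<Oplus>i\<in>{..<j}. ?f i) = z j"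
    unfolding z_def using j by (intro finsum_eqI) (auto simp: v_def b_in)
  also have "?f j = \<one> \<ominus> z j" using j by (simp add: v_def s_star y(5))
  also have "(\<one> \<ominus> z j) \<oplus> z j = \<one>" using z_in[OF j] by (simp add: minus_add_cancel)
  finally show ?thesis .
qed

lemma v_norm: "\<lbrakk>i < k; j < k\<rbrakk> \<Longrightarrow> cnorm A (v j i) \<le> 1"
proof -
  assume i: "i < k" and j: "j < k"
  have "cnorm A (v j i) \<le> column_norm A k (v j)" by (rule norm_entry_le[OF v_cols[OF j] i])
  also have "\<dots> \<le> 1" unfolding column_norm_eq v_unit[OF j] using norm_one by simp
  finally show ?thesis .
qed

lemma v_close: "\<lbrakk>i < k; j < k\<rbrakk> \<Longrightarrow> cnorm A (v j i \<ominus> unit_col j i) \<le> \<eta>"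
proof -
  assume i: "i < k" and j: "j < k"
  have "s j \<ominus> \<one> = \<ominus> y j" unfolding s_def using y(2)[OF j] by algebra
  then show ?thesis
    using i j b_norm[of i j] b_in[of i j] y[OF j] \<eta>_pos by (auto simp: v_def unit_col_def)
qed

lemma p_in: "j < k \<Longrightarrow> p j \<in> carrier E"
  unfolding p_def by (intro rank_one_in v_cols)

lemma p_projection: "j < k \<Longrightarrow> projection E (p j)"
  unfolding p_def by (intro projection_rank_one v_cols v_unit)

text \<open>Each of the \<open>k\<^sup>2\<close> entries is off by at most \<open>2 \<eta>\<close>,
  one \<open>\<eta>\<close> for replacing each of the two factors \<open>v j\<close> by the basis
  column.\<close>

lemma p_close: "j < k \<Longrightarrow> cnorm E (p j \<ominus>\<^bsub>E\<^esub> emat j j \<one>) \<le> 2 * real k ^ 2 * \<eta>"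
proof -
  assume j: "j < k"
  let ?e = "unit_col j"
  have e: "?e i \<in> carrier A" "star A (?e i) = ?e i" "cnorm A (?e i) \<le> 1" for i
    using norm_one by (simp_all add: unit_col_def)
  have "cnorm A ((p j \<ominus>\<^bsub>E\<^esub> emat j j \<one>) $$ (r, c)) \<le> \<eta> + \<eta>" if rc: "r < k" "c < k" for r c
  proof -
    have vr: "v j r \<in> carrier A" "v j c \<in> carrier A" using rc j v_in by simp_all
    have "(p j \<ominus>\<^bsub>E\<^esub> emat j j \<one>) $$ (r, c) = v j r \<otimes> star A (v j c) \<ominus> ?e r \<otimes> ?e c"
      using rc p_in[OF j] by (simp add: p_def unit_col_def)
    also have "\<dots> = (v j r \<otimes> star A (v j c) \<ominus> ?e r \<otimes> star A (v j c)) \<oplus> (?e r \<otimes> star A (v j c) \<ominus> ?e r \<otimes> ?e c)"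
      using vr e by (intro minus_add_minus) simp_all
    also have "\<dots> = (v j r \<ominus> ?e r) \<otimes> star A (v j c) \<oplus> ?e r \<otimes> star A (v j c \<ominus> ?e c)"
      using vr e by (simp add: mult_minus_left mult_minus_right star_minus)
    finally have "cnorm A ((p j \<ominus>\<^bsub>E\<^esub> emat j j \<one>) $$ (r, c))
        = cnorm A ((v j r \<ominus> ?e r) \<otimes> star A (v j c) \<oplus> ?e r \<otimes> star A (v j c \<ominus> ?e c))" by simp
    also have "\<dots> \<le> cnorm A (v j r \<ominus> ?e r) * cnorm A (star A (v j c))
        + cnorm A (?e r) * cnorm A (star A (v j c \<ominus> ?e c))"
      using vr e by (intro order_trans[OF norm_triangle] add_mono cnorm_mult) simp_all
    also have "\<dots> \<le> \<eta> * 1 + 1 * \<eta>"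
    proof (rule add_mono; rule mult_mono)
      show "cnorm A (star A (v j c)) \<le> 1" using vr v_norm[OF rc(2) j] by simp
      show "cnorm A (star A (v j c \<ominus> ?e c)) \<le> \<eta>" using vr(2) e(1) v_close[OF rc(2) j] by simp
      show "0 \<le> cnorm A (star A (v j c))" "0 \<le> cnorm A (star A (v j c \<ominus> ?e c))"
        using vr(2) e(1) by (simp_all add: norm_nonneg)
    qed (use \<eta>_pos in \<open>simp_all add: e(3) v_close[OF rc(1) j]\<close>)
    finally show ?thesis by simp
  qed
  then have "(\<Sum>r<k. \<Sum>c<k. cnorm A ((p j \<ominus>\<^bsub>E\<^esub> emat j j \<one>) $$ (r, c))) \<le> (\<Sum>r<k. \<Sum>c<k. \<eta> + \<eta>)"
    by (intro sum_mono) auto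
  also have "\<dots> = 2 * real k ^ 2 * \<eta>" by (simp add: power2_eq_square)
  finally show ?thesis using norm_mat_le[of "p j \<ominus>\<^bsub>E\<^esub> emat j j \<one>"] p_in[OF j] by simp
qed

text \<open>The product of the two diagonal matrix units is zero, and replacing the projections by
  these units one at a time costs \<open>p_close\<close> twice.\<close>

lemma p_almost_orthogonal:
  assumes ij: "i < k" "j < k" "i \<noteq> j"
  shows "cnorm E (p i \<otimes>\<^bsub>E\<^esub> p j) \<le> 4 * real k ^ 2 * \<eta>"
proof -
  let ?e = "\<lambda>i. emat i i \<one>"
  note P = p_in[OF ij(1)] p_in[OF ij(2)]
  have e0: "?e i \<otimes>\<^bsub>E\<^esub> ?e j = \<zero>\<^bsub>E\<^esub>"
    using ij by (intro E_eqI) (auto simp: emat_mult_entry simp del: E_entries(1))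
  have "p i \<otimes>\<^bsub>E\<^esub> p j = p i \<otimes>\<^bsub>E\<^esub> p j \<ominus>\<^bsub>E\<^esub> ?e i \<otimes>\<^bsub>E\<^esub> ?e j" using P by (simp add: e0)
  also have "\<dots> = (p i \<otimes>\<^bsub>E\<^esub> p j \<ominus>\<^bsub>E\<^esub> ?e i \<otimes>\<^bsub>E\<^esub> p j) \<oplus>\<^bsub>E\<^esub> (?e i \<otimes>\<^bsub>E\<^esub> p j \<ominus>\<^bsub>E\<^esub> ?e i \<otimes>\<^bsub>E\<^esub> ?e j)"
    using P by (intro EN.minus_add_minus) simp_all
  also have "\<dots> = (p i \<ominus>\<^bsub>E\<^esub> ?e i) \<otimes>\<^bsub>E\<^esub> p j \<oplus>\<^bsub>E\<^esub> ?e i \<otimes>\<^bsub>E\<^esub> (p j \<ominus>\<^bsub>E\<^esub> ?e j)"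
    using P by (simp add: EE.mult_minus_left EE.mult_minus_right)
  finally have "cnorm E (p i \<otimes>\<^bsub>E\<^esub> p j)
      = cnorm E ((p i \<ominus>\<^bsub>E\<^esub> ?e i) \<otimes>\<^bsub>E\<^esub> p j \<oplus>\<^bsub>E\<^esub> ?e i \<otimes>\<^bsub>E\<^esub> (p j \<ominus>\<^bsub>E\<^esub> ?e j))" by simp
  also have "\<dots> \<le> cnorm E (p i \<ominus>\<^bsub>E\<^esub> ?e i) * cnorm E (p j) + cnorm E (?e i) * cnorm E (p j \<ominus>\<^bsub>E\<^esub> ?e j)"
    using P by (intro order_trans[OF EN.norm_triangle] add_mono EE.cnorm_mult) simp_all
  also have "\<dots> \<le> (2 * real k ^ 2 * \<eta>) * 1 + 1 * (2 * real k ^ 2 * \<eta>)"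
  proof (rule add_mono; rule mult_mono)
    show "0 \<le> cnorm E (p j)" "0 \<le> cnorm E (p j \<ominus>\<^bsub>E\<^esub> ?e j)"
      using P by (simp_all add: EN.norm_nonneg)
  qed (use \<eta>_pos p_close[OF ij(1)] p_close[OF ij(2)] EE.norm_projection[OF p_projection[OF ij(2)]]
      EE.norm_projection[OF projection_emat[OF ij(1)]] in simp_all)
  finally show ?thesis by (simp add: mult.commute)
qed

text \<open>The chain runs through \<open>emat i i \<one>\<close> and
  \<open>emat j j \<one>\<close>. The smallness hypothesis puts both projections at distance less
  than 1 from their matrix units.\<close>

lemma p_equivalent:
  assumes small: "2 * real k ^ 2 * \<eta> < 1" and ij: "i < k" "j < k"
  shows "unitarily_equivalent E (p i) (p j)"
proof -
  have "unitarily_equivalent E (p i) (emat i i \<one>)"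
    using p_close[OF ij(1)] small ij by (intro EE.unitarily_equivalent_close p_projection projection_emat) simp_all
  moreover have "unitarily_equivalent E (emat j j \<one>) (p j)"
    using p_close[OF ij(2)] small ij p_in
    by (intro EE.unitarily_equivalent_close p_projection projection_emat)
      (simp_all add: EN.norm_minus_commute[of _ "p j"])
  ultimately show ?thesis
    using EE.unitarily_equivalent_trans[OF EE.unitarily_equivalent_trans[OF _ unitarily_equivalent_emat[OF ij]]]
      p_in[OF ij(1)] by blast
qed

text \<open>The diagonal matrix units sum to 1, so the sum of the projections is within
  \<open>k\<close> times the bound of \<open>p_close\<close> of the unit, and the Neumann series
  inverts it.\<close>

lemma p_sum_invertible:
  assumes small: "2 * real k ^ 3 * \<eta> < 1"
  shows "(\<Oplus>\<^bsub>E\<^esub>j\<in>{..<k}. p j) \<in> Units E"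
proof -
  let ?S = "\<Oplus>\<^bsub>E\<^esub>j\<in>{..<k}. p j"
  have S: "?S \<in> carrier E" by (rule EE.finsum_in) (simp add: p_in)
  have "cnorm E (?S \<ominus>\<^bsub>E\<^esub> \<one>\<^bsub>E\<^esub>) \<le> (\<Sum>j<k. cnorm E (p j \<ominus>\<^bsub>E\<^esub> emat j j \<one>))"
    unfolding one_eq_sum_emat by (rule EN.norm_finsum_minus) (simp_all add: p_in)
  also have "\<dots> \<le> (\<Sum>j<k. 2 * real k ^ 2 * \<eta>)" by (intro sum_mono p_close) simp
  also have "\<dots> < 1" using small by (simp add: power2_eq_square power3_eq_cube algebra_simps)
  finally have "cnorm E (\<one>\<^bsub>E\<^esub> \<ominus>\<^bsub>E\<^esub> ?S) < 1"
    using S by (simp add: EN.norm_minus_commute[of "\<one>\<^bsub>E\<^esub>"])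
  then obtain w where w: "w \<in> cstar_generated E {\<one>\<^bsub>E\<^esub>, \<one>\<^bsub>E\<^esub> \<ominus>\<^bsub>E\<^esub> ?S}"
      "w \<otimes>\<^bsub>E\<^esub> (\<one>\<^bsub>E\<^esub> \<ominus>\<^bsub>E\<^esub> (\<one>\<^bsub>E\<^esub> \<ominus>\<^bsub>E\<^esub> ?S)) = \<one>\<^bsub>E\<^esub>" "(\<one>\<^bsub>E\<^esub> \<ominus>\<^bsub>E\<^esub> (\<one>\<^bsub>E\<^esub> \<ominus>\<^bsub>E\<^esub> ?S)) \<otimes>\<^bsub>E\<^esub> w = \<one>\<^bsub>E\<^esub>"
    using EE.inverse_one_minus[of "\<one>\<^bsub>E\<^esub> \<ominus>\<^bsub>E\<^esub> ?S"] S by (metis E_closed(5) EN.minus_in)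
  have "\<one>\<^bsub>E\<^esub> \<ominus>\<^bsub>E\<^esub> (\<one>\<^bsub>E\<^esub> \<ominus>\<^bsub>E\<^esub> ?S) = ?S" using S E_closed(5) by algebra
  moreover have "w \<in> carrier E"
    using EE.subalgebra_carrier[OF EE.subalgebra_generated w(1)] S by simp
  ultimately show ?thesis using w(2,3) S by (auto simp: Units_def)
qed

section \<open>Recovering the whole matrix algebra from the projections\<close>

context
  fixes C :: "'a mat set"
  assumes C: "cstar_subalgebra C E" and pC: "\<And>j. j < k \<Longrightarrow> p j \<in> C"
begin

text \<open>The corner of \<open>C\<close> at position (0, 0), viewed as a subset of
  \<open>A\<close>; the recovered entries are collected here.\<close>

definition D :: "'a set"
  where "D = {d \<in> carrier A. emat 0 0 d \<in> C}"

lemma D_subalgebra: "cstar_subalgebra D A"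
  unfolding subalgebra_iff
proof (intro conjI ballI allI impI)
  fix x w assume "x \<in> D" "w \<in> D"
  then show "x \<oplus> w \<in> D" "x \<otimes> w \<in> D"
    using EE.subalgebra_add[OF C, of "emat 0 0 x" "emat 0 0 w"] EE.subalgebra_mult[OF C, of "emat 0 0 x" "emat 0 0 w"] k_ge
    by (simp_all add: D_def emat_add emat_mult)
next
  fix x c assume "x \<in> D"
  then show "c \<odot> x \<in> D" "star A x \<in> D"
    using EE.subalgebra_smult[OF C, of "emat 0 0 x" c] EE.subalgebra_star[OF C, of "emat 0 0 x"]
    by (simp_all add: D_def emat_smult emat_star)
next
  fix f l assume f: "(\<forall>n. f n \<in> D) \<and> tends A f l"
  then have "tends E (\<lambda>n. emat 0 0 (f n)) (emat 0 0 l)" by (intro tends_emat) simp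
  then have "emat 0 0 l \<in> C"
    by (rule EE.subalgebra_tends[OF C, rotated]) (use f in \<open>simp add: D_def\<close>)
  then show "l \<in> D" using f by (simp add: D_def tends_def)
qed (use EE.subalgebra_zero[OF C] in \<open>auto simp: D_def emat_zero\<close>)

text \<open>Column 0 has nothing above the diagonal, so \<open>z 0\<close> is zero. The bound of
  \<open>y 0\<close> by the norm of \<open>z 0\<close> excludes every root of 1 other than 1
  itself.\<close>

lemma emat_00_in_C: "emat 0 0 \<one> \<in> C"
proof -
  have 0: "0 < k" using k_ge by simp
  have "z 0 = \<zero>" by (simp add: z_def)
  then have "cnorm A (y 0) = 0" using y(6)[OF 0] norm_nonneg[OF y(2)[OF 0]] by simp
  then have "y 0 = \<zero>" using norm_eq_0[OF y(2)[OF 0]] by simp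
  then have "s 0 = \<one>" by (simp add: s_def)
  then have "p 0 = emat 0 0 \<one>"
    using p_in[OF 0] by (intro E_eqI) (auto simp: p_def v_def)
  then show ?thesis using pC[OF 0] by simp
qed

lemma one_in_D: "\<one> \<in> D"
  using emat_00_in_C by (simp add: D_def)

lemma scalar_unscale:
  assumes "x \<in> carrier A" shows "complex_of_real (1 / \<eta>) \<odot> (complex_of_real \<eta> \<odot> x) = x"
  using assms \<eta>_pos by simp

text \<open>The two claims are proved together: reading the entries of column \<open>j\<close> takes
  the matrix units of the earlier columns, and obtaining its own unit takes the inverse of
  \<open>s j\<close>, which is built from those entries.\<close>

lemma emat_0_in_C:
  assumes "j < k"
  shows "emat 0 j \<one> \<in> C \<and> (\<forall>i<j. b i j \<in> D)"
  using assms
proof (induction j rule: less_induct)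
  case (less j)
  note j = less.prems
  show ?case
  proof (cases "j = 0")
    case True
    then show ?thesis using emat_00_in_C by simp
  next
    case False
    then have j0: "0 < j" by simp
    have k0: "0 < k" using k_ge by simp
    note P = p_in[OF j]
    have row0: "emat 0 i \<one> \<in> C" if "i < j" for i using less.IH[of i] that j by simp
    have col0: "emat i 0 \<one> \<in> C" if "i < j" for i
      using EE.subalgebra_star[OF C row0[OF that]] by (simp add: emat_star)
    have v0: "v j 0 = complex_of_real \<eta> \<odot> \<one>" using j0 j by (simp add: v_def b_0)
    \<comment> \<open>As the top entry of the column is the scalar \<open>\<eta>\<close>, row 0 of
      the projection shows the adjoints of the single entries.\<close>
    have p0: "p j $$ (0, c) = complex_of_real \<eta> \<odot> star A (v j c)" if "c < k" for c
      using that k0 v_in[OF that j] by (simp add: p_def v0 mult_smult_left)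
    have bD: "b i j \<in> D" if i: "i < j" for i
    proof -
      have bc: "b i j \<in> carrier A" using b_in i j by simp
      have "emat 0 0 \<one> \<otimes>\<^bsub>E\<^esub> p j \<otimes>\<^bsub>E\<^esub> emat i 0 \<one> \<in> C"
        using EE.subalgebra_mult[OF C] emat_00_in_C pC[OF j] col0[OF i] by simp
      also have "emat 0 0 \<one> \<otimes>\<^bsub>E\<^esub> p j \<otimes>\<^bsub>E\<^esub> emat i 0 \<one> = emat 0 0 (complex_of_real \<eta> \<odot> star A (b i j))"
        using P i j k0 bc by (subst emat_compress) (simp_all add: p0 v_def)
      finally have "complex_of_real \<eta> \<odot> star A (b i j) \<in> D" using bc by (simp add: D_def)
      then have "complex_of_real (1 / \<eta>) \<odot> (complex_of_real \<eta> \<odot> star A (b i j)) \<in> D"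
        by (rule subalgebra_smult[OF D_subalgebra])
      then have "star A (b i j) \<in> D" using scalar_unscale[of "star A (b i j)"] bc by (simp only: star_closed)
      then have "star A (star A (b i j)) \<in> D" by (rule subalgebra_star[OF D_subalgebra])
      then show ?thesis using bc by simp
    qed
    \<comment> \<open>With the entries in the corner, so are \<open>z j\<close>, the element
      \<open>y j\<close> that lies in the algebra generated by it, and the inverse \<open>w\<close>
      of \<open>s j\<close>, which the Neumann series places in the algebra generated by 1 and
      \<open>y j\<close>.\<close>
    have "z j \<in> D"
      unfolding z_def using bD
      by (intro subalgebra_finsum[OF D_subalgebra]) (auto intro!: subalgebra_mult[OF D_subalgebra] subalgebra_star[OF D_subalgebra])
    then have yD: "y j \<in> D" using generated_minimal[OF D_subalgebra, of "{z j}"] y(1)[OF j] by auto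
    have "cnorm A (y j) < 1" using y(4)[OF j] \<eta>_less by simp
    then obtain w where w: "w \<in> cstar_generated A {\<one>, y j}" "w \<otimes> s j = \<one>"
      using inverse_one_minus[OF y(2)[OF j]] unfolding s_def by metis
    have wD: "w \<in> D" using generated_minimal[OF D_subalgebra, of "{\<one>, y j}"] w(1) yD one_in_D by auto
    then have wc: "w \<in> carrier A" by (simp add: D_def)
    define R where "R = emat 0 0 \<one> \<otimes>\<^bsub>E\<^esub> p j"
    have R: "R \<in> C" unfolding R_def using EE.subalgebra_mult[OF C] emat_00_in_C pC[OF j] by simp
    have Rc: "R \<in> carrier E" using P by (simp add: R_def)
    have R_entry: "R $$ (r, c) = (if r = 0 then complex_of_real \<eta> \<odot> star A (v j c) else \<zero>)"
      if "r < k" "c < k" for r c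
      unfolding R_def using that P k0 v_in[OF that(2) j] by (simp add: emat_mult_entry p0 del: E_entries)
    \<comment> \<open>\<open>T\<close> is the part of the row \<open>R\<close> in the columns before
      \<open>j\<close>, cut out by diagonal units already in \<open>C\<close>. Entries after column
      \<open>j\<close> vanish by triangularity, so subtracting \<open>T\<close> isolates column
      \<open>j\<close>; no unit of the matrix algebra is required in \<open>C\<close>.\<close>
    define T where "T = (\<Oplus>\<^bsub>E\<^esub>i\<in>{..<j}. R \<otimes>\<^bsub>E\<^esub> emat i i \<one>)"
    have "emat i i \<one> \<in> C" if "i < j" for i
      using EE.subalgebra_mult[OF C col0[OF that] row0[OF that]] k0 by (simp add: emat_mult)
    then have TC: "T \<in> C"
      unfolding T_def using R by (intro EE.subalgebra_finsum[OF C]) (auto intro: EE.subalgebra_mult[OF C])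
    have Tc: "T \<in> carrier E" using EE.subalgebra_carrier[OF C TC] .
    have T_entry: "T $$ (r, c) = (if c < j then R $$ (r, c) else \<zero>)" if rc: "r < k" "c < k" for r c
    proof -
      have "T $$ (r, c) = (\<Oplus>i\<in>{..<j}. (R \<otimes>\<^bsub>E\<^esub> emat i i \<one>) $$ (r, c))"
        unfolding T_def using rc Rc by (intro finsum_entry) auto
      also have "\<dots> = (\<Oplus>i\<in>{..<j}. if i = c then R $$ (r, c) else \<zero>)"
        using rc Rc j by (intro finsum_eqI) (auto simp: mult_emat_entry simp del: E_entries)
      also have "\<dots> = (if c < j then R $$ (r, c) else \<zero>)"
      proof (cases "c < j")
        case True
        then show ?thesis using rc Rc by (simp add: M.finsum_delta)
      next
        case False
        then have "(\<Oplus>i\<in>{..<j}. if i = c then R $$ (r, c) else \<zero>) = (\<Oplus>i\<in>{..<j}. \<zero>)"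
          by (intro finsum_eqI) auto
        with False show ?thesis by simp
      qed
      finally show ?thesis .
    qed
    have "R \<ominus>\<^bsub>E\<^esub> T = emat 0 j (complex_of_real \<eta> \<odot> s j)"
    proof (rule E_eqI)
      fix r c assume rc: "r < k" "c < k"
      show "(R \<ominus>\<^bsub>E\<^esub> T) $$ (r, c) = emat 0 j (complex_of_real \<eta> \<odot> s j) $$ (r, c)"
        using rc Rc Tc j v_in[OF rc(2) j] s_in[OF j] s_star[OF j]
        by (auto simp: R_entry T_entry v_def)
    qed (use Rc Tc s_in[OF j] in simp_all)
    then have "emat 0 j (complex_of_real \<eta> \<odot> s j) \<in> C" using EE.subalgebra_minus[OF C R TC] by simp
    \<comment> \<open>The corner element \<open>w\<close> cancels \<open>s j\<close> from the left,
      and the factor \<open>1 / \<eta>\<close> then removes the scalar.\<close>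
    then have "emat 0 0 w \<otimes>\<^bsub>E\<^esub> emat 0 j (complex_of_real \<eta> \<odot> s j) \<in> C"
      using wD by (intro EE.subalgebra_mult[OF C]) (simp_all add: D_def)
    also have "emat 0 0 w \<otimes>\<^bsub>E\<^esub> emat 0 j (complex_of_real \<eta> \<odot> s j) = emat 0 j (complex_of_real \<eta> \<odot> \<one>)"
      using wc k0 s_in[OF j] w(2) by (simp add: emat_mult mult_smult_right)
    finally have "complex_of_real (1 / \<eta>) \<odot>\<^bsub>E\<^esub> emat 0 j (complex_of_real \<eta> \<odot> \<one>) \<in> C"
      by (rule EE.subalgebra_smult[OF C])
    also have "complex_of_real (1 / \<eta>) \<odot>\<^bsub>E\<^esub> emat 0 j (complex_of_real \<eta> \<odot> \<one>) = emat 0 j \<one>"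
      using scalar_unscale[of \<one>] by (simp only: emat_smult smult_in one_closed)
    finally show ?thesis using bD by simp
  qed
qed

text \<open>Once the corner is all of \<open>A\<close>, a matrix unit with coefficient
  \<open>m\<close> factors as \<open>emat i 0 \<one>\<close>, \<open>emat 0 0 m\<close>,
  \<open>emat 0 j \<one>\<close>, and every matrix is a finite sum of such.\<close>

lemma C_eq_carrier:
  assumes gen: "\<And>B. \<lbrakk>cstar_subalgebra B A; \<one> \<in> B; \<And>i j. \<lbrakk>i < j; j < k\<rbrakk> \<Longrightarrow> b i j \<in> B\<rbrakk> \<Longrightarrow> B = carrier A"
  shows "C = carrier E"
proof -
  have D: "D = carrier A"
    using D_subalgebra one_in_D emat_0_in_C by (intro gen) auto
  have "emat i j m \<in> C" if "i < k" "j < k" "m \<in> carrier A" for i j m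
  proof -
    have "emat 0 0 m \<in> C" using that D by (auto simp: D_def)
    moreover have "emat i 0 \<one> \<in> C"
      using EE.subalgebra_star[OF C, of "emat 0 i \<one>"] emat_0_in_C[OF that(1)] by (simp add: emat_star)
    ultimately have "emat i 0 \<one> \<otimes>\<^bsub>E\<^esub> emat 0 0 m \<otimes>\<^bsub>E\<^esub> emat 0 j \<one> \<in> C"
      using emat_0_in_C[OF that(2)] by (auto intro!: EE.subalgebra_mult[OF C])
    then show ?thesis using that k_ge by (simp add: emat_mult)
  qed
  then have "M \<in> C" if "M \<in> carrier E" for M
    using that by (subst mat_eq_sum_emat[OF that]) (auto intro!: EE.subalgebra_finsum[OF C])
  then show ?thesis using EE.subalgebra_carrier[OF C] by blast
qed

end

end

section \<open>Counting the free entries and choosing the constants\<close>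

text \<open>Row 0 is left out because it holds the scalars \<open>\<eta>\<close>; column
  \<open>j\<close> then has \<open>j - 1\<close> places, and truncated subtraction gives 0 for
  \<open>j = 0\<close> as it should.\<close>

lemma card_upper_triangle:
  "finite {(i, j). 1 \<le> i \<and> i < j \<and> j < (k :: nat)}"
  "2 * card {(i, j). 1 \<le> i \<and> i < j \<and> j < k} = (k - 1) * (k - 2)"
proof -
  have eq: "{(i, j). 1 \<le> i \<and> i < j \<and> j < k} = (\<lambda>(j, i). (i, j)) ` (SIGMA j:{..<k}. {1..<j})" for k :: nat
    by (auto simp: image_iff)
  show "finite {(i, j). 1 \<le> i \<and> i < j \<and> j < k}" unfolding eq by simp
  have "card {(i, j). 1 \<le> i \<and> i < j \<and> j < k} = card (SIGMA j:{..<k}. {1..<j})"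
    unfolding eq by (rule card_image) (auto simp: inj_on_def)
  also have "\<dots> = (\<Sum>j<k. j - 1)" by simp
  finally have "card {(i, j). 1 \<le> i \<and> i < j \<and> j < k} = (\<Sum>j<k. j - 1)" .
  moreover have "2 * (\<Sum>j<k. j - 1) = (k - 1) * (k - 2)"
  proof (induction k)
    case (Suc k)
    then show ?case by (cases k; cases "k - 1") (simp_all add: algebra_simps)
  qed simp
  ultimately show "2 * card {(i, j). 1 \<le> i \<and> i < j \<and> j < k} = (k - 1) * (k - 2)" by simp
qed

text \<open>The product vanishes at 1 and 2, so \<open>n \<ge> 1\<close> pushes
  \<open>delta n\<close> to at least 3. From there on both factors are nonnegative, the product is
  monotone, and natural subtraction agrees with integer subtraction.\<close>

lemma delta_le:
  assumes "delta n \<le> k" "1 \<le> n"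
  shows "3 \<le> k" "2 * n \<le> (k - 1) * (k - 2)"
proof -
  let ?P = "\<lambda>k. 1 \<le> k \<and> (int k - 1) * (int k - 2) \<ge> 2 * int n"
  \<comment> \<open>The number \<open>2 n + 2\<close> satisfies the condition, so the least one does
    as well.\<close>
  have "(int n * 2 + 1) * (int n * 2) \<ge> 1 * (int n * 2)" by (intro mult_right_mono) auto
  then have "?P (2 * n + 2)" by (simp add: algebra_simps)
  then have d: "?P (delta n)" unfolding delta_def by (rule LeastI)
  have "\<not> delta n \<le> 2"
  proof
    assume "delta n \<le> 2"
    with d have "delta n = 1 \<or> delta n = 2" by auto
    with d \<open>1 \<le> n\<close> show False by auto
  qed
  then have d3: "delta n \<ge> 3" by simp
  then show k3: "3 \<le> k" using assms by simp
  have "(int (delta n) - 1) * (int (delta n) - 2) \<le> (int k - 1) * (int k - 2)"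
    using d3 assms by (intro mult_mono) auto
  with d have "2 * int n \<le> (int k - 1) * (int k - 2)" by linarith
  also have "\<dots> = int ((k - 1) * (k - 2))" using k3 by (simp add: of_nat_diff)
  finally show "2 * n \<le> (k - 1) * (k - 2)" by presburger
qed

context matrices
begin

text \<open>The generators occupy distinct free entries, scaled down to norm at most
  \<open>\<eta>\<close>; nonzero scaling does not change what they generate.\<close>

theorem generated_by_projections:
  assumes k3: "3 \<le> k" and nk: "2 * n \<le> (k - 1) * (k - 2)"
    and a: "\<And>m. m \<in> {1..n} \<Longrightarrow> a m \<in> carrier A"
    and gen: "\<And>B. \<lbrakk>cstar_subalgebra B A; \<one> \<in> B; \<And>m. m \<in> {1..n} \<Longrightarrow> a m \<in> B\<rbrakk> \<Longrightarrow> B = carrier A"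
  shows "generated_by_almost_orthogonal_projections E k"
  unfolding generated_by_almost_orthogonal_projections_def
proof (intro conjI allI impI unital_matrices)
  show "2 \<le> k" using k3 by simp
  fix \<epsilon> :: real assume \<epsilon>: "\<epsilon> > 0"
  let ?P = "{(i, j). 1 \<le> i \<and> i < j \<and> j < k}"
  have "card {1..n} \<le> card ?P" using card_upper_triangle(2)[of k] nk by simp
  then obtain f where f: "f ` {1..n} \<subseteq> ?P" "inj_on f {1..n}"
    using card_le_inj[of "{1..n}" ?P] card_upper_triangle(1)[of k] by auto
  \<comment> \<open>A common bound for the generators; the summand 1 keeps it positive even if all
    of them are zero.\<close>
  define K where "K = 1 + (\<Sum>m\<in>{1..n}. cnorm A (a m))"
  have sum0: "0 \<le> (\<Sum>m\<in>{1..n}. cnorm A (a m))" using a by (intro sum_nonneg norm_nonneg)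
  then have K: "K \<ge> 1" by (simp add: K_def)
  have aK: "cnorm A (a m) \<le> K" if "m \<in> {1..n}" for m
    using that a member_le_sum[of m "{1..n}" "\<lambda>m. cnorm A (a m)"] by (simp add: K_def norm_nonneg)
  \<comment> \<open>One choice meets all requirements:
    \<open>8 k\<^sup>3 \<eta> = min 1 \<epsilon>\<close> gives \<open>k \<eta> \<le> 1\<close>,
    \<open>2 k\<^sup>2 \<eta> < 1\<close>, \<open>2 k\<^sup>3 \<eta> < 1\<close> and
    \<open>4 k\<^sup>2 \<eta> < \<epsilon>\<close>.\<close>
  define \<eta> where "\<eta> = min 1 \<epsilon> / (8 * real k ^ 3)"
  have k3': "real k ^ 3 > 0" using k3 by simp
  have \<eta>8: "8 * real k ^ 3 * \<eta> = min 1 \<epsilon>" using k3' by (simp add: \<eta>_def)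
  have \<eta>0: "\<eta> > 0" using \<epsilon> k3' by (simp add: \<eta>_def)
  have pow: "1 \<le> real k ^ 3" "real k \<le> real k ^ 3" "real k ^ 2 \<le> real k ^ 3"
    using k3 power_increasing[of 0 3 "real k"] power_increasing[of 1 3 "real k"] power_increasing[of 2 3 "real k"]
    by simp_all
  have pow\<eta>: "\<eta> \<le> real k ^ 3 * \<eta>" "real k * \<eta> \<le> real k ^ 3 * \<eta>" "real k ^ 2 * \<eta> \<le> real k ^ 3 * \<eta>"
    using mult_right_mono[OF pow(1), of \<eta>] mult_right_mono[OF pow(2), of \<eta>] mult_right_mono[OF pow(3), of \<eta>] \<eta>0
    by simp_all
  have le1: "8 * (real k ^ 3 * \<eta>) \<le> 1" "8 * (real k ^ 3 * \<eta>) \<le> \<epsilon>" using \<eta>8 by simp_all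
  define h where "h = inv_into {1..n} f"
  have hf: "h (f m) = m" if "m \<in> {1..n}" for m using f that by (simp add: h_def)
  have h_in: "h x \<in> {1..n}" if "x \<in> f ` {1..n}" for x using that hf by auto
  \<comment> \<open>Free places not hit by \<open>f\<close> are filled with zero, since
    \<open>k\<close> may leave more room than there are generators.\<close>
  define b where "b i j = (if i = 0 then complex_of_real \<eta> \<odot> \<one>
      else if (i, j) \<in> f ` {1..n} then complex_of_real (\<eta> / K) \<odot> a (h (i, j)) else \<zero>)" for i j
  interpret F: projection_family A k b \<eta>
  proof
    show "2 \<le> k" "0 < \<eta>" using k3 \<eta>0 by simp_all
    show "real k * \<eta> \<le> 1" "\<eta> < 1" using pow\<eta> le1 \<eta>0 by linarith+
    fix i j assume "i < j" "j < k"
    show "b i j \<in> carrier A" using a h_in by (auto simp: b_def)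
    have "\<eta> / K * cnorm A (a m) \<le> \<eta>" if "m \<in> {1..n}" for m
      using aK[OF that] K \<eta>0 by (simp add: field_simps)
    then show "cnorm A (b i j) \<le> \<eta>"
      using a h_in K \<eta>0 norm_scalar[of \<eta>] by (auto simp: b_def norm_smult norm_divide)
  qed (simp add: b_def)
  \<comment> \<open>The family is indexed from 0, like matrix rows, while the definition of the
    property counts from 1.\<close>
  define p where "p i = F.p (i - 1)" for i
  have range: "{1..k} = Suc ` {..<k}" by (simp add: image_Suc_lessThan)
  have image: "p ` {1..k} = F.p ` {..<k}" unfolding range by (simp only: image_image p_def diff_Suc_1)
  have "(\<Oplus>\<^bsub>E\<^esub>i\<in>{1..k}. p i) = (\<Oplus>\<^bsub>E\<^esub>i\<in>{..<k}. p (Suc i))"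
    unfolding range by (rule EN.M.finsum_reindex) (auto simp: p_def F.p_in)
  then have "(\<Oplus>\<^bsub>E\<^esub>i\<in>{1..k}. p i) = (\<Oplus>\<^bsub>E\<^esub>i\<in>{..<k}. F.p i)" by (simp add: p_def)
  moreover have "(\<Oplus>\<^bsub>E\<^esub>i\<in>{..<k}. F.p i) \<in> Units E"
    using le1 pow\<eta> \<eta>0 by (intro F.p_sum_invertible) linarith
  ultimately have inv: "(\<Oplus>\<^bsub>E\<^esub>i\<in>{1..k}. p i) \<in> Units E" by simp
  have "cstar_subalgebra (cstar_generated E (p ` {1..k})) E"
    unfolding image by (intro EE.subalgebra_generated) (auto simp: F.p_in)
  then have gen_E: "cstar_generated E (p ` {1..k}) = carrier E"
  proof (rule F.C_eq_carrier)
    show "F.p j \<in> cstar_generated E (p ` {1..k})" if "j < k" for j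
      using EE.generated_superset[of "p ` {1..k}"] that image by auto
    fix B assume B: "cstar_subalgebra B A" "\<one> \<in> B" "\<And>i j. \<lbrakk>i < j; j < k\<rbrakk> \<Longrightarrow> b i j \<in> B"
    have "a m \<in> B" if m: "m \<in> {1..n}" for m
    proof -
      obtain i j where fm: "f m = (i, j)" by fastforce
      have "f m \<in> ?P" by (rule subsetD[OF f(1) imageI[OF m]])
      then have ij: "1 \<le> i" "i < j" "j < k" by (simp_all add: fm)
      have "(i, j) \<in> f ` {1..n}" using imageI[OF m, of f] by (simp only: fm)
      then have "b i j = complex_of_real (\<eta> / K) \<odot> a m"
        using hf[OF m] ij(1) by (simp add: b_def fm)
      then have "complex_of_real (K / \<eta>) \<odot> (complex_of_real (\<eta> / K) \<odot> a m) \<in> B"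
        using B(3)[OF ij(2,3)] subalgebra_smult[OF B(1)] by simp
      then show ?thesis using a[OF m] K \<eta>0 by simp
    qed
    then show "B = carrier A" by (rule gen[OF B(1,2)])
  qed
  have small: "2 * real k ^ 2 * \<eta> < 1" using le1 pow\<eta> \<eta>0 by linarith
  show "\<exists>p :: nat \<Rightarrow> 'a mat. (\<forall>i\<in>{1..k}. projection E (p i)) \<and> (\<Oplus>\<^bsub>E\<^esub>i\<in>{1..k}. p i) \<in> Units E \<and>
      cstar_generated E (p ` {1..k}) = carrier E \<and>
      (\<forall>i\<in>{1..k}. \<forall>j\<in>{1..k}. i \<noteq> j \<longrightarrow>
        unitarily_equivalent E (p i) (p j) \<and> cnorm E (p i \<otimes>\<^bsub>E\<^esub> p j) < \<epsilon>)"
  proof (intro exI[of _ p] conjI ballI impI inv gen_E)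
    fix i assume i: "i \<in> {1..k}"
    then show "projection E (p i)" unfolding p_def by (intro F.p_projection) auto
    fix j assume j: "j \<in> {1..k}" and ij: "i \<noteq> j"
    show "unitarily_equivalent E (p i) (p j)"
      unfolding p_def using i j by (intro F.p_equivalent[OF small]) auto
    have "cnorm E (p i \<otimes>\<^bsub>E\<^esub> p j) \<le> 4 * real k ^ 2 * \<eta>"
      unfolding p_def using i j ij by (intro F.p_almost_orthogonal) auto
    also have "\<dots> < \<epsilon>" using le1 pow\<eta> \<eta>0 by linarith
    finally show "cnorm E (p i \<otimes>\<^bsub>E\<^esub> p j) < \<epsilon>" .
  qed
qed

end

theorem theorem2p3:
  fixes A :: "'a cstar" and a :: "nat \<Rightarrow> 'a" and n k :: nat
  assumes "n \<ge> 1"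
    and "cstar_algebra A"
    and "a ` {1..n} \<subseteq> carrier A"
    and "carrier A = cstar_generated A (a ` {1..n})"
    and "k \<ge> delta n"
  shows "generated_by_almost_orthogonal_projections (mat_cstar k (unitization A)) k"
proof -
  interpret A: cstar_algebra A by fact
  interpret M: matrices "unitization A" k
    by (intro matrices.intro A.unital_unitization)
  show ?thesis
  \<comment> \<open>Only subalgebras of the unitization that contain its unit have to be considered,
    so the \<open>n\<close> generators of \<open>A\<close> are enough even when a unit is
    adjoined.\<close>
  proof (rule M.generated_by_projections[where a = "\<lambda>m. (a m, 0)" and n = n])
    show "3 \<le> k" "2 * n \<le> (k - 1) * (k - 2)" using delta_le assms(1,5) by auto
    show "(a m, 0) \<in> carrier (unitization A)" if "m \<in> {1..n}" for m
      using assms(3) that by (auto simp: A.unitization_simps)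
    fix B assume B: "cstar_subalgebra B (unitization A)" "\<one>\<^bsub>unitization A\<^esub> \<in> B"
      and "\<And>m. m \<in> {1..n} \<Longrightarrow> (a m, 0) \<in> B"
    then show "B = carrier (unitization A)"
      by (intro A.unitization_generated[OF assms(4)]) (use assms(3) in auto)
  qed
qed

end
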